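(* Let $(X_t)_{t\ge0}$ be a rich Feller process such that its Feller generator $(\mathscr A,\mathscr D(\mathscr A))$ is a Lévy-type operator in $\mathbb R^d$ with characteristic triplet $(a,b,\Pi)$, and let $\pi=(\nu,\mu,\rho)$ be a convenient decomposition of the Lévy kernel $\Pi$. Let $\eta\in\mathcal M(\mathscr A,\pi)$ be finite. Consider the distributional equation $$-\nabla\cdot((a+a_\pi)\eta)+\tfrac12\nabla\cdot b\nabla\eta+U^\pi(\eta)-\nabla\cdot V^\pi(\eta)+\mathbf H\cdot W^\pi(\eta)=0.\qquad( * )$$ If a core of $(\mathscr A,\mathscr D(\mathscr A))$ is contained in $\mathcal C_c^\infty(\mathbb R^d)$, and $\eta$ solves $( * )$, then $\eta$ is invariant for $(X_t)_{t\ge0}$. Conversely, if $\eta$ is invariant for $(X_t)_{t\ge0}$, then it solves $( * )$.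
   Context: **Feller processes.** For a time-homogeneous Markov process in $\mathbb R^d$ put $P_tf(x)=\mathbb E^x[f(X_t)]$, $f\in\mathcal C_\infty(\mathbb R^d)$ (continuous functions vanishing at infinity). It is Feller if $P_t\mathcal C_\infty\subset\mathcal C_\infty$ and $\|P_tf-f\|_\infty\to0$ as $t\downarrow0$ for all $f\in\mathcal C_\infty$. Its Feller generator is $\mathscr Af=\lim_{t\downarrow0}t^{-1}(P_tf-f)$ on $\mathscr D(\mathscr A)=\{f\in\mathcal C_\infty(\mathbb R^d):\text{the limit exists in }\|\cdot\|_\infty\}$. It is rich if $\mathcal C_c^\infty(\mathbb R^d)\subset\mathscr D(\mathscr A)$. A (positive) measure $\eta$ is invariant if $\int\mathbb P^x(X_t\in B)\eta(dx)=\eta(B)$ for all $t\ge0$ and Borel $B$. **Lévy-type operators.** Let $\mathcal E$ be a Banach space of functions $f:\mathbb R^d\to\mathbb R$. A Lévy-type operator is a pair $(\mathcal A,\mathscr D(\mathcal A))$ with $\mathscr D(\mathcal A)\subset\mathcal E$ and $\mathcal A:\mathscr D(\mathcal A)\to\mathcal E$ of the form $$\mathcal Af(x)=a(x)\cdot\nabla f(x)+\tfrac12\nabla\cdot b(x)\nabla f(x)+\int_{\mathbb R^d}\big(f(x+y)-f(x)-\nabla f(x)\cdot y\mathbf 1_{\{|y|<1\}}\big)\Pi(x,dy),$$ where $\nabla\cdot b\nabla f=\sum_{i,j}\partial_i(b_{ij}\partial_jf)$, $a:\mathbb R^d\to\mathbb R^d$ is Borel, $b$ is Borel with values in the symmetric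 positive semidefinite $d\times d$ matrices, and $\Pi$ is a Lévy kernel: $\Pi(x,\cdot)$ is a Lévy measure on $\mathbb R^d$ for each $x$, $\Pi(\cdot,B)$ is Borel for each Borel $B$, $\Pi(x,\{0\})=0$. $(a,b,\Pi)$ is the characteristic triplet. **Convenient decomposition.** $\pi=(\nu,\mu,\rho)$ is a convenient decomposition of $\Pi$ if there are non-negative continuous functions $h_\nu,h_\mu,h_\rho$ on $\mathbb R^d$ with $\nu=h_\nu\Pi$, $\mu=h_\mu\Pi$, $\rho=h_\rho\Pi$, $\Pi=\nu+\mu+\rho$, and for all $x$: $\nu(x,\mathbb R^d)<\infty$, $\int(1\wedge|y|)\mu(x,dy)<\infty$, $\int(|y|\wedge|y|^2)\rho(x,dy)<\infty$. Put $a_\pi(x)=-\int_{|y|<1}y\,\nu(x,dy)-\int_{|y|<1}y\,\mu(x,dy)+\int_{|y|\ge1}y\,\rho(x,dy)$. **Integrated tails.** A polar decomposition of a $\sigma$-finite measure $Q$ on $\mathbb R^d$ with $Q(\{0\})=0$ is a finite measure $Q_o$ on $S^{d-1}$ and a measurable family $(Q_\xi)_{\xi\in S^{d-1}}$ of $\sigma$-finite measures on $(0,\infty)$ with $Q_\xi((0,\infty))>0$ and $Q(B)=\int_{S^{d-1}}\int_{(0,\infty)}\mathbf 1_B(r\xi)Q_\xi(dr)Q_o(d\xi)$. For a Lévy kernel $Q$ choose for each $x$ a polar decomposition of $Q(x,\cdot)$ whose radial parts are Lévy measures. The integrated radial tail is $\overline Q(x,B)=\int_{S^{d-1}}\int_{(0,\infty)}\mathbf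 1_B(z\xi)\int_{(z,\infty)}Q_\xi(x,dr)\,dz\,Q_o(x,d\xi)$, and, if $\int(|y|\wedge|y|^2)Q(x,dy)<\infty$ for all $x$ (radial parts chosen with $\int(r\wedge r^2)Q_\xi(x,dr)<\infty$), the double-integrated radial tail is $\overline{\overline Q}(x,B)=\int_{S^{d-1}}\int_{(0,\infty)}\mathbf 1_B(z_2\xi)\int_{(z_2,\infty)}\int_{(z_1,\infty)}Q_\xi(x,dr)\,dz_1\,dz_2\,Q_o(x,d\xi)$. Both are independent of the choice. **Jump functionals.** For test functions $f$: $\langle U^\pi(\eta),f\rangle=\int\big(\int f(x+y)\nu(x,dy)-f(x)\nu(x,\mathbb R^d)\big)\eta(dx)$, $\langle V^\pi_i(\eta),f\rangle=\int\int f(x+y)\frac{y_i}{|y|}\overline\mu(x,dy)\eta(dx)$, $\langle W^\pi_{ij}(\eta),f\rangle=\int\int f(x+y)\frac{y_iy_j}{|y|^2}\overline{\overline\rho}(x,dy)\eta(dx)$. **The space $\mathcal M(\mathcal A,\pi)$.** It is the set of measures $\eta$ such that $\nabla\cdot((a+a_\pi)\eta)$, $\frac12\nabla\cdot b\nabla\eta$, $U^\pi(\eta)$, $\nabla\cdot V^\pi(\eta)$, $\mathbf H\cdot W^\pi(\eta)$ define distributions; these symbols denote respectively the functionals on $\mathcal C_c^\infty(\mathbb R^d)$ (required to be well defined) $f\mapsto-\int(a+a_\pi)\cdot\nabla f\,d\eta$, $f\mapsto\int\frac12\nabla\cdot b\nabla f\,d\eta$, $f\mapsto\langle U^\pi(\eta),f\rangle$,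 $f\mapsto-\sum_i\langle V_i^\pi(\eta),\partial_if\rangle$, $f\mapsto\sum_{i,j}\langle W^\pi_{ij}(\eta),\partial_i\partial_jf\rangle$. *)

theory Defs
  imports "HOL-Probability.Probability"
begin

section \<open>Function spaces on \<open>\<real>\<^sup>d\<close>\<close>

definition partial_differentiable ::
    "'n::finite \<Rightarrow> (real^'n \<Rightarrow> real) \<Rightarrow> real^'n \<Rightarrow> bool" where
  "partial_differentiable i f x \<longleftrightarrow> (\<lambda>t. f (x + t *\<^sub>R axis i 1)) differentiable (at 0)"

definition partial_deriv ::
    "'n::finite \<Rightarrow> (real^'n \<Rightarrow> real) \<Rightarrow> real^'n \<Rightarrow> real" where
  "partial_deriv i f x = deriv (\<lambda>t. f (x + t *\<^sub>R axis i 1)) 0"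

definition grad :: "(real^'n \<Rightarrow> real) \<Rightarrow> real^'n \<Rightarrow> real^'n::finite" where
  "grad f x = (\<chi> i. partial_deriv i f x)"

text \<open>A list of indices stands for the iterated partial derivative taken in these directions.\<close>

definition iter_partial ::
    "'n::finite list \<Rightarrow> (real^'n \<Rightarrow> real) \<Rightarrow> real^'n \<Rightarrow> real" where
  "iter_partial is f = foldr partial_deriv is f"

text \<open>All partial derivatives of order at most \<open>k\<close> exist everywhere and are continuous.\<close>

definition C_k :: "nat \<Rightarrow> (real^'n::finite \<Rightarrow> real) set" where
  "C_k k = {f. \<forall>is. length is \<le> k \<longrightarrow>
      continuous_on UNIV (iter_partial is f) \<and>
      (length is < k \<longrightarrow> (\<forall>i x. partial_differentiable i (iter_partial is f) x))}"

definition supp :: "(real^'n::finite \<Rightarrow> real) \<Rightarrow> (real^'n) set" where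
  "supp f = closure {x. f x \<noteq> 0}"

definition C_c_infty :: "(real^'n::finite \<Rightarrow> real) set" where
  "C_c_infty = {f. (\<forall>k. f \<in> C_k k) \<and> compact (supp f)}"

definition C_infty :: "(real^'n::finite \<Rightarrow> real) set" where
  "C_infty = {f. continuous_on UNIV f \<and> (f \<longlongrightarrow> 0) at_infinity}"

text \<open>Linear functionals on test functions that are continuous, i.e. on every compact set
  bounded by finitely many derivative norms.\<close>

definition is_distribution :: "((real^'n::finite \<Rightarrow> real) \<Rightarrow> real) \<Rightarrow> bool" where
  "is_distribution T \<longleftrightarrow>
     (\<forall>f\<in>C_c_infty. \<forall>g\<in>C_c_infty. T (\<lambda>x. f x + g x) = T f + T g) \<and>
     (\<forall>f\<in>C_c_infty. \<forall>c. T (\<lambda>x. c * f x) = c * T f) \<and>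
     (\<forall>K. compact K \<longrightarrow> (\<exists>C N. \<forall>f\<in>C_c_infty. supp f \<subseteq> K \<longrightarrow>
        \<bar>T f\<bar> \<le> C * (\<Sum>is | length is \<le> N. SUP x. \<bar>iter_partial is f x\<bar>)))"


section \<open>Feller processes\<close>

definition natural_filtration ::
    "'w measure \<Rightarrow> (real \<Rightarrow> 'w \<Rightarrow> real^'n::finite) \<Rightarrow> real \<Rightarrow> 'w measure" where
  "natural_filtration M X s =
     sigma (space M) {X u -` B \<inter> space M | u B. 0 \<le> u \<and> u \<le> s \<and> B \<in> sets borel}"

text \<open>Only the measurable space underlying \<open>M\<close> is used; \<open>P x\<close> is the law of the process
  started in \<open>x\<close>.\<close>

locale markov_process =
  fixes M :: "'w measure"
    and P :: "real^'n::finite \<Rightarrow> 'w measure"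
    and X :: "real \<Rightarrow> 'w \<Rightarrow> real^'n"
  assumes prob: "prob_space (P x)"
    and sets_P: "sets (P x) = sets M"
    and X_measurable: "0 \<le> t \<Longrightarrow> X t \<in> borel_measurable M"
    and start: "AE w in P x. X 0 w = x"
    and kernel: "0 \<le> t \<Longrightarrow> B \<in> sets borel \<Longrightarrow>
      (\<lambda>x. measure (P x) (X t -` B \<inter> space M)) \<in> borel_measurable borel"
    and markov: "0 \<le> s \<Longrightarrow> 0 \<le> t \<Longrightarrow> B \<in> sets borel \<Longrightarrow>
      AE w in P x.
        real_cond_exp (P x) (natural_filtration M X s) (indicator (X (s + t) -` B \<inter> space M)) w =
        measure (P (X s w)) (X t -` B \<inter> space M)"

definition semigroup_op ::
    "(real^'n::finite \<Rightarrow> 'w measure) \<Rightarrow> (real \<Rightarrow> 'w \<Rightarrow> real^'n) \<Rightarrow>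
     real \<Rightarrow> (real^'n \<Rightarrow> real) \<Rightarrow> real^'n \<Rightarrow> real" where
  "semigroup_op P X t f x = (\<integral>w. f (X t w) \<partial>P x)"

definition feller_process ::
    "'w measure \<Rightarrow> (real^'n::finite \<Rightarrow> 'w measure) \<Rightarrow> (real \<Rightarrow> 'w \<Rightarrow> real^'n) \<Rightarrow> bool" where
  "feller_process M P X \<longleftrightarrow> markov_process M P X \<and>
     (\<forall>f\<in>C_infty. (\<forall>t\<ge>0. semigroup_op P X t f \<in> C_infty) \<and>
        uniform_limit UNIV (\<lambda>t. semigroup_op P X t f) f (at_right 0))"

definition is_generator_value ::
    "(real^'n::finite \<Rightarrow> 'w measure) \<Rightarrow> (real \<Rightarrow> 'w \<Rightarrow> real^'n) \<Rightarrow>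
     (real^'n \<Rightarrow> real) \<Rightarrow> (real^'n \<Rightarrow> real) \<Rightarrow> bool" where
  "is_generator_value P X f g \<longleftrightarrow>
     uniform_limit UNIV (\<lambda>t x. (semigroup_op P X t f x - f x) / t) g (at_right 0)"

definition generator_dom ::
    "(real^'n::finite \<Rightarrow> 'w measure) \<Rightarrow> (real \<Rightarrow> 'w \<Rightarrow> real^'n) \<Rightarrow> (real^'n \<Rightarrow> real) set" where
  "generator_dom P X = {f \<in> C_infty. \<exists>g. is_generator_value P X f g}"

definition generator ::
    "(real^'n::finite \<Rightarrow> 'w measure) \<Rightarrow> (real \<Rightarrow> 'w \<Rightarrow> real^'n) \<Rightarrow>
     (real^'n \<Rightarrow> real) \<Rightarrow> real^'n \<Rightarrow> real" where
  "generator P X f = (THE g. is_generator_value P X f g)"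

definition rich ::
    "(real^'n::finite \<Rightarrow> 'w measure) \<Rightarrow> (real \<Rightarrow> 'w \<Rightarrow> real^'n) \<Rightarrow> bool" where
  "rich P X \<longleftrightarrow> C_c_infty \<subseteq> generator_dom P X"

text \<open>\<open>D\<close> is a core of \<open>(A, DA)\<close> if \<open>A\<close> is the closure of its restriction to \<open>D\<close>: the closure
  (in the supremum norm) of the graph of the restriction is the graph of \<open>A\<close>.\<close>

definition is_core ::
    "(real^'n::finite \<Rightarrow> real) set \<Rightarrow> (real^'n \<Rightarrow> real) set \<Rightarrow>
     ((real^'n \<Rightarrow> real) \<Rightarrow> real^'n \<Rightarrow> real) \<Rightarrow> bool" where
  "is_core D DA A \<longleftrightarrow> D \<subseteq> DA \<and>
     (\<forall>f g. f \<in> DA \<and> g = A f \<longleftrightarrow>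
        (\<exists>F :: nat \<Rightarrow> real^'n \<Rightarrow> real. (\<forall>n. F n \<in> D) \<and>
           uniform_limit UNIV F f sequentially \<and>
           uniform_limit UNIV (\<lambda>n. A (F n)) g sequentially))"

definition invariant_measure ::
    "'w measure \<Rightarrow> (real^'n::finite \<Rightarrow> 'w measure) \<Rightarrow> (real \<Rightarrow> 'w \<Rightarrow> real^'n) \<Rightarrow>
     (real^'n) measure \<Rightarrow> bool" where
  "invariant_measure M P X \<eta> \<longleftrightarrow> sets \<eta> = sets borel \<and>
     (\<forall>t\<ge>0. \<forall>B\<in>sets borel.
        (\<integral>\<^sup>+x. emeasure (P x) (X t -` B \<inter> space M) \<partial>\<eta>) = emeasure \<eta> B)"


section \<open>Levy-type operators\<close>

definition levy_kernel :: "(real^'n::finite \<Rightarrow> (real^'n) measure) \<Rightarrow> bool" where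
  "levy_kernel Q \<longleftrightarrow>
     (\<forall>x. sets (Q x) = sets borel \<and> emeasure (Q x) {0} = 0 \<and>
        (\<integral>\<^sup>+y. ennreal (min 1 ((norm y)\<^sup>2)) \<partial>Q x) < \<infinity>) \<and>
     (\<forall>B\<in>sets borel. (\<lambda>x. emeasure (Q x) B) \<in> borel_measurable borel)"

definition characteristic_triplet ::
    "(real^'n::finite \<Rightarrow> real^'n) \<Rightarrow> (real^'n \<Rightarrow> real^'n^'n) \<Rightarrow>
     (real^'n \<Rightarrow> (real^'n) measure) \<Rightarrow> bool" where
  "characteristic_triplet a b Q \<longleftrightarrow>
     a \<in> borel_measurable borel \<and> b \<in> borel_measurable borel \<and>
     (\<forall>x. transpose (b x) = b x \<and> (\<forall>v. 0 \<le> v \<bullet> (b x *v v))) \<and>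
     levy_kernel Q"

definition div_grad_defined ::
    "(real^'n::finite \<Rightarrow> real^'n^'n) \<Rightarrow> (real^'n \<Rightarrow> real) \<Rightarrow> real^'n \<Rightarrow> bool" where
  "div_grad_defined b f x \<longleftrightarrow>
     (\<forall>i j. partial_differentiable i (\<lambda>z. b z $ i $ j * partial_deriv j f z) x)"

definition div_grad ::
    "(real^'n::finite \<Rightarrow> real^'n^'n) \<Rightarrow> (real^'n \<Rightarrow> real) \<Rightarrow> real^'n \<Rightarrow> real" where
  "div_grad b f x = (\<Sum>i\<in>UNIV. \<Sum>j\<in>UNIV. partial_deriv i (\<lambda>z. b z $ i $ j * partial_deriv j f z) x)"

definition jump_integrand ::
    "(real^'n::finite \<Rightarrow> real) \<Rightarrow> real^'n \<Rightarrow> real^'n \<Rightarrow> real" where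
  "jump_integrand f x y = f (x + y) - f x - (grad f x \<bullet> y) * indicator {y. norm y < 1} y"

definition levy_expr ::
    "(real^'n::finite \<Rightarrow> real^'n) \<Rightarrow> (real^'n \<Rightarrow> real^'n^'n) \<Rightarrow>
     (real^'n \<Rightarrow> (real^'n) measure) \<Rightarrow> (real^'n \<Rightarrow> real) \<Rightarrow> real^'n \<Rightarrow> real" where
  "levy_expr a b Q f x =
     a x \<bullet> grad f x + 1/2 * div_grad b f x + (\<integral>y. jump_integrand f x y \<partial>Q x)"

text \<open>The Banach space \<open>E\<close> enters only through its elements. The differential expression is
  classical, so it is imposed on those \<open>f \<in> D\<close> that are twice continuously differentiable, where
  it has to be well defined at every point: the domain of a Feller generator in general also
  contains functions without classical derivatives (for Brownian motion in dimension at least 2,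
  say), on which the totalised \<open>levy_expr\<close> has no meaning.\<close>

definition levy_type_operator ::
    "(real^'n::finite \<Rightarrow> real) set \<Rightarrow> (real^'n \<Rightarrow> real) set \<Rightarrow>
     ((real^'n \<Rightarrow> real) \<Rightarrow> real^'n \<Rightarrow> real) \<Rightarrow>
     (real^'n \<Rightarrow> real^'n) \<Rightarrow> (real^'n \<Rightarrow> real^'n^'n) \<Rightarrow> (real^'n \<Rightarrow> (real^'n) measure) \<Rightarrow> bool" where
  "levy_type_operator E D A a b Q \<longleftrightarrow>
     characteristic_triplet a b Q \<and> D \<subseteq> E \<and> (\<forall>f\<in>D. A f \<in> E) \<and>
     (\<forall>f\<in>D \<inter> C_k 2. \<forall>x.
        div_grad_defined b f x \<and> integrable (Q x) (jump_integrand f x) \<and>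
        A f x = levy_expr a b Q f x)"

text \<open>The densities \<open>h\<close> depend on the jump \<open>y\<close> only, e.g. \<open>\<nu>(x,dy) = h(y) \<Pi>(x,dy)\<close>.\<close>

definition convenient_decomposition ::
    "(real^'n::finite \<Rightarrow> (real^'n) measure) \<Rightarrow> (real^'n \<Rightarrow> (real^'n) measure) \<Rightarrow>
     (real^'n \<Rightarrow> (real^'n) measure) \<Rightarrow> (real^'n \<Rightarrow> (real^'n) measure) \<Rightarrow> bool" where
  "convenient_decomposition Q \<nu> \<mu> \<rho> \<longleftrightarrow>
     (\<exists>h\<^sub>\<nu> h\<^sub>\<mu> h\<^sub>\<rho> :: real^'n \<Rightarrow> real.
        (\<forall>h\<in>{h\<^sub>\<nu>, h\<^sub>\<mu>, h\<^sub>\<rho>}. continuous_on UNIV h \<and> (\<forall>y. 0 \<le> h y)) \<and>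
        (\<forall>x. \<nu> x = density (Q x) (\<lambda>y. ennreal (h\<^sub>\<nu> y)) \<and>
             \<mu> x = density (Q x) (\<lambda>y. ennreal (h\<^sub>\<mu> y)) \<and>
             \<rho> x = density (Q x) (\<lambda>y. ennreal (h\<^sub>\<rho> y)))) \<and>
     (\<forall>x. \<forall>B\<in>sets borel.
        emeasure (Q x) B = emeasure (\<nu> x) B + emeasure (\<mu> x) B + emeasure (\<rho> x) B) \<and>
     (\<forall>x. emeasure (\<nu> x) UNIV < \<infinity> \<and>
        (\<integral>\<^sup>+y. ennreal (min 1 (norm y)) \<partial>\<mu> x) < \<infinity> \<and>
        (\<integral>\<^sup>+y. ennreal (min (norm y) ((norm y)\<^sup>2)) \<partial>\<rho> x) < \<infinity>)"

definition a_pi ::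
    "(real^'n::finite \<Rightarrow> (real^'n) measure) \<Rightarrow> (real^'n \<Rightarrow> (real^'n) measure) \<Rightarrow>
     (real^'n \<Rightarrow> (real^'n) measure) \<Rightarrow> real^'n \<Rightarrow> real^'n" where
  "a_pi \<nu> \<mu> \<rho> x =
     - (LINT y:{y. norm y < 1}|\<nu> x. y) - (LINT y:{y. norm y < 1}|\<mu> x. y)
     + (LINT y:{y. 1 \<le> norm y}|\<rho> x. y)"


section \<open>Integrated radial tails\<close>

definition polar_decomposition ::
    "(real^'n::finite) measure \<Rightarrow> (real^'n) measure \<Rightarrow> (real^'n \<Rightarrow> real measure) \<Rightarrow> bool" where
  "polar_decomposition Q Qo Qr \<longleftrightarrow>
     sets Qo = sets (restrict_space borel (sphere 0 1)) \<and> finite_measure Qo \<and>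
     (\<forall>\<xi>\<in>sphere 0 1. sets (Qr \<xi>) = sets (restrict_space borel {0<..}) \<and>
        sigma_finite_measure (Qr \<xi>) \<and> 0 < emeasure (Qr \<xi>) {0<..}) \<and>
     (\<forall>S\<in>sets (restrict_space borel {0<..}).
        (\<lambda>\<xi>. emeasure (Qr \<xi>) S) \<in> borel_measurable (restrict_space borel (sphere 0 1))) \<and>
     (\<forall>B\<in>sets borel. emeasure Q B = (\<integral>\<^sup>+\<xi>. (\<integral>\<^sup>+r. indicator B (r *\<^sub>R \<xi>) \<partial>Qr \<xi>) \<partial>Qo))"

text \<open>The integrated tails do not depend on the polar decomposition they are computed from;
  one is chosen, with the integrability of the radial parts prescribed by the weight \<open>w\<close>.\<close>

definition chosen_polar ::
    "(real \<Rightarrow> real) \<Rightarrow> (real^'n::finite) measure \<Rightarrow>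
     (real^'n) measure \<times> (real^'n \<Rightarrow> real measure)" where
  "chosen_polar w Q = (SOME (Qo, Qr). polar_decomposition Q Qo Qr \<and>
     (\<forall>\<xi>\<in>sphere 0 1. (\<integral>\<^sup>+r. ennreal (w r) \<partial>Qr \<xi>) < \<infinity>))"

definition integrated_tail :: "(real^'n::finite) measure \<Rightarrow> (real^'n) measure" where
  "integrated_tail Q = (case chosen_polar (\<lambda>r. min 1 (r\<^sup>2)) Q of (Qo, Qr) \<Rightarrow>
     measure_of UNIV (sets borel) (\<lambda>B.
       \<integral>\<^sup>+\<xi>. (\<integral>\<^sup>+z\<in>{0<..}. indicator B (z *\<^sub>R \<xi>) * emeasure (Qr \<xi>) {z<..} \<partial>lborel) \<partial>Qo))"

definition double_integrated_tail :: "(real^'n::finite) measure \<Rightarrow> (real^'n) measure" where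
  "double_integrated_tail Q = (case chosen_polar (\<lambda>r. min r (r\<^sup>2)) Q of (Qo, Qr) \<Rightarrow>
     measure_of UNIV (sets borel) (\<lambda>B.
       \<integral>\<^sup>+\<xi>. (\<integral>\<^sup>+z\<^sub>2\<in>{0<..}. indicator B (z\<^sub>2 *\<^sub>R \<xi>) *
          (\<integral>\<^sup>+z\<^sub>1\<in>{z\<^sub>2<..}. emeasure (Qr \<xi>) {z\<^sub>1<..} \<partial>lborel) \<partial>lborel) \<partial>Qo))"


section \<open>The distributional equation\<close>

definition U_inner ::
    "(real^'n::finite \<Rightarrow> (real^'n) measure) \<Rightarrow> (real^'n \<Rightarrow> real) \<Rightarrow> real^'n \<Rightarrow> real" where
  "U_inner \<nu> f x = (\<integral>y. f (x + y) \<partial>\<nu> x) - f x * measure (\<nu> x) UNIV"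

definition V_integrand ::
    "'n::finite \<Rightarrow> (real^'n \<Rightarrow> real) \<Rightarrow> real^'n \<Rightarrow> real^'n \<Rightarrow> real" where
  "V_integrand i f x y = f (x + y) * (y $ i / norm y)"

definition V_inner ::
    "(real^'n::finite \<Rightarrow> (real^'n) measure) \<Rightarrow> 'n \<Rightarrow> (real^'n \<Rightarrow> real) \<Rightarrow> real^'n \<Rightarrow> real" where
  "V_inner \<mu> i f x = (\<integral>y. V_integrand i f x y \<partial>integrated_tail (\<mu> x))"

definition W_integrand ::
    "'n::finite \<Rightarrow> 'n \<Rightarrow> (real^'n \<Rightarrow> real) \<Rightarrow> real^'n \<Rightarrow> real^'n \<Rightarrow> real" where
  "W_integrand i j f x y = f (x + y) * (y $ i * y $ j / (norm y)\<^sup>2)"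

definition W_inner ::
    "(real^'n::finite \<Rightarrow> (real^'n) measure) \<Rightarrow> 'n \<Rightarrow> 'n \<Rightarrow> (real^'n \<Rightarrow> real) \<Rightarrow> real^'n \<Rightarrow> real" where
  "W_inner \<rho> i j f x = (\<integral>y. W_integrand i j f x y \<partial>double_integrated_tail (\<rho> x))"

text \<open>The five functionals \<open>\<nabla>\<cdot>(c\<eta>)\<close>, \<open>1/2 \<nabla>\<cdot>b\<nabla>\<eta>\<close>, \<open>U(\<eta>)\<close>, \<open>\<nabla>\<cdot>V(\<eta>)\<close>, \<open>H\<cdot>W(\<eta>)\<close>; each comes with the
  condition that all integrals occurring in its value at \<open>f\<close> exist.\<close>

definition drift_functional ::
    "(real^'n::finite \<Rightarrow> real^'n) \<Rightarrow> (real^'n) measure \<Rightarrow> (real^'n \<Rightarrow> real) \<Rightarrow> real" where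
  "drift_functional c \<eta> f = - (\<integral>x. c x \<bullet> grad f x \<partial>\<eta>)"

definition drift_defined ::
    "(real^'n::finite \<Rightarrow> real^'n) \<Rightarrow> (real^'n) measure \<Rightarrow> (real^'n \<Rightarrow> real) \<Rightarrow> bool" where
  "drift_defined c \<eta> f \<longleftrightarrow> integrable \<eta> (\<lambda>x. c x \<bullet> grad f x)"

definition diffusion_functional ::
    "(real^'n::finite \<Rightarrow> real^'n^'n) \<Rightarrow> (real^'n) measure \<Rightarrow> (real^'n \<Rightarrow> real) \<Rightarrow> real" where
  "diffusion_functional b \<eta> f = (\<integral>x. 1/2 * div_grad b f x \<partial>\<eta>)"

definition diffusion_defined ::
    "(real^'n::finite \<Rightarrow> real^'n^'n) \<Rightarrow> (real^'n) measure \<Rightarrow> (real^'n \<Rightarrow> real) \<Rightarrow> bool" where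
  "diffusion_defined b \<eta> f \<longleftrightarrow>
     (AE x in \<eta>. div_grad_defined b f x) \<and> integrable \<eta> (\<lambda>x. 1/2 * div_grad b f x)"

definition U_functional ::
    "(real^'n::finite \<Rightarrow> (real^'n) measure) \<Rightarrow> (real^'n) measure \<Rightarrow> (real^'n \<Rightarrow> real) \<Rightarrow> real" where
  "U_functional \<nu> \<eta> f = (\<integral>x. U_inner \<nu> f x \<partial>\<eta>)"

definition U_defined ::
    "(real^'n::finite \<Rightarrow> (real^'n) measure) \<Rightarrow> (real^'n) measure \<Rightarrow> (real^'n \<Rightarrow> real) \<Rightarrow> bool" where
  "U_defined \<nu> \<eta> f \<longleftrightarrow>
     (AE x in \<eta>. integrable (\<nu> x) (\<lambda>y. f (x + y))) \<and> integrable \<eta> (U_inner \<nu> f)"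

definition div_V_functional ::
    "(real^'n::finite \<Rightarrow> (real^'n) measure) \<Rightarrow> (real^'n) measure \<Rightarrow> (real^'n \<Rightarrow> real) \<Rightarrow> real" where
  "div_V_functional \<mu> \<eta> f = - (\<Sum>i\<in>UNIV. \<integral>x. V_inner \<mu> i (partial_deriv i f) x \<partial>\<eta>)"

definition div_V_defined ::
    "(real^'n::finite \<Rightarrow> (real^'n) measure) \<Rightarrow> (real^'n) measure \<Rightarrow> (real^'n \<Rightarrow> real) \<Rightarrow> bool" where
  "div_V_defined \<mu> \<eta> f \<longleftrightarrow> (\<forall>i.
     (AE x in \<eta>. integrable (integrated_tail (\<mu> x)) (V_integrand i (partial_deriv i f) x)) \<and>
     integrable \<eta> (V_inner \<mu> i (partial_deriv i f)))"

definition H_W_functional ::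
    "(real^'n::finite \<Rightarrow> (real^'n) measure) \<Rightarrow> (real^'n) measure \<Rightarrow> (real^'n \<Rightarrow> real) \<Rightarrow> real" where
  "H_W_functional \<rho> \<eta> f = (\<Sum>i\<in>UNIV. \<Sum>j\<in>UNIV.
     \<integral>x. W_inner \<rho> i j (partial_deriv i (partial_deriv j f)) x \<partial>\<eta>)"

definition H_W_defined ::
    "(real^'n::finite \<Rightarrow> (real^'n) measure) \<Rightarrow> (real^'n) measure \<Rightarrow> (real^'n \<Rightarrow> real) \<Rightarrow> bool" where
  "H_W_defined \<rho> \<eta> f \<longleftrightarrow> (\<forall>i j.
     (AE x in \<eta>. integrable (double_integrated_tail (\<rho> x))
        (W_integrand i j (partial_deriv i (partial_deriv j f)) x)) \<and>
     integrable \<eta> (W_inner \<rho> i j (partial_deriv i (partial_deriv j f))))"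

definition M_space ::
    "(real^'n::finite \<Rightarrow> real^'n) \<Rightarrow> (real^'n \<Rightarrow> real^'n^'n) \<Rightarrow>
     (real^'n \<Rightarrow> (real^'n) measure) \<Rightarrow> (real^'n \<Rightarrow> (real^'n) measure) \<Rightarrow>
     (real^'n \<Rightarrow> (real^'n) measure) \<Rightarrow> (real^'n) measure set" where
  "M_space a b \<nu> \<mu> \<rho> = {\<eta>. sets \<eta> = sets borel \<and>
     (let c = (\<lambda>x. a x + a_pi \<nu> \<mu> \<rho> x) in
       (\<forall>f\<in>C_c_infty. drift_defined c \<eta> f \<and> diffusion_defined b \<eta> f \<and> U_defined \<nu> \<eta> f \<and>
          div_V_defined \<mu> \<eta> f \<and> H_W_defined \<rho> \<eta> f) \<and>
       is_distribution (drift_functional c \<eta>) \<and>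
       is_distribution (diffusion_functional b \<eta>) \<and>
       is_distribution (U_functional \<nu> \<eta>) \<and>
       is_distribution (div_V_functional \<mu> \<eta>) \<and>
       is_distribution (H_W_functional \<rho> \<eta>))}"

definition solves_equation ::
    "(real^'n::finite \<Rightarrow> real^'n) \<Rightarrow> (real^'n \<Rightarrow> real^'n^'n) \<Rightarrow>
     (real^'n \<Rightarrow> (real^'n) measure) \<Rightarrow> (real^'n \<Rightarrow> (real^'n) measure) \<Rightarrow>
     (real^'n \<Rightarrow> (real^'n) measure) \<Rightarrow> (real^'n) measure \<Rightarrow> bool" where
  "solves_equation a b \<nu> \<mu> \<rho> \<eta> \<longleftrightarrow> (\<forall>f\<in>C_c_infty.
     - drift_functional (\<lambda>x. a x + a_pi \<nu> \<mu> \<rho> x) \<eta> f + diffusion_functional b \<eta> f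
     + U_functional \<nu> \<eta> f - div_V_functional \<mu> \<eta> f + H_W_functional \<rho> \<eta> f = 0)"

end

theory Submission
  imports Defs
begin

text \<open>Taylor's formula along the segment from \<open>x\<close> to \<open>x + y\<close>, of order one against \<open>\<mu>\<close> and of order two
  against \<open>\<rho>\<close>, turns the jump part of the generator into integrals against the (double-)integrated
  radial tails: these spread the mass at \<open>y\<close> over the segment from \<open>0\<close> to \<open>y\<close>, with density \<open>1\<close> and
  \<open>|y| - z\<close> at distance \<open>z\<close> respectively. Hence for test functions \<open>f\<close> the left-hand side of the distributional equation is
  \<open>\<integral>A f d\<eta>\<close>.

  If \<open>\<eta>\<close> is invariant, then \<open>\<integral>(P\<^sub>t f - f)/t d\<eta> = 0\<close>, and \<open>t \<rightarrow> 0\<close> gives \<open>\<integral>A f d\<eta> = 0\<close>. Conversely,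
  \<open>\<integral>A f d\<eta> = 0\<close> passes from a core to the whole domain by uniform convergence. For \<open>f\<close> vanishing at
  infinity the time average \<open>g = \<integral>\<^sub>0\<^sup>t P\<^sub>s f ds\<close> lies in the domain and \<open>A g = P\<^sub>t f - f\<close>, so
  \<open>\<integral>P\<^sub>t f d\<eta> = \<integral>f d\<eta>\<close>.\<close>

section \<open>Polar decompositions\<close>

text \<open>The tails in the equation are computed from a polar decomposition picked by
  \<open>SOME\<close>, which says nothing until one is known to exist. Existence is a disintegration
  theorem; it is proved for an arbitrary radial weight \<open>w\<close>, since the two tails
  prescribe different integrability of the radial parts. After that the choice disappears: both
  tails are images of a density on the product of \<open>Q\<close> and \<open>lborel\<close> under
  (y, z) -> z sgn y. The Taylor argument is carried out for each \<open>x\<close> separately, and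
  integrability in \<open>x\<close> comes from membership in \<open>M_space\<close>. The other
  obstacle is the time average. It is an integral in the space of bounded continuous functions,
  whose elements need not vanish at infinity, so it has to be shown to stay in
  \<open>C_infty\<close> and to commute with the semigroup. It is in general neither smooth nor
  compactly supported, and the equation reaches it only through the core. Finiteness of
  \<open>\<eta>\<close> turns each uniform limit into a limit of integrals.\<close>

lemma AE_le_if_set_nn_integral_le:
  fixes f g :: "'a \<Rightarrow> ennreal"
  assumes [measurable]: "f \<in> borel_measurable M" "g \<in> borel_measurable M"
    and fin: "(\<integral>\<^sup>+x. g x \<partial>M) \<noteq> \<infinity>"
    and le: "\<And>A. A \<in> sets M \<Longrightarrow> (\<integral>\<^sup>+x\<in>A. f x \<partial>M) \<le> (\<integral>\<^sup>+x\<in>A. g x \<partial>M)"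
  shows "AE x in M. f x \<le> g x"
proof -
  \<comment> \<open>It is enough to test with the set where the claim fails. If it had positive
    measure, the integral of \<open>g\<close> over it would be strictly smaller than that of
    \<open>f\<close>; strictness rests on the former being finite.\<close>
  define A where "A = {x \<in> space M. g x < f x}"
  have A[measurable]: "A \<in> sets M" unfolding A_def by measurable
  have "(\<integral>\<^sup>+x\<in>A. g x \<partial>M) \<noteq> \<infinity>"
  proof -
    have "(\<integral>\<^sup>+x\<in>A. g x \<partial>M) \<le> (\<integral>\<^sup>+x. g x \<partial>M)"
      by (intro nn_integral_mono) (auto simp: indicator_def)
    with fin show ?thesis using neq_top_trans by auto
  qed
  moreover have "AE x in M. g x * indicator A x \<le> f x * indicator A x"
    by (auto simp: A_def indicator_def less_imp_le)
  ultimately have "AE x in M. f x * indicator A x \<le> g x * indicator A x"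
    using nn_integral_less[of "\<lambda>x. g x * indicator A x" M "\<lambda>x. f x * indicator A x"]
      leD[OF le[OF A]] by - (rule ccontr, simp)
  with AE_space show ?thesis
  proof eventually_elim
    case (elim x)
    then show ?case by (cases "g x < f x") (auto simp: A_def indicator_def)
  qed
qed

section \<open>Disintegration of a finite measure by uniform noise\<close>

lemma emeasure_uniform_Ioo_less:
  fixes s :: ennreal
  assumes "s \<le> 1"
  shows "emeasure (uniform_measure lborel {0<..<1::real}) {u. ennreal u < s} = s"
proof -
  obtain r where r: "s = ennreal r" "0 \<le> r" "r \<le> 1"
    using assms by (cases s) (auto simp: top_unique)
  have "{0<..<1::real} \<inter> {u. ennreal u < s} = {0<..<r}"
    using r by (auto simp: ennreal_less_iff)
  then show ?thesis using r by (simp add: emeasure_uniform_measure divide_ennreal_def)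
qed

text \<open>Rectangles over half-lines \<open>{..<c}\<close> are stable under intersection and
  generate. Full strips are added because \<open>{..<c}\<close> never contains a largest element:
  for \<open>ennreal\<close> the mass at \<open>\<top>\<close> would otherwise be invisible.\<close>

lemma measure_eqI_times_lessThan:
  fixes N K :: "('a \<times> 'b::{linorder_topology, second_countable_topology}) measure"
  assumes sets_N: "sets N = sets (S \<Otimes>\<^sub>M borel)" and sets_K: "sets K = sets (S \<Otimes>\<^sub>M borel)"
    and "finite_measure N"
    and eq: "\<And>A c. A \<in> sets S \<Longrightarrow> emeasure N (A \<times> {..<c}) = emeasure K (A \<times> {..<c})"
      "\<And>A. A \<in> sets S \<Longrightarrow> emeasure N (A \<times> UNIV) = emeasure K (A \<times> UNIV)"
  shows "N = K"
proof (rule measure_eqI_generator_eq[where A="\<lambda>_. space S \<times> UNIV"])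
  interpret N: finite_measure N by fact
  let ?E = "{A \<times> B | A B. A \<in> sets S \<and> B \<in> insert UNIV (range (lessThan :: 'b \<Rightarrow> _))}"
  show "Int_stable ?E"
  proof (rule Int_stableI)
    fix Z Z' assume "Z \<in> ?E" "Z' \<in> ?E"
    then obtain A A' B B' where Z: "Z = A \<times> B" "Z' = A' \<times> B'"
      and *: "A \<in> sets S" "A' \<in> sets S" "B \<in> insert UNIV (range lessThan)" "B' \<in> insert UNIV (range lessThan)"
      by blast
    have lessThan_Int_lessThan: "{..<x} \<inter> {..<y} = {..<min x y}" for x y :: 'b by auto
    have "B \<inter> B' \<in> insert UNIV (range lessThan)"
      using *(3,4) by (elim insertE rangeE) (auto simp: lessThan_Int_lessThan)
    moreover have "A \<inter> A' \<in> sets S" using *(1,2) by auto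
    ultimately show "Z \<inter> Z' \<in> ?E" unfolding Z Times_Int_Times by blast
  qed
  have "sets (S \<Otimes>\<^sub>M borel) = sigma_sets (space S \<times> UNIV) ?E"
  proof (intro antisym)
    show "sets (S \<Otimes>\<^sub>M borel) \<subseteq> sigma_sets (space S \<times> UNIV) ?E"
    proof
      have E: "?E \<subseteq> Pow (space S \<times> UNIV)" using sets.sets_into_space by fastforce
      \<comment> \<open>The generated sigma-algebra contains the product one because both
        projections, hence the identity into the product, are measurable for it.\<close>
      define R where "R = sigma (space S \<times> UNIV) ?E"
      have R: "space R = space S \<times> UNIV" "sets R = sigma_sets (space S \<times> UNIV) ?E"
        using E by (simp_all add: R_def)
      have "fst \<in> measurable R S"
      proof (rule measurableI)
        fix A assume "A \<in> sets S"
        then have "A \<times> UNIV \<in> ?E" by auto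
        moreover have "fst -` A \<inter> space R = A \<times> UNIV"
          using sets.sets_into_space[OF \<open>A \<in> sets S\<close>] by (auto simp: R)
        ultimately show "fst -` A \<inter> space R \<in> sets R"
          unfolding R(2) by (simp only: sigma_sets.Basic)
      qed (auto simp: R)
      moreover have "snd \<in> borel_measurable R"
      proof (rule borel_measurableI_less)
        fix c
        have "space S \<times> {..<c} \<in> ?E" by auto
        moreover have "{w \<in> space R. snd w < c} = space S \<times> {..<c}" by (auto simp: R)
        ultimately show "{w \<in> space R. snd w < c} \<in> sets R"
          unfolding R(2) by (simp only: sigma_sets.Basic)
      qed
      ultimately have "(\<lambda>z. (fst z, snd z)) \<in> measurable R (S \<Otimes>\<^sub>M borel)"
        by (rule measurable_Pair)
      then have id: "(\<lambda>z. z) \<in> measurable R (S \<Otimes>\<^sub>M borel)" by simp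
      fix Z assume Z: "Z \<in> sets (S \<Otimes>\<^sub>M (borel :: 'b measure))"
      have "(\<lambda>z. z) -` Z \<inter> space R \<in> sets R"
        using measurable_sets[OF id Z] .
      moreover have "(\<lambda>z. z) -` Z \<inter> space R = Z"
        using sets.sets_into_space[OF Z] by (auto simp: R space_pair_measure)
      ultimately show "Z \<in> sigma_sets (space S \<times> UNIV) ?E" by (simp add: R(2))
    qed
    have "?E \<subseteq> sets (S \<Otimes>\<^sub>M borel)" by auto
    from sets.sigma_sets_subset[OF this]
    show "sigma_sets (space S \<times> UNIV) ?E \<subseteq> sets (S \<Otimes>\<^sub>M borel)"
      by (simp only: space_pair_measure space_borel)
  qed
  then show "sets N = sigma_sets (space S \<times> UNIV) ?E" "sets K = sigma_sets (space S \<times> UNIV) ?E"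
    by (simp_all add: sets_N sets_K)
  show "?E \<subseteq> Pow (space S \<times> UNIV)" using sets.sets_into_space by fastforce
  show "emeasure N (space S \<times> UNIV) \<noteq> \<infinity>" by simp
qed (use eq in auto)

text \<open>For a single \<open>c\<close>, the measure A -> N (A x {..<c}) is dominated by the first
  marginal, and its Radon-Nikodym density serves as conditional probability of lying below
  \<open>c\<close>. Different \<open>c\<close> come with different null sets, so nothing is claimed
  about the dependence on \<open>c\<close>.\<close>

lemma exists_conditional_distribution_less:
  fixes N :: "('a \<times> 'b::{linorder_topology, second_countable_topology}) measure"
  assumes sets_N[measurable_cong]: "sets N = sets (S \<Otimes>\<^sub>M borel)" and "finite_measure N"
  shows "\<exists>G\<in>borel_measurable S. \<forall>A\<in>sets S.
    (\<integral>\<^sup>+x\<in>A. G x \<partial>distr N S fst) = emeasure N (A \<times> {..<c})"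
proof -
  interpret N: finite_measure N by fact
  have space_N: "space N = space S \<times> UNIV"
    using sets_eq_imp_space_eq[OF sets_N] by (simp add: space_pair_measure)
  define M where "M = distr N S fst"
  have sets_M[measurable_cong, simp]: "sets M = sets S" and space_M[simp]: "space M = space S"
    by (simp_all add: M_def)
  interpret M: finite_measure M
    unfolding M_def by (intro N.finite_measure_distr) simp
  have M_eq: "emeasure M A = emeasure N (A \<times> UNIV)" if "A \<in> sets S" for A
  proof -
    have "fst -` A \<inter> space N = A \<times> UNIV"
      using sets.sets_into_space[OF that] by (auto simp: space_N)
    then show ?thesis unfolding M_def using that by (subst emeasure_distr) auto
  qed
    define R where "R = distr (density N (indicator (space S \<times> {..<c}))) S fst"
  have R_eq: "emeasure R A = emeasure N (A \<times> {..<c})" if [measurable]: "A \<in> sets S" for A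
  proof -
    have "emeasure R A = emeasure (density N (indicator (space S \<times> {..<c}))) (fst -` A \<inter> space N)"
      unfolding R_def by (subst emeasure_distr) auto
    also have "fst -` A \<inter> space N = A \<times> UNIV"
      using sets.sets_into_space[OF that] by (auto simp: space_N)
    also have "emeasure (density N (indicator (space S \<times> {..<c}))) (A \<times> UNIV) =
        (\<integral>\<^sup>+x. indicator (A \<times> {..<c}) x \<partial>N)"
      using sets.sets_into_space[OF that]
      by (subst emeasure_density) (use that in \<open>auto simp del: nn_integral_indicator
        intro!: nn_integral_cong[of N "\<lambda>x. indicator _ x * indicator _ x"] split: split_indicator\<close>)
    also have "\<dots> = emeasure N (A \<times> {..<c})" by (simp add: sets_N)
    finally show ?thesis .
  qed
  have le: "emeasure R A \<le> emeasure M A" if [measurable]: "A \<in> sets S" for A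
    unfolding R_eq[OF that] M_eq[OF that] by (intro emeasure_mono) (auto simp: sets_N)
  have "\<exists>f\<in>borel_measurable M. density M f = R"
  proof (rule M.Radon_Nikodym_finite_measure)
    show "finite_measure R"
      using le[of "space S"] M.finite_emeasure_space
      by (intro finite_measureI) (auto simp: R_def top_unique)
    show "absolutely_continuous M R"
      using le unfolding absolutely_continuous_def null_sets_def by (auto simp: R_def) (metis le_zero_eq)
  qed (simp add: R_def)
  then obtain G where [measurable]: "G \<in> borel_measurable M" and "density M G = R" by auto
  then have "(\<integral>\<^sup>+x\<in>A. G x \<partial>M) = emeasure N (A \<times> {..<c})" if "A \<in> sets S" for A
    using R_eq[OF that] emeasure_density[of G M A] that by simp
  then show ?thesis unfolding M_def[symmetric] by (intro bexI[of _ G]) auto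
qed

text \<open>A random variable with prescribed conditional distribution given \<open>x\<close> is obtained by
  applying the conditional quantile function to uniform noise. In contrast to the usual
  construction of regular conditional distributions, the conditional distribution functions
  \<open>G q\<close> need not be made monotone or right-continuous in \<open>q\<close>.\<close>

lemma noise_outsourcing:
  fixes N :: "('a \<times> ennreal) measure"
  assumes sets_N[measurable_cong]: "sets N = sets (S \<Otimes>\<^sub>M borel)" and "finite_measure N"
  defines "U \<equiv> uniform_measure lborel {0<..<1::real}"
  obtains T where "(\<lambda>(x, u). T x u) \<in> borel_measurable (S \<Otimes>\<^sub>M borel)"
    "N = distr (distr N S fst \<Otimes>\<^sub>M U) (S \<Otimes>\<^sub>M borel) (\<lambda>(x, u). (x, T x u))"
proof -
  interpret N: finite_measure N by fact
  define M where "M = distr N S fst"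
  have space_N: "space N = space S \<times> UNIV"
    using sets_eq_imp_space_eq[OF sets_N] by (simp add: space_pair_measure)
  have sets_M[measurable_cong, simp]: "sets M = sets S" and space_M[simp]: "space M = space S"
    by (simp_all add: M_def)
  interpret M: finite_measure M
    unfolding M_def by (intro N.finite_measure_distr) simp
  have sets_U[measurable_cong, simp]: "sets U = sets borel" by (simp add: U_def)
  interpret U: prob_space U
    unfolding U_def by (rule prob_space_uniform_measure) auto
  have M_eq: "emeasure M A = emeasure N (A \<times> UNIV)" if "A \<in> sets S" for A
  proof -
    have "fst -` A \<inter> space N = A \<times> UNIV"
      using sets.sets_into_space[OF that] by (auto simp: space_N)
    then show ?thesis unfolding M_def using that by (subst emeasure_distr) auto
  qed
  from exists_conditional_distribution_less[OF sets_N N.finite_measure_axioms, folded M_def]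
  obtain G where G[measurable]: "\<And>c. G c \<in> borel_measurable S"
    and G_eq: "\<And>c A. A \<in> sets S \<Longrightarrow> (\<integral>\<^sup>+x\<in>A. G c x \<partial>M) = emeasure N (A \<times> {..<c})"
    by metis
  have int_G: "(\<integral>\<^sup>+x. G c x \<partial>M) \<noteq> \<infinity>" for c
  proof -
    have "(\<integral>\<^sup>+x. G c x \<partial>M) = (\<integral>\<^sup>+x\<in>space S. G c x \<partial>M)"
      by (intro nn_integral_cong) simp
    then show ?thesis using G_eq[of "space S" c] by simp
  qed
  have G_mono: "AE x in M. G c x \<le> G d x" if "c \<le> d" for c d
  proof (rule AE_le_if_set_nn_integral_le)
    fix A assume "A \<in> sets M"
    then show "(\<integral>\<^sup>+x\<in>A. G c x \<partial>M) \<le> (\<integral>\<^sup>+x\<in>A. G d x \<partial>M)"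
      using that by (simp add: G_eq) (intro emeasure_mono, auto simp: sets_N)
  qed (use int_G in auto)
  have G_le_1: "AE x in M. G c x \<le> 1" for c
  proof (rule AE_le_if_set_nn_integral_le)
    fix A assume "A \<in> sets M"
    then show "(\<integral>\<^sup>+x\<in>A. G c x \<partial>M) \<le> (\<integral>\<^sup>+x\<in>A. 1 \<partial>M)"
      by (simp add: G_eq M_eq) (intro emeasure_mono, auto simp: sets_N)
  qed (use M.finite_emeasure_space in auto)
  obtain D :: "ennreal set" where D: "countable D" "\<And>x y. x < y \<Longrightarrow> \<exists>b\<in>D. x < b \<and> b < y"
    using countable_separating_set_dense_linorder by metis
  \<comment> \<open>A quantile function: the infimum of the levels whose conditional distribution
    function exceeds the noise. Levels run over a countable set to keep \<open>T\<close> measurable,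
    \<open>min 1\<close> covers the null set where \<open>G\<close> exceeds \<open>1\<close>, and
    \<open>top\<close> makes the other levels invisible to the infimum.\<close>
  define T where "T x u = (INF q\<in>D. if ennreal u < min 1 (G q x) then q else top)" for x u
  \<comment> \<open>Pure order theory, valid whatever the shape of \<open>G\<close>: the supremum
    over smaller levels is a monotone, left-continuous substitute for \<open>G c\<close>.\<close>
  have T_less: "T x u < c \<longleftrightarrow> ennreal u < (SUP q\<in>D \<inter> {..<c}. min 1 (G q x))" for x u c
  proof -
    have "T x u < c \<longleftrightarrow> (\<exists>q\<in>D. ennreal u < min 1 (G q x) \<and> q < c)"
      unfolding T_def by (subst INF_less_iff) (force split: if_splits)
    then show ?thesis by (auto simp: less_SUP_iff)
  qed
  have T[measurable]: "(\<lambda>z. T (fst z) (snd z)) \<in> borel_measurable (S \<Otimes>\<^sub>M borel)"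
    unfolding T_def using D(1) by measurable
  define K where "K = distr (M \<Otimes>\<^sub>M U) (S \<Otimes>\<^sub>M borel) (\<lambda>(x, u). (x, T x u))"
  have K_eq: "emeasure K (A \<times> {..<c}) = emeasure N (A \<times> {..<c})" if A[measurable]: "A \<in> sets S" for A c
  proof -
    have "(\<lambda>(x, u). (x, T x u)) -` (A \<times> {..<c}) \<inter> space (M \<Otimes>\<^sub>M U) = {z \<in> A \<times> UNIV. T (fst z) (snd z) < c}"
      using sets.sets_into_space[OF A] by (auto simp: space_pair_measure U_def)
    then have "emeasure K (A \<times> {..<c}) = emeasure (M \<Otimes>\<^sub>M U) {z \<in> A \<times> UNIV. T (fst z) (snd z) < c}"
      unfolding K_def by (subst emeasure_distr) (auto simp: split_beta')
    also have "\<dots> = (\<integral>\<^sup>+x. emeasure U (Pair x -` {z \<in> A \<times> UNIV. T (fst z) (snd z) < c}) \<partial>M)"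
    proof (rule U.emeasure_pair_measure_alt)
      have "{z \<in> A \<times> UNIV. T (fst z) (snd z) < c} =
          {z \<in> space (S \<Otimes>\<^sub>M borel). fst z \<in> A \<and> T (fst z) (snd z) < c}"
        using sets.sets_into_space[OF A] by (auto simp: space_pair_measure)
      also have "\<dots> \<in> sets (S \<Otimes>\<^sub>M borel)" by measurable
      finally show "{z \<in> A \<times> UNIV. T (fst z) (snd z) < c} \<in> sets (M \<Otimes>\<^sub>M U)" by simp
    qed
    also have "\<dots> = (\<integral>\<^sup>+x\<in>A. (SUP q\<in>D \<inter> {..<c}. min 1 (G q x)) \<partial>M)"
    proof (rule nn_integral_cong)
      fix x
      have "Pair x -` {z \<in> A \<times> UNIV. T (fst z) (snd z) < c} =
          (if x \<in> A then {u. ennreal u < (SUP q\<in>D \<inter> {..<c}. min 1 (G q x))} else {})"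
        by (auto simp: T_less)
      moreover have "emeasure U {u. ennreal u < (SUP q\<in>D \<inter> {..<c}. min 1 (G q x))} =
          (SUP q\<in>D \<inter> {..<c}. min 1 (G q x))"
        unfolding U_def by (rule emeasure_uniform_Ioo_less) (simp add: SUP_le_iff)
      ultimately show "emeasure U (Pair x -` {z \<in> A \<times> UNIV. T (fst z) (snd z) < c}) =
          (SUP q\<in>D \<inter> {..<c}. min 1 (G q x)) * indicator A x"
        by simp
    qed
    also have "\<dots> = emeasure N (A \<times> {..<c})"
    \<comment> \<open>Upper bound: almost surely \<open>G q\<close> is at most \<open>G c\<close>
      for all of the countably many \<open>q < c\<close>. Lower bound: \<open>{..<c}\<close> is
      exhausted by half-lines that end below separating levels.\<close>
    proof (rule antisym)
      have "AE x in M. \<forall>q\<in>D \<inter> {..<c}. G q x \<le> G c x"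
        using D(1) G_mono by (subst AE_ball_countable) (auto intro: countable_Int1 less_imp_le)
      then have "(\<integral>\<^sup>+x\<in>A. (SUP q\<in>D \<inter> {..<c}. min 1 (G q x)) \<partial>M) \<le> (\<integral>\<^sup>+x\<in>A. G c x \<partial>M)"
        by (intro nn_integral_mono_AE, eventually_elim)
           (auto intro!: mult_right_mono SUP_least simp: min.coboundedI2)
      then show "(\<integral>\<^sup>+x\<in>A. (SUP q\<in>D \<inter> {..<c}. min 1 (G q x)) \<partial>M) \<le> emeasure N (A \<times> {..<c})"
        by (simp add: G_eq)
    next
      have le: "emeasure N (A \<times> {..<q}) \<le> (\<integral>\<^sup>+x\<in>A. (SUP q\<in>D \<inter> {..<c}. min 1 (G q x)) \<partial>M)"
        if "q \<in> D" "q < c" for q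
        unfolding G_eq[OF A, symmetric] using G_le_1[of q]
        by (intro nn_integral_mono_AE, eventually_elim)
           (use that in \<open>auto intro!: mult_right_mono SUP_upper2[of q]\<close>)
      show "emeasure N (A \<times> {..<c}) \<le> (\<integral>\<^sup>+x\<in>A. (SUP q\<in>D \<inter> {..<c}. min 1 (G q x)) \<partial>M)"
      \<comment> \<open>Nothing lies below \<open>0\<close>, so only positive levels can be
        approached from below.\<close>
      proof (cases "c = 0")
        case False
        then obtain k where k: "\<And>n. k n < c" "k \<longlonglongrightarrow> c"
          using approx_from_below_dense_linorder[of 0 c] by (auto simp: zero_less_iff_neq_zero)
        \<comment> \<open>The approximating sequence need not be monotone; its running maxima are,
          and they stay below \<open>c\<close>.\<close>
        define l where "l n = Max (k ` {..n})" for n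
        have l: "incseq l" "\<And>n. l n < c"
          using k(1) by (auto simp: l_def incseq_def intro!: Max_mono)
        have "\<exists>n. y < l n" if "y < c" for y
        proof -
          have "\<forall>\<^sub>F n in sequentially. y < k n" using order_tendstoD(1)[OF k(2) that] .
          then obtain n where "y < k n" by (auto simp: eventually_sequentially)
          then show ?thesis by (intro exI[of _ n]) (auto simp: l_def Max_gr_iff)
        qed
        then have "A \<times> {..<c} = (\<Union>n. A \<times> {..<l n})"
          using l(2) by (blast intro: less_trans)
        then have "emeasure N (A \<times> {..<c}) = (SUP n. emeasure N (A \<times> {..<l n}))"
          using l(1) by (subst SUP_emeasure_incseq) (auto simp: sets_N incseq_def intro: order.strict_trans2)
        also have "\<dots> \<le> (\<integral>\<^sup>+x\<in>A. (SUP q\<in>D \<inter> {..<c}. min 1 (G q x)) \<partial>M)"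
        proof (rule SUP_least)
          fix n
          obtain q where q: "q \<in> D" "l n < q" "q < c"
            using D(2)[OF l(2)] by auto
          then have "emeasure N (A \<times> {..<l n}) \<le> emeasure N (A \<times> {..<q})"
            by (intro emeasure_mono) (auto simp: sets_N)
          also have "\<dots> \<le> (\<integral>\<^sup>+x\<in>A. (SUP q\<in>D \<inter> {..<c}. min 1 (G q x)) \<partial>M)"
            by (rule le[OF q(1,3)])
          finally show "emeasure N (A \<times> {..<l n}) \<le> (\<integral>\<^sup>+x\<in>A. (SUP q\<in>D \<inter> {..<c}. min 1 (G q x)) \<partial>M)" .
        qed
        finally show ?thesis .
      next
        case True
        then have *: "A \<times> {..<c} = {}" by auto
        show ?thesis unfolding * by simp
      qed
    qed
    finally show ?thesis .
  qed
  have "N = K"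
  proof (rule measure_eqI_times_lessThan)
    fix A assume Z: "A \<in> sets S"
    have "(\<lambda>(x, u). (x, T x u)) -` (A \<times> UNIV) \<inter> space (M \<Otimes>\<^sub>M U) = A \<times> UNIV"
      using sets.sets_into_space[OF Z] by (auto simp: space_pair_measure U_def)
    then have "emeasure K (A \<times> UNIV) = emeasure (M \<Otimes>\<^sub>M U) (A \<times> UNIV)"
      unfolding K_def using Z by (subst emeasure_distr) (auto simp: split_beta')
    also have "\<dots> = emeasure M A"
      using Z U.emeasure_space_1 by (subst U.emeasure_pair_measure_Times) (auto simp: U_def)
    finally show "emeasure N (A \<times> UNIV) = emeasure K (A \<times> UNIV)" using Z by (simp add: M_eq)
  qed (use K_eq sets_N in \<open>simp_all add: K_def N.finite_measure_axioms\<close>)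
  then show ?thesis using that[of T] T by (simp add: K_def M_def split_beta')
qed

section \<open>Existence of polar decompositions\<close>

lemma sigma_finite_measure_if_nn_integral_finite:
  fixes f :: "'a \<Rightarrow> ennreal"
  assumes [measurable]: "f \<in> borel_measurable M" and pos: "\<And>x. x \<in> space M \<Longrightarrow> 0 < f x"
    and fin: "(\<integral>\<^sup>+x. f x \<partial>M) < \<infinity>"
  shows "sigma_finite_measure M"
proof
  \<comment> \<open>Each set has finite measure by Markov's inequality, and positivity of
    \<open>f\<close> makes them exhaust the space; points with \<open>f x = \<top>\<close> already
    lie in the first one.\<close>
  define A where "A n = {x \<in> space M. 1 \<le> of_nat (Suc n) * f x}" for n
  have [measurable]: "A n \<in> sets M" for n unfolding A_def by measurable
  show "\<exists>A. countable A \<and> A \<subseteq> sets M \<and> \<Union> A = space M \<and> (\<forall>a\<in>A. emeasure M a \<noteq> \<infinity>)"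
  proof (intro exI conjI)
    show "\<Union> (range A) = space M"
    proof safe
      fix x assume x: "x \<in> space M"
      obtain n where "1 \<le> of_nat (Suc n) * f x"
      proof (cases "f x = \<top>")
        case True
        then show ?thesis using that[of 0] by simp
      next
        case False
        then obtain r where r: "f x = ennreal r" "0 < r"
          using pos[OF x] by (cases "f x") auto
        obtain n where "1 / r < real n" using reals_Archimedean2 by blast
        then have "1 \<le> real (Suc n) * r" using r by (simp add: field_simps)
        then have "1 \<le> of_nat (Suc n) * f x"
          using r by (simp add: ennreal_of_nat_eq_real_of_nat del: of_nat_Suc flip: ennreal_mult'' ennreal_1)
        then show ?thesis by (rule that)
      qed
      then show "x \<in> \<Union> (range A)" using x by (auto simp: A_def)
    qed (auto simp: A_def)
    show "\<forall>a\<in>range A. emeasure M a \<noteq> \<infinity>"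
    proof
      fix a assume "a \<in> range A"
      then obtain n where a: "a = A n" by auto
      have "emeasure M (A n) = (\<integral>\<^sup>+x. indicator (A n) x \<partial>M)" by simp
      also have "\<dots> \<le> (\<integral>\<^sup>+x. of_nat (Suc n) * f x \<partial>M)"
        by (intro nn_integral_mono) (auto simp: A_def indicator_def)
      also have "\<dots> < \<infinity>"
        using fin by (subst nn_integral_cmult) (auto simp: ennreal_mult_less_top of_nat_less_top simp del: of_nat_Suc)
      finally show "emeasure M a \<noteq> \<infinity>" using a by simp
    qed
  qed auto
qed

text \<open>Weighting by \<open>w (norm y)\<close> makes \<open>Q\<close> finite; its image under
  direction and radius is disintegrated by \<open>noise_outsourcing\<close>, and division by
  \<open>w\<close> gives back \<open>Q\<close>. Each radial part has \<open>w\<close>-integral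
  exactly \<open>1\<close>, which yields its sigma-finiteness, its positivity and the required
  integrability at one stroke.\<close>

lemma polar_decomposition_exists:
  fixes Q :: "(real^'n::finite) measure" and w :: "real \<Rightarrow> real"
  assumes sets_Q[measurable_cong]: "sets Q = sets borel" and Q0: "emeasure Q {0} = 0"
    and w[measurable]: "w \<in> borel_measurable borel" and w_pos: "\<And>r. 0 < r \<Longrightarrow> 0 < w r"
    and fin: "(\<integral>\<^sup>+y. ennreal (w (norm y)) \<partial>Q) < \<infinity>"
  shows "\<exists>Qo Qr. polar_decomposition Q Qo Qr \<and> (\<forall>\<xi>\<in>sphere 0 1. (\<integral>\<^sup>+r. ennreal (w r) \<partial>Qr \<xi>) < \<infinity>)"
proof -
  define S :: "(real^'n) measure" where "S = restrict_space borel (sphere 0 1)"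
  define R :: "real measure" where "R = restrict_space borel {0<..}"
  define U where "U = uniform_measure lborel {0<..<1::real}"
  have sets_U[measurable_cong, simp]: "sets U = sets borel" by (simp add: U_def)
  interpret U: prob_space U
    unfolding U_def by (rule prob_space_uniform_measure) auto
  have space_S: "space S = sphere 0 1" and space_R: "space R = {0<..}"
    by (simp_all add: S_def R_def space_restrict_space)
  have AE0: "AE y in Q. y \<noteq> 0"
    using Q0 by (intro AE_I[of _ _ "{0}"]) auto
  \<comment> \<open>The origin gets an arbitrary direction: \<open>p\<close> has to map into the
    sphere everywhere, while the origin is a null set. The radius is taken in
    \<open>ennreal\<close>, the target of \<open>noise_outsourcing\<close>.\<close>
  define p :: "real^'n \<Rightarrow> (real^'n) \<times> ennreal"
    where "p y = (if y = 0 then axis undefined 1 else sgn y, ennreal (norm y))" for y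
  have "(\<lambda>y. if y = 0 then axis undefined 1 else sgn y) \<in> measurable borel S"
    unfolding S_def
  proof (rule measurable_restrict_space2)
    have "(\<lambda>y::real^'n. if y = 0 then axis undefined 1 else y /\<^sub>R norm y) \<in> borel_measurable borel"
      by measurable
    then show "(\<lambda>y::real^'n. if y = 0 then axis undefined 1 else sgn y) \<in> borel_measurable borel"
      by (simp add: sgn_div_norm)
  qed (auto simp: norm_sgn)
  then have p[measurable]: "p \<in> measurable borel (S \<Otimes>\<^sub>M borel)"
    unfolding p_def by measurable
  define N where "N = distr (density Q (\<lambda>y. ennreal (w (norm y)))) (S \<Otimes>\<^sub>M borel) p"
  have nn_N: "(\<integral>\<^sup>+z. f z \<partial>N) = (\<integral>\<^sup>+y. ennreal (w (norm y)) * f (p y) \<partial>Q)"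
    if [measurable]: "f \<in> borel_measurable (S \<Otimes>\<^sub>M borel)" for f
    unfolding N_def by (subst nn_integral_distr; (subst nn_integral_density)?) auto
  have sets_N: "sets N = sets (S \<Otimes>\<^sub>M borel)" by (simp add: N_def)
  have "finite_measure N"
  proof (rule finite_measureI)
    have "emeasure N (space N) = (\<integral>\<^sup>+z. 1 \<partial>N)" by simp
    also have "\<dots> < \<infinity>" using fin by (subst nn_N) auto
    finally show "emeasure N (space N) \<noteq> \<infinity>" by simp
  qed
  from noise_outsourcing[OF sets_N this, folded U_def] obtain T
    where T: "(\<lambda>(x, u). T x u) \<in> borel_measurable (S \<Otimes>\<^sub>M borel)"
      and N_eq: "N = distr (distr N S fst \<Otimes>\<^sub>M U) (S \<Otimes>\<^sub>M borel) (\<lambda>(x, u). (x, T x u))" by blast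
  have T1[measurable]: "(\<lambda>z. T (fst z) (snd z)) \<in> borel_measurable (S \<Otimes>\<^sub>M borel)"
    using T by (simp add: split_beta')
  have T2[measurable]: "T x \<in> borel_measurable borel" if "x \<in> space S" for x
    using measurable_compose[OF measurable_Pair1'[OF that] T1] by simp
  \<comment> \<open>The quantile function may take the values \<open>0\<close> and
    \<open>\<top>\<close>. They are sent to \<open>1\<close>, so that the radial part lives on the
    open half-line for every direction and every noise value.\<close>
  define \<tau> :: "ennreal \<Rightarrow> real" where "\<tau> t = (if 0 < enn2real t then enn2real t else 1)" for t
  have \<tau>_pos: "0 < \<tau> t" for t by (simp add: \<tau>_def)
  have "\<tau> \<in> borel_measurable borel" unfolding \<tau>_def by measurable
  then have \<tau>[measurable]: "\<tau> \<in> measurable borel R"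
    unfolding R_def by (rule measurable_restrict_space2[rotated]) (auto simp: \<tau>_pos)
  have id_R[measurable]: "(\<lambda>x. x) \<in> borel_measurable R"
    unfolding R_def by (rule measurable_restrict_space1) measurable
  have id_S[measurable]: "(\<lambda>x. x) \<in> borel_measurable S"
    unfolding S_def by (rule measurable_restrict_space1) measurable
  note [measurable] = measurable_compose[OF id_R w]
  define Qo where "Qo = distr N S fst"
  \<comment> \<open>The law of the radius under uniform noise; the density \<open>1 / w r\<close>
    removes the weight again.\<close>
  define Qr where "Qr \<xi> = density (distr U R (\<lambda>u. \<tau> (T \<xi> u))) (\<lambda>r. ennreal (1 / w r))" for \<xi>
  have nn_Qr: "(\<integral>\<^sup>+r. f r \<partial>Qr \<xi>) = (\<integral>\<^sup>+u. ennreal (1 / w (\<tau> (T \<xi> u))) * f (\<tau> (T \<xi> u)) \<partial>U)"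
    if [measurable]: "f \<in> borel_measurable R" and \<xi>: "\<xi> \<in> sphere 0 1" for f \<xi>
  proof -
    have "T \<xi> \<in> borel_measurable borel" using T2 \<xi> by (simp add: space_S)
    from measurable_compose[OF this \<tau>] have [measurable]: "(\<lambda>u. \<tau> (T \<xi> u)) \<in> measurable U R"
      by (simp add: measurable_cong_sets[OF sets_U refl])
    show ?thesis unfolding Qr_def by (subst nn_integral_density; (subst nn_integral_distr)?) auto
  qed
  have sets_Qr: "sets (Qr \<xi>) = sets R" for \<xi> by (simp add: Qr_def)
  have w_Qr: "(\<integral>\<^sup>+r. ennreal (w r) \<partial>Qr \<xi>) = 1" if \<xi>: "\<xi> \<in> sphere 0 1" for \<xi>
  proof -
    have "(\<integral>\<^sup>+r. ennreal (w r) \<partial>Qr \<xi>) = (\<integral>\<^sup>+u. 1 \<partial>U)"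
    proof (subst nn_Qr[OF _ \<xi>], measurable, rule nn_integral_cong)
      fix u
      have "0 < w (\<tau> (T \<xi> u))" by (intro w_pos \<tau>_pos)
      then show "ennreal (1 / w (\<tau> (T \<xi> u))) * ennreal (w (\<tau> (T \<xi> u))) = 1"
        by (simp flip: ennreal_mult')
    qed
    then show ?thesis using U.emeasure_space_1 by simp
  qed
  have "polar_decomposition Q Qo Qr"
    unfolding polar_decomposition_def S_def[symmetric] R_def[symmetric]
  proof (intro conjI ballI)
    show "sets Qo = sets S" by (simp add: Qo_def)
    show "finite_measure Qo" unfolding Qo_def
      using \<open>finite_measure N\<close> by (intro finite_measure.finite_measure_distr) (auto simp: sets_N cong: measurable_cong_sets)
    fix \<xi> :: "real^'n" assume \<xi>: "\<xi> \<in> sphere 0 1"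
    show "sets (Qr \<xi>) = sets R" by (rule sets_Qr)
    have sp: "space (Qr \<xi>) = {0<..}" using sets_eq_imp_space_eq[OF sets_Qr[of \<xi>]] by (simp add: space_R)
    show "sigma_finite_measure (Qr \<xi>)"
      using w_pos w_Qr[OF \<xi>] sp by (intro sigma_finite_measure_if_nn_integral_finite[where f="\<lambda>r. ennreal (w r)"])
        (auto simp: measurable_cong_sets[OF sets_Qr refl])
    show "0 < emeasure (Qr \<xi>) {0<..}"
    proof (rule ccontr)
      assume "\<not> 0 < emeasure (Qr \<xi>) {0<..}"
      then have "emeasure (Qr \<xi>) (space (Qr \<xi>)) = 0" by (simp add: sp zero_less_iff_neq_zero)
      then have "AE r in Qr \<xi>. ennreal (w r) = 0"
        by (intro AE_I'[of "space (Qr \<xi>)"]) (auto simp: null_sets_def)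
      then have "(\<integral>\<^sup>+r. ennreal (w r) \<partial>Qr \<xi>) = (\<integral>\<^sup>+r. 0 \<partial>Qr \<xi>)"
        by (rule nn_integral_cong_AE)
      then show False using w_Qr[OF \<xi>] by simp
    qed
  next
    fix A assume [measurable]: "A \<in> sets R"
    have "(\<lambda>\<xi>. emeasure (Qr \<xi>) A) \<in> borel_measurable S \<longleftrightarrow>
      (\<lambda>\<xi>. \<integral>\<^sup>+u. ennreal (1 / w (\<tau> (T \<xi> u))) * indicator A (\<tau> (T \<xi> u)) \<partial>U) \<in> borel_measurable S"
      by (rule measurable_cong) (simp add: space_S nn_Qr[symmetric] sets_Qr)
    also have "\<dots>"
      by (rule U.borel_measurable_nn_integral) (simp add: split_beta')
    finally show "(\<lambda>\<xi>. emeasure (Qr \<xi>) A) \<in> borel_measurable S" .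
  next
    fix B :: "(real^'n) set" assume [measurable]: "B \<in> sets borel"
    have "(\<integral>\<^sup>+\<xi>. (\<integral>\<^sup>+r. indicator B (r *\<^sub>R \<xi>) \<partial>Qr \<xi>) \<partial>Qo) =
      (\<integral>\<^sup>+\<xi>. (\<integral>\<^sup>+u. ennreal (1 / w (\<tau> (T \<xi> u))) * indicator B (\<tau> (T \<xi> u) *\<^sub>R \<xi>) \<partial>U) \<partial>Qo)"
      by (intro nn_integral_cong nn_Qr) (auto simp: Qo_def space_S)
    \<comment> \<open>The disintegration of \<open>N\<close> is read backwards, and the resulting
      integral is then pulled back to \<open>Q\<close>.\<close>
    also have "\<dots> = (\<integral>\<^sup>+z. ennreal (1 / w (\<tau> (snd z))) * indicator B (\<tau> (snd z) *\<^sub>R fst z) \<partial>N)"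
      by (subst N_eq, subst nn_integral_distr)
         (auto simp: U.nn_integral_fst[symmetric] Qo_def split_beta')
    also have "\<dots> = (\<integral>\<^sup>+y. indicator B y \<partial>Q)"
    proof (subst nn_N, measurable, rule nn_integral_cong_AE, use AE0 in eventually_elim)
      fix y :: "real^'n" assume "y \<noteq> 0"
      then have "0 < w (norm y)" by (intro w_pos) simp
      with \<open>y \<noteq> 0\<close> show "ennreal (w (norm y)) * (ennreal (1 / w (\<tau> (snd (p y)))) *
          indicator B (\<tau> (snd (p y)) *\<^sub>R fst (p y))) = indicator B y"
        by (simp add: p_def \<tau>_def sgn_div_norm mult.assoc[symmetric] flip: ennreal_mult')
    qed
    also have "\<dots> = emeasure Q B" by (simp add: sets_Q)
    finally show "emeasure Q B = (\<integral>\<^sup>+\<xi>. (\<integral>\<^sup>+r. indicator B (r *\<^sub>R \<xi>) \<partial>Qr \<xi>) \<partial>Qo)" by simp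
  qed
  then show ?thesis using w_Qr by (metis ennreal_one_less_top infinity_ennreal_def)
qed

text \<open>Existence gives the \<open>SOME\<close> in \<open>chosen_polar\<close> its meaning: the
  chosen pair inherits the defining properties.\<close>

lemma chosen_polar_props:
  fixes Q :: "(real^'n::finite) measure" and w :: "real \<Rightarrow> real"
  assumes "sets Q = sets borel" "emeasure Q {0} = 0"
    and "w \<in> borel_measurable borel" "\<And>r. 0 < r \<Longrightarrow> 0 < w r"
    and "(\<integral>\<^sup>+y. ennreal (w (norm y)) \<partial>Q) < \<infinity>"
  obtains Qo Qr where "chosen_polar w Q = (Qo, Qr)" "polar_decomposition Q Qo Qr"
    "\<And>\<xi>. \<xi> \<in> sphere 0 1 \<Longrightarrow> (\<integral>\<^sup>+r. ennreal (w r) \<partial>Qr \<xi>) < \<infinity>"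
proof -
  have "\<exists>z. case z of (Qo, Qr) \<Rightarrow> polar_decomposition Q Qo Qr \<and>
     (\<forall>\<xi>\<in>sphere 0 1. (\<integral>\<^sup>+r. ennreal (w r) \<partial>Qr \<xi>) < \<infinity>)"
    using polar_decomposition_exists[OF assms] by auto
  from someI_ex[OF this] show ?thesis
    using that by (auto simp: chosen_polar_def split_beta' prod_eq_iff)
qed

section \<open>Integration in polar coordinates\<close>

context
  fixes Q :: "(real^'n::finite) measure" and Qo :: "(real^'n) measure"
    and Qr :: "real^'n \<Rightarrow> real measure" and w :: "real \<Rightarrow> real"
  assumes sets_Q[measurable_cong]: "sets Q = sets borel"
    and polar: "polar_decomposition Q Qo Qr"
    and w[measurable]: "w \<in> borel_measurable borel" and w_pos: "\<And>r. 0 < r \<Longrightarrow> 0 < w r"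
    and w_fin: "\<And>\<xi>. \<xi> \<in> sphere 0 1 \<Longrightarrow> (\<integral>\<^sup>+r. ennreal (w r) \<partial>Qr \<xi>) < \<infinity>"
begin

abbreviation (input) borel_sphere :: "(real^'n) measure" where
  "borel_sphere \<equiv> restrict_space borel (sphere 0 1)"

abbreviation (input) borel_pos :: "real measure" where
  "borel_pos \<equiv> restrict_space borel {0<..}"

lemma space_borel_sphere: "space borel_sphere = sphere 0 1" and space_borel_pos: "space borel_pos = {0<..}"
  by (simp_all add: space_restrict_space)

lemma borel_measurable_borel_pos: "f \<in> measurable borel N \<Longrightarrow> f \<in> measurable borel_pos N"
  by (rule measurable_restrict_space1)

lemma ident_borel_pos: "(\<lambda>x. x) \<in> measurable borel_pos borel"
  by (rule measurable_restrict_space1) measurable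

lemma ident_borel_sphere: "(\<lambda>x. x) \<in> measurable borel_sphere borel"
  by (rule measurable_restrict_space1) measurable

lemma polar_decomposition_props:
  shows sets_angular: "sets Qo = sets borel_sphere"
    and sets_radial: "\<xi> \<in> sphere 0 1 \<Longrightarrow> sets (Qr \<xi>) = sets borel_pos"
    and sigma_finite_radial: "\<xi> \<in> sphere 0 1 \<Longrightarrow> sigma_finite_measure (Qr \<xi>)"
    and emeasure_radial_pos: "\<xi> \<in> sphere 0 1 \<Longrightarrow> 0 < emeasure (Qr \<xi>) {0<..}"
    and measurable_radial: "A \<in> sets borel_pos \<Longrightarrow> (\<lambda>\<xi>. emeasure (Qr \<xi>) A) \<in> borel_measurable borel_sphere"
    and emeasure_polar: "B \<in> sets borel \<Longrightarrow> emeasure Q B = (\<integral>\<^sup>+\<xi>. (\<integral>\<^sup>+r. indicator B (r *\<^sub>R \<xi>) \<partial>Qr \<xi>) \<partial>Qo)"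
  using polar unfolding polar_decomposition_def by blast+

lemma space_radial: "\<xi> \<in> sphere 0 1 \<Longrightarrow> space (Qr \<xi>) = {0<..}"
  using sets_eq_imp_space_eq[OF sets_radial] by (simp add: space_borel_pos)

lemma nn_integral_radial_measurable_const:
  assumes "g \<in> borel_measurable borel_pos"
  shows "(\<lambda>\<xi>. \<integral>\<^sup>+r. g r \<partial>Qr \<xi>) \<in> borel_measurable borel_sphere"
  using assms
proof induct
  case (cong f g)
  have "(\<lambda>\<xi>. \<integral>\<^sup>+r. f r \<partial>Qr \<xi>) \<in> borel_measurable borel_sphere \<longleftrightarrow> (\<lambda>\<xi>. \<integral>\<^sup>+r. g r \<partial>Qr \<xi>) \<in> borel_measurable borel_sphere"
    using cong(3) by (intro measurable_cong nn_integral_cong) (simp add: space_borel_sphere space_radial space_borel_pos)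
  then show ?case using cong by simp
next
  case (set A)
  have "(\<lambda>\<xi>. \<integral>\<^sup>+r. indicator A r \<partial>Qr \<xi>) \<in> borel_measurable borel_sphere \<longleftrightarrow> (\<lambda>\<xi>. emeasure (Qr \<xi>) A) \<in> borel_measurable borel_sphere"
    by (intro measurable_cong) (simp add: space_borel_sphere sets_radial set)
  then show ?case using measurable_radial[OF set] by simp
next
  case (mult u c)
  have "(\<lambda>\<xi>. \<integral>\<^sup>+r. c * u r \<partial>Qr \<xi>) \<in> borel_measurable borel_sphere \<longleftrightarrow> (\<lambda>\<xi>. c * (\<integral>\<^sup>+r. u r \<partial>Qr \<xi>)) \<in> borel_measurable borel_sphere"
    using mult by (intro measurable_cong nn_integral_cmult) (simp add: space_borel_sphere measurable_cong_sets[OF sets_radial refl])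
  then show ?case using mult by simp
next
  case (add u v)
  have "(\<lambda>\<xi>. \<integral>\<^sup>+r. v r + u r \<partial>Qr \<xi>) \<in> borel_measurable borel_sphere \<longleftrightarrow>
      (\<lambda>\<xi>. (\<integral>\<^sup>+r. v r \<partial>Qr \<xi>) + (\<integral>\<^sup>+r. u r \<partial>Qr \<xi>)) \<in> borel_measurable borel_sphere"
    using add by (intro measurable_cong nn_integral_add) (simp_all add: space_borel_sphere measurable_cong_sets[OF sets_radial refl])
  then show ?case using add by simp
next
  case (seq U)
  have "(\<lambda>\<xi>. \<integral>\<^sup>+r. (SUP i. U i) r \<partial>Qr \<xi>) \<in> borel_measurable borel_sphere \<longleftrightarrow>
      (\<lambda>\<xi>. SUP i. \<integral>\<^sup>+r. U i r \<partial>Qr \<xi>) \<in> borel_measurable borel_sphere"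
    unfolding SUP_apply using seq
    by (intro measurable_cong nn_integral_monotone_convergence_SUP) (simp_all add: space_borel_sphere measurable_cong_sets[OF sets_radial refl])
  then show ?case using seq by simp
qed

text \<open>The radial parts are \<open>\<sigma>\<close>-finite only; normalising \<open>w Qr\<close> turns them into a probability
  kernel, for which joint measurability is available.\<close>

lemma nn_integral_radial_measurable:
  assumes [measurable]: "case_prod H \<in> borel_measurable (borel_sphere \<Otimes>\<^sub>M borel_pos)"
  shows "(\<lambda>\<xi>. \<integral>\<^sup>+r. H \<xi> r \<partial>Qr \<xi>) \<in> borel_measurable borel_sphere"
proof -
  define c where "c \<xi> = (\<integral>\<^sup>+r. ennreal (w r) \<partial>Qr \<xi>)" for \<xi>
  note [measurable] = borel_measurable_borel_pos[OF w]
  have [measurable]: "c \<in> borel_measurable borel_sphere"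
    unfolding c_def by (rule nn_integral_radial_measurable_const) measurable
  have c_pos: "c \<xi> \<noteq> 0" if \<xi>: "\<xi> \<in> sphere 0 1" for \<xi>
  \<comment> \<open>Otherwise \<open>w\<close> would vanish almost everywhere for
    \<open>Qr \<xi>\<close>; being positive on the half-line, it would force the radial part to be
    null.\<close>
  proof
    assume "c \<xi> = 0"
    then have "AE r in Qr \<xi>. ennreal (w r) = 0"
      unfolding c_def by (subst (asm) nn_integral_0_iff_AE) (simp_all add: measurable_cong_sets[OF sets_radial[OF \<xi>] refl])
    then have "AE r in Qr \<xi>. False"
      using AE_space by eventually_elim (use w_pos in \<open>force simp: space_radial[OF \<xi>]\<close>)
    then have "emeasure (Qr \<xi>) (space (Qr \<xi>)) = 0"
      by (subst (asm) AE_iff_measurable[of "space (Qr \<xi>)"]) auto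
    with emeasure_radial_pos[OF \<xi>] show False by (simp add: space_radial[OF \<xi>])
  qed
  define \<kappa> where "\<kappa> \<xi> = density (Qr \<xi>) (\<lambda>r. ennreal (w r) / c \<xi>)" for \<xi>
  have \<kappa>: "(\<integral>\<^sup>+r. g r \<partial>\<kappa> \<xi>) = (\<integral>\<^sup>+r. ennreal (w r) * g r \<partial>Qr \<xi>) / c \<xi>"
    if \<xi>: "\<xi> \<in> sphere 0 1" and [measurable]: "g \<in> borel_measurable borel_pos" for g \<xi>
  proof -
    have "(\<integral>\<^sup>+r. g r \<partial>\<kappa> \<xi>) = (\<integral>\<^sup>+r. ennreal (w r) * g r / c \<xi> \<partial>Qr \<xi>)"
      unfolding \<kappa>_def by (subst nn_integral_density)
        (auto simp: measurable_cong_sets[OF sets_radial[OF \<xi>] refl] ac_simps divide_ennreal_def)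
    then show ?thesis by (simp add: nn_integral_divide measurable_cong_sets[OF sets_radial[OF \<xi>] refl])
  qed
  have sets_\<kappa>: "sets (\<kappa> \<xi>) = sets borel_pos" if "\<xi> \<in> sphere 0 1" for \<xi>
    by (simp add: \<kappa>_def sets_radial[OF that])
  have [measurable]: "\<kappa> \<in> measurable borel_sphere (subprob_algebra borel_pos)"
  proof (rule measurable_subprob_algebra)
    fix \<xi> assume "\<xi> \<in> space borel_sphere"
    then have \<xi>: "\<xi> \<in> sphere 0 1" by (simp add: space_borel_sphere)
    show "sets (\<kappa> \<xi>) = sets borel_pos" by (rule sets_\<kappa>[OF \<xi>])
    have sp: "space (\<kappa> \<xi>) = {0<..}" by (simp add: \<kappa>_def space_radial[OF \<xi>])
    have "emeasure (\<kappa> \<xi>) (space (\<kappa> \<xi>)) = (\<integral>\<^sup>+r. 1 \<partial>\<kappa> \<xi>)" by simp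
    also have "\<dots> = c \<xi> / c \<xi>" by (subst \<kappa>[OF \<xi>]) (simp_all add: c_def)
    also have "\<dots> = 1" using c_pos[OF \<xi>] w_fin[OF \<xi>] by (simp add: c_def ennreal_divide_self)
    finally show "subprob_space (\<kappa> \<xi>)" by (intro subprob_spaceI) (auto simp: sp)
  next
    fix A assume [measurable]: "A \<in> sets borel_pos"
    have "(\<lambda>\<xi>. emeasure (\<kappa> \<xi>) A) \<in> borel_measurable borel_sphere \<longleftrightarrow>
        (\<lambda>\<xi>. (\<integral>\<^sup>+r. ennreal (w r) * indicator A r \<partial>Qr \<xi>) / c \<xi>) \<in> borel_measurable borel_sphere"
      by (rule measurable_cong) (simp add: space_borel_sphere \<kappa>[symmetric] sets_\<kappa>)
    also have "\<dots>"
      using nn_integral_radial_measurable_const[of "\<lambda>r. ennreal (w r) * indicator A r"] by measurable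
    finally show "(\<lambda>\<xi>. emeasure (\<kappa> \<xi>) A) \<in> borel_measurable borel_sphere" .
  qed
  have cancel: "d * (X / d) = X" if "d \<noteq> 0" "d \<noteq> \<top>" for d X :: ennreal
    using that by (metis ennreal_mult_divide_eq ennreal_times_divide mult.commute)
  \<comment> \<open>Dividing by \<open>w\<close> inside and multiplying by \<open>c\<close> outside
    undoes the normalisation, so measurability passes from \<open>\<kappa>\<close> to the radial
    parts. Cancellation in \<open>ennreal\<close> is legitimate since both factors are positive and
    finite.\<close>
  have "(\<lambda>\<xi>. c \<xi> * (\<integral>\<^sup>+r. H \<xi> r / ennreal (w r) \<partial>\<kappa> \<xi>)) \<in> borel_measurable borel_sphere"
    by (intro borel_measurable_times_ennreal nn_integral_measurable_subprob_algebra2[where N=borel_pos]) measurable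
  also have "?this \<longleftrightarrow> (\<lambda>\<xi>. \<integral>\<^sup>+r. H \<xi> r \<partial>Qr \<xi>) \<in> borel_measurable borel_sphere"
  proof (rule measurable_cong)
    fix \<xi> assume \<xi>': "\<xi> \<in> space borel_sphere"
    then have \<xi>: "\<xi> \<in> sphere 0 1" by (simp add: space_borel_sphere)
    have [measurable]: "H \<xi> \<in> borel_measurable borel_pos"
      using measurable_compose[OF measurable_Pair1'[OF \<xi>'] assms] by simp
    have "c \<xi> * (\<integral>\<^sup>+r. H \<xi> r / ennreal (w r) \<partial>\<kappa> \<xi>) = (\<integral>\<^sup>+r. ennreal (w r) * (H \<xi> r / ennreal (w r)) \<partial>Qr \<xi>)"
      using c_pos[OF \<xi>] w_fin[OF \<xi>] by (subst \<kappa>[OF \<xi>]) (auto simp: c_def intro!: cancel)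
    also have "\<dots> = (\<integral>\<^sup>+r. H \<xi> r \<partial>Qr \<xi>)"
    proof (rule nn_integral_cong)
      fix r assume "r \<in> space (Qr \<xi>)"
      then have "0 < w r" by (simp add: space_radial[OF \<xi>] w_pos)
      then show "ennreal (w r) * (H \<xi> r / ennreal (w r)) = H \<xi> r"
        by (intro cancel) auto
    qed
    finally show "c \<xi> * (\<integral>\<^sup>+r. H \<xi> r / ennreal (w r) \<partial>\<kappa> \<xi>) = (\<integral>\<^sup>+r. H \<xi> r \<partial>Qr \<xi>)" .
  qed
  finally show ?thesis .
qed

lemma ray_measurable:
  assumes [measurable]: "G \<in> borel_measurable borel"
  shows "(\<lambda>(\<xi>, r). G (r *\<^sub>R \<xi>)) \<in> borel_measurable (borel_sphere \<Otimes>\<^sub>M borel_pos)"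
proof -
  have "(\<lambda>z. snd z *\<^sub>R fst z) \<in> measurable (borel_sphere \<Otimes>\<^sub>M borel_pos) borel"
    by (intro borel_measurable_scaleR measurable_compose[OF measurable_snd ident_borel_pos]
        measurable_compose[OF measurable_fst ident_borel_sphere])
  from measurable_compose[OF this assms] show ?thesis by (simp add: split_beta')
qed

lemma nn_integral_polar_measurable:
  assumes [measurable]: "G \<in> borel_measurable borel"
  shows "(\<lambda>\<xi>. \<integral>\<^sup>+r. G (r *\<^sub>R \<xi>) \<partial>Qr \<xi>) \<in> borel_measurable Qo"
  using nn_integral_radial_measurable[OF ray_measurable[OF assms]]
  by (simp add: measurable_cong_sets[OF sets_angular refl])

lemma ray_measurable_radial:
  assumes [measurable]: "G \<in> borel_measurable borel" and \<xi>: "\<xi> \<in> space Qo"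
  shows "(\<lambda>r. G (r *\<^sub>R \<xi>)) \<in> borel_measurable (Qr \<xi>)"
proof -
  have "\<xi> \<in> space borel_sphere" using \<xi> sets_eq_imp_space_eq[OF sets_angular] by simp
  from measurable_compose[OF measurable_Pair1'[OF this] ray_measurable[OF assms(1)]] this
  show ?thesis by (simp add: measurable_cong_sets[OF sets_radial refl] space_borel_sphere)
qed

text \<open>Induction over non-negative measurable functions from the defining identity for sets.
  Measurability of the inner integral in the direction is what permits splitting the outer one and
  exchanging it with suprema.\<close>

lemma nn_integral_polar:
  assumes "G \<in> borel_measurable borel"
  shows "(\<integral>\<^sup>+y. G y \<partial>Q) = (\<integral>\<^sup>+\<xi>. (\<integral>\<^sup>+r. G (r *\<^sub>R \<xi>) \<partial>Qr \<xi>) \<partial>Qo)"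
  using assms
proof induct
  case (cong f g)
  then have "f = g" by auto
  with cong show ?case by simp
next
  case (set A)
  then show ?case by (simp add: emeasure_polar sets_Q)
next
  case (mult u c)
  then show ?case
    by (simp add: nn_integral_cmult ray_measurable_radial nn_integral_polar_measurable measurable_cong_sets[OF sets_Q refl]
        cong: nn_integral_cong)
next
  case (add u v)
  then show ?case
    by (simp add: nn_integral_add ray_measurable_radial nn_integral_polar_measurable measurable_cong_sets[OF sets_Q refl]
        cong: nn_integral_cong)
next
  case (seq U)
  have mono: "incseq (\<lambda>i. U i (r *\<^sub>R \<xi>))" for r \<xi> using seq by (auto simp: incseq_def le_fun_def)
  have "(\<integral>\<^sup>+y. (SUP i. U i) y \<partial>Q) = (SUP i. \<integral>\<^sup>+y. U i y \<partial>Q)"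
    unfolding SUP_apply using seq by (intro nn_integral_monotone_convergence_SUP) (auto simp: measurable_cong_sets[OF sets_Q refl])
  also have "\<dots> = (SUP i. \<integral>\<^sup>+\<xi>. (\<integral>\<^sup>+r. U i (r *\<^sub>R \<xi>) \<partial>Qr \<xi>) \<partial>Qo)"
    using seq by simp
  also have "\<dots> = (\<integral>\<^sup>+\<xi>. (SUP i. (\<integral>\<^sup>+r. U i (r *\<^sub>R \<xi>) \<partial>Qr \<xi>)) \<partial>Qo)"
    using seq by (intro nn_integral_monotone_convergence_SUP[symmetric] nn_integral_polar_measurable)
      (auto simp: incseq_def le_fun_def intro!: nn_integral_mono)
  also have "\<dots> = (\<integral>\<^sup>+\<xi>. (\<integral>\<^sup>+r. (SUP i. U i) (r *\<^sub>R \<xi>) \<partial>Qr \<xi>) \<partial>Qo)"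
    unfolding SUP_apply using seq
    by (intro nn_integral_cong nn_integral_monotone_convergence_SUP[symmetric] ray_measurable_radial)
      (auto simp: incseq_def le_fun_def)
  finally show ?case .
qed

end

section \<open>Radial tails\<close>

text \<open>Extending \<open>k\<close> by zero off the open segment turns integrals over a segment
  of varying length into integrals over the whole line, so that Fubini's theorem applies on a
  product with \<open>lborel\<close>.\<close>

definition ray_weight :: "(real \<Rightarrow> real \<Rightarrow> real) \<Rightarrow> real \<Rightarrow> real \<Rightarrow> real" where
  "ray_weight k r z = (if 0 < z \<and> z < r then k r z else 0)"

lemma borel_measurable_ray_weight:
  assumes k: "case_prod k \<in> borel_measurable borel"
    and [measurable]: "f \<in> borel_measurable M" "g \<in> borel_measurable M"
  shows "(\<lambda>x. ray_weight k (f x) (g x)) \<in> borel_measurable M"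
proof -
  have [measurable]: "(\<lambda>x. k (f x) (g x)) \<in> borel_measurable M"
    using measurable_compose[OF borel_measurable_Pair[OF assms(2,3)] k] by simp
  show ?thesis unfolding ray_weight_def by measurable
qed

text \<open>For \<open>k = 1\<close> and \<open>k r z = r - z\<close> these are the integrated and the double-integrated radial
  tail, written without a polar decomposition: the mass of \<open>Q\<close> at \<open>y\<close> is spread over the segment
  from \<open>0\<close> to \<open>y\<close>.\<close>

definition ray_tail :: "(real \<Rightarrow> real \<Rightarrow> real) \<Rightarrow> (real^'n::finite) measure \<Rightarrow> (real^'n) measure" where
  "ray_tail k Q = distr
     (density (Q \<Otimes>\<^sub>M lborel) (\<lambda>(y, z). ennreal (ray_weight k (norm y) z)))
     borel (\<lambda>(y, z). z *\<^sub>R sgn y)"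

lemma borel_measurable_sgn_vec[measurable]:
  "sgn \<in> borel_measurable (borel :: (real^'n::finite) measure)"
  unfolding sgn_div_norm by measurable

text \<open>Covers both tails: \<open>K\<close> is whatever results from integrating the weight over
  \<open>Qr \<xi>\<close>. Tonelli's theorem exchanges \<open>r\<close> and \<open>z\<close>, and
  the polar formula turns the outcome into an integral over \<open>Q\<close>. The set function thus
  agrees with a genuine measure on Borel sets, so \<open>measure_of\<close> does not degenerate to
  the zero measure.\<close>

lemma measure_of_eq_ray_tail:
  fixes Q Qo :: "(real^'n::finite) measure"
  assumes sets_Q[measurable_cong]: "sets Q = sets borel"
    and polar: "polar_decomposition Q Qo Qr"
    and w: "w \<in> borel_measurable borel" "\<And>r. 0 < r \<Longrightarrow> 0 < w r"
    and w_fin: "\<And>\<xi>. \<xi> \<in> sphere 0 1 \<Longrightarrow> (\<integral>\<^sup>+r. ennreal (w r) \<partial>Qr \<xi>) < \<infinity>"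
    and k[measurable]: "case_prod k \<in> borel_measurable borel"
    and k_pos: "\<And>r z. 0 < z \<Longrightarrow> z < r \<Longrightarrow> 0 \<le> k r z"
    and K: "\<And>\<xi> z. \<xi> \<in> sphere 0 1 \<Longrightarrow> 0 < z \<Longrightarrow>
      K \<xi> z = (\<integral>\<^sup>+r. ennreal (ray_weight k r z) \<partial>Qr \<xi>)"
  shows "measure_of UNIV (sets borel)
      (\<lambda>B. \<integral>\<^sup>+\<xi>. (\<integral>\<^sup>+z\<in>{0<..}. indicator B (z *\<^sub>R \<xi>) * K \<xi> z \<partial>lborel) \<partial>Qo) = ray_tail k Q"
proof -
  note [measurable] = borel_measurable_ray_weight[OF k]
  have "emeasure (ray_tail k Q) B =
      (\<integral>\<^sup>+\<xi>. (\<integral>\<^sup>+z\<in>{0<..}. indicator B (z *\<^sub>R \<xi>) * K \<xi> z \<partial>lborel) \<partial>Qo)"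
    if [measurable]: "B \<in> sets borel" for B
  proof -
    define G where "G y = (\<integral>\<^sup>+z. ennreal (ray_weight k (norm y) z) * indicator B (z *\<^sub>R sgn y) \<partial>lborel)"
      for y :: "real^'n"
    have [measurable]: "G \<in> borel_measurable borel" unfolding G_def by measurable
    have "emeasure (ray_tail k Q) B = (\<integral>\<^sup>+x. indicator B x \<partial>ray_tail k Q)"
      by (simp add: ray_tail_def)
    also have "\<dots> = (\<integral>\<^sup>+(y, z). ennreal (ray_weight k (norm y) z) * indicator B (z *\<^sub>R sgn y) \<partial>(Q \<Otimes>\<^sub>M lborel))"
      unfolding ray_tail_def
      by (subst nn_integral_distr; (subst nn_integral_density)?) (auto simp: split_beta')
    also have "\<dots> = (\<integral>\<^sup>+y. G y \<partial>Q)"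
      unfolding G_def by (subst lborel.nn_integral_fst[symmetric]) auto
    also have "\<dots> = (\<integral>\<^sup>+\<xi>. (\<integral>\<^sup>+r. G (r *\<^sub>R \<xi>) \<partial>Qr \<xi>) \<partial>Qo)"
      by (rule nn_integral_polar[OF sets_Q polar w w_fin]) auto
    also have "\<dots> = (\<integral>\<^sup>+\<xi>. (\<integral>\<^sup>+z\<in>{0<..}. indicator B (z *\<^sub>R \<xi>) * K \<xi> z \<partial>lborel) \<partial>Qo)"
    proof (rule nn_integral_cong)
      fix \<xi> assume "\<xi> \<in> space Qo"
      then have \<xi>: "\<xi> \<in> sphere 0 1"
        using sets_eq_imp_space_eq[OF sets_angular[OF sets_Q polar w w_fin]] by (simp add: space_restrict_space)
      have sets_Qr: "sets (Qr \<xi>) = sets (restrict_space borel {0<..})" "space (Qr \<xi>) = {0<..}"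
        using polar_decomposition_props(2)[OF sets_Q polar w w_fin] space_radial[OF sets_Q polar w w_fin] \<xi> by auto
      interpret Qr: sigma_finite_measure "Qr \<xi>" using sigma_finite_radial[OF sets_Q polar w w_fin \<xi>] .
      interpret pair_sigma_finite "Qr \<xi>" lborel ..
      have [measurable]: "(\<lambda>x. x) \<in> borel_measurable (Qr \<xi>)"
        by (simp add: measurable_cong_sets[OF sets_Qr(1) refl] measurable_restrict_space1)
      have "(\<integral>\<^sup>+r. G (r *\<^sub>R \<xi>) \<partial>Qr \<xi>) =
          (\<integral>\<^sup>+r. (\<integral>\<^sup>+z. ennreal (ray_weight k r z) * indicator B (z *\<^sub>R \<xi>) \<partial>lborel) \<partial>Qr \<xi>)"
        using \<xi> by (intro nn_integral_cong) (simp add: G_def sets_Qr sgn_div_norm)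
      also have "\<dots> = (\<integral>\<^sup>+z. (\<integral>\<^sup>+r. ennreal (ray_weight k r z) * indicator B (z *\<^sub>R \<xi>) \<partial>Qr \<xi>) \<partial>lborel)"
        by (rule Fubini'[symmetric]) measurable
      also have "\<dots> = (\<integral>\<^sup>+z\<in>{0<..}. indicator B (z *\<^sub>R \<xi>) * K \<xi> z \<partial>lborel)"
      proof (rule nn_integral_cong)
        fix z :: real
        show "(\<integral>\<^sup>+r. ennreal (ray_weight k r z) * indicator B (z *\<^sub>R \<xi>) \<partial>Qr \<xi>) =
            indicator B (z *\<^sub>R \<xi>) * K \<xi> z * indicator {0<..} z"
        proof (cases "0 < z")
          case True
          then show ?thesis by (subst nn_integral_multc) (simp_all add: K[OF \<xi>] mult.commute)
        qed (simp add: ray_weight_def)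
      qed
      finally show "(\<integral>\<^sup>+r. G (r *\<^sub>R \<xi>) \<partial>Qr \<xi>) = (\<integral>\<^sup>+z\<in>{0<..}. indicator B (z *\<^sub>R \<xi>) * K \<xi> z \<partial>lborel)" .
    qed
    finally show ?thesis .
  qed
  then have "measure_of UNIV (sets borel)
      (\<lambda>B. \<integral>\<^sup>+\<xi>. (\<integral>\<^sup>+z\<in>{0<..}. indicator B (z *\<^sub>R \<xi>) * K \<xi> z \<partial>lborel) \<partial>Qo) =
      measure_of UNIV (sets borel) (emeasure (ray_tail k Q))"
    by (intro measure_of_eq) (use sets.sigma_sets_eq[of "borel :: (real^'n) measure"] in auto)
  also have "\<dots> = ray_tail k Q"
    using measure_of_of_measure[of "ray_tail k Q"] by (simp add: ray_tail_def)
  finally show ?thesis .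
qed

lemma integrated_tail_eq_ray_tail:
  fixes Q :: "(real^'n::finite) measure"
  assumes Q: "sets Q = sets borel" "emeasure Q {0} = 0"
    and fin: "(\<integral>\<^sup>+y. ennreal (min 1 ((norm y)\<^sup>2)) \<partial>Q) < \<infinity>"
  shows "integrated_tail Q = ray_tail (\<lambda>r z. 1) Q"
proof -
  obtain Qo Qr where chosen: "chosen_polar (\<lambda>r. min 1 (r\<^sup>2)) Q = (Qo, Qr)"
    and polar: "polar_decomposition Q Qo Qr"
    and w: "\<And>\<xi>. \<xi> \<in> sphere 0 1 \<Longrightarrow> (\<integral>\<^sup>+r. ennreal (min 1 (r\<^sup>2)) \<partial>Qr \<xi>) < \<infinity>"
    by (rule chosen_polar_props[OF Q _ _ fin]) auto
  show ?thesis
    unfolding integrated_tail_def chosen case_prod_conv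
  proof (rule measure_of_eq_ray_tail[OF Q(1) polar _ _ w])
    fix \<xi> :: "real^'n" and z :: real assume \<xi>: "\<xi> \<in> sphere 0 1" and z: "0 < z"
    have "(\<integral>\<^sup>+r. ennreal (ray_weight (\<lambda>r z. 1) r z) \<partial>Qr \<xi>) = (\<integral>\<^sup>+r. indicator {z<..} r \<partial>Qr \<xi>)"
      using z by (intro nn_integral_cong) (auto simp: indicator_def ray_weight_def)
    also have "\<dots> = emeasure (Qr \<xi>) {z<..}"
      using polar \<xi> z by (intro nn_integral_indicator) (auto simp: polar_decomposition_def sets_restrict_space_iff)
    finally show "emeasure (Qr \<xi>) {z<..} = (\<integral>\<^sup>+r. ennreal (ray_weight (\<lambda>r z. 1) r z) \<partial>Qr \<xi>)" by simp
  qed auto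
qed

text \<open>The weight \<open>r - z\<close> is a length: by Tonelli's theorem the inner variable is
  integrated first, and for fixed \<open>r\<close> it ranges over the interval from \<open>z\<close>
  to \<open>r\<close>.\<close>

lemma double_integrated_tail_eq_ray_tail:
  fixes Q :: "(real^'n::finite) measure"
  assumes Q: "sets Q = sets borel" "emeasure Q {0} = 0"
    and fin: "(\<integral>\<^sup>+y. ennreal (min (norm y) ((norm y)\<^sup>2)) \<partial>Q) < \<infinity>"
  shows "double_integrated_tail Q = ray_tail (\<lambda>r z. r - z) Q"
proof -
  obtain Qo Qr where chosen: "chosen_polar (\<lambda>r. min r (r\<^sup>2)) Q = (Qo, Qr)"
    and polar: "polar_decomposition Q Qo Qr"
    and w: "\<And>\<xi>. \<xi> \<in> sphere 0 1 \<Longrightarrow> (\<integral>\<^sup>+r. ennreal (min r (r\<^sup>2)) \<partial>Qr \<xi>) < \<infinity>"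
    by (rule chosen_polar_props[OF Q _ _ fin]) auto
  show ?thesis
    unfolding double_integrated_tail_def chosen case_prod_conv
  proof (rule measure_of_eq_ray_tail[OF Q(1) polar _ _ w])
    fix \<xi> :: "real^'n" and z :: real assume \<xi>: "\<xi> \<in> sphere 0 1" and z: "0 < z"
    have sets_Qr: "sets (Qr \<xi>) = sets (restrict_space borel {0<..})" "sigma_finite_measure (Qr \<xi>)"
      using polar \<xi> by (auto simp: polar_decomposition_def)
    interpret Qr: sigma_finite_measure "Qr \<xi>" by fact
    interpret pair_sigma_finite "Qr \<xi>" lborel ..
    have [measurable]: "(\<lambda>x. x) \<in> borel_measurable (Qr \<xi>)"
      by (simp add: measurable_cong_sets[OF sets_Qr(1) refl] measurable_restrict_space1)
    have "(\<integral>\<^sup>+z1\<in>{z<..}. emeasure (Qr \<xi>) {z1<..} \<partial>lborel) =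
        (\<integral>\<^sup>+z1. (\<integral>\<^sup>+r. (if z < z1 \<and> z1 < r then 1 else 0) \<partial>Qr \<xi>) \<partial>lborel)"
    proof (rule nn_integral_cong)
      fix z1 :: real
      show "emeasure (Qr \<xi>) {z1<..} * indicator {z<..} z1 = (\<integral>\<^sup>+r. (if z < z1 \<and> z1 < r then 1 else 0) \<partial>Qr \<xi>)"
      proof (cases "z < z1")
        case True
        have "(\<integral>\<^sup>+r. (if z < z1 \<and> z1 < r then 1 else 0) \<partial>Qr \<xi>) = (\<integral>\<^sup>+r. indicator {z1<..} r \<partial>Qr \<xi>)"
          using True by (intro nn_integral_cong) (auto simp: indicator_def)
        then show ?thesis
          using True z by (simp add: sets_Qr sets_restrict_space_iff)
      qed simp
    qed
    also have "\<dots> = (\<integral>\<^sup>+r. (\<integral>\<^sup>+z1. (if z < z1 \<and> z1 < r then 1 else 0) \<partial>lborel) \<partial>Qr \<xi>)"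
      by (rule Fubini') measurable
    also have "\<dots> = (\<integral>\<^sup>+r. (\<integral>\<^sup>+z1. indicator {z<..<r} z1 \<partial>lborel) \<partial>Qr \<xi>)"
      by (intro nn_integral_cong) (auto simp: indicator_def)
    also have "\<dots> = (\<integral>\<^sup>+r. ennreal (ray_weight (\<lambda>r z. r - z) r z) \<partial>Qr \<xi>)"
      using z by (intro nn_integral_cong) (auto simp: ray_weight_def)
    finally show "(\<integral>\<^sup>+z1\<in>{z<..}. emeasure (Qr \<xi>) {z1<..} \<partial>lborel) =
        (\<integral>\<^sup>+r. ennreal (ray_weight (\<lambda>r z. r - z) r z) \<partial>Qr \<xi>)" .
  next
    show "case_prod (\<lambda>r z::real. r - z) \<in> borel_measurable borel"
      unfolding split_beta' by (intro borel_measurable_continuous_onI continuous_intros)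
  qed (auto simp: zero_less_power2)
qed

text \<open>Image measure, density and Fubini in this order. The hypothesis \<open>fin\<close> is
  absolute integrability on the product, from which the iterated integral inherits integrability in
  \<open>y\<close>.\<close>

lemma integral_ray_tail:
  fixes Q :: "(real^'n::finite) measure" and g :: "real^'n \<Rightarrow> real"
  assumes sets_Q[measurable_cong]: "sets Q = sets borel" and "sigma_finite_measure Q"
    and k[measurable]: "case_prod k \<in> borel_measurable borel"
    and k_pos: "\<And>r z. 0 < z \<Longrightarrow> z < r \<Longrightarrow> 0 \<le> k r z"
    and g[measurable]: "g \<in> borel_measurable borel"
    and fin: "(\<integral>\<^sup>+y. (\<integral>\<^sup>+z. ennreal (ray_weight k (norm y) z * \<bar>g (z *\<^sub>R sgn y)\<bar>) \<partial>lborel) \<partial>Q) < \<infinity>"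
  shows "integrable (ray_tail k Q) g" (is ?int)
    and "(\<integral>x. g x \<partial>ray_tail k Q) =
      (\<integral>y. (\<integral>z. ray_weight k (norm y) z * g (z *\<^sub>R sgn y) \<partial>lborel) \<partial>Q)" (is ?eq)
    and "integrable Q (\<lambda>y. \<integral>z. ray_weight k (norm y) z * g (z *\<^sub>R sgn y) \<partial>lborel)" (is ?int2)
proof -
  note [measurable] = borel_measurable_ray_weight[OF k]
  interpret Q: sigma_finite_measure Q by fact
  interpret pair_sigma_finite Q lborel ..
  have nonneg: "0 \<le> ray_weight k r z" for r z using k_pos by (auto simp: ray_weight_def)
  have int: "integrable (Q \<Otimes>\<^sub>M lborel) (\<lambda>(y, z). ray_weight k (norm y) z * g (z *\<^sub>R sgn y))"
  proof (rule integrableI_bounded)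
    have "(\<integral>\<^sup>+x. ennreal (norm (case x of (y, z) \<Rightarrow> ray_weight k (norm y) z * g (z *\<^sub>R sgn y))) \<partial>(Q \<Otimes>\<^sub>M lborel)) =
      (\<integral>\<^sup>+y. (\<integral>\<^sup>+z. ennreal (ray_weight k (norm y) z * \<bar>g (z *\<^sub>R sgn y)\<bar>) \<partial>lborel) \<partial>Q)"
      by (subst lborel.nn_integral_fst[symmetric]) (auto simp: split_beta' abs_mult abs_of_nonneg[OF nonneg])
    with fin show "(\<integral>\<^sup>+x. ennreal (norm (case x of (y, z) \<Rightarrow> ray_weight k (norm y) z * g (z *\<^sub>R sgn y))) \<partial>(Q \<Otimes>\<^sub>M lborel)) < \<infinity>"
      by simp
  qed measurable
  have "integrable (density (Q \<Otimes>\<^sub>M lborel) (\<lambda>(y, z). ennreal (ray_weight k (norm y) z))) (\<lambda>(y, z). g (z *\<^sub>R sgn y))"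
    using int nonneg unfolding split_beta' by (subst integrable_density) auto
  then show ?int
    unfolding ray_tail_def by (subst integrable_distr_eq) (auto simp: split_beta')
  have "(\<integral>x. g x \<partial>ray_tail k Q) = (\<integral>(y, z). ray_weight k (norm y) z * g (z *\<^sub>R sgn y) \<partial>(Q \<Otimes>\<^sub>M lborel))"
    unfolding ray_tail_def split_beta' using nonneg
    by (subst integral_distr, measurable, subst integral_density) auto
  also have "\<dots> = (\<integral>y. (\<integral>z. ray_weight k (norm y) z * g (z *\<^sub>R sgn y) \<partial>lborel) \<partial>Q)"
    using integral_fst[OF int] by simp
  finally show ?eq .
  show ?int2 using integrable_fst[OF int] .
qed

section \<open>Taylor expansion of the jump part\<close>

lemma has_real_derivative_partial_deriv:
  assumes "partial_differentiable i f (x + t *\<^sub>R axis i 1)"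
  shows "((\<lambda>s. f (x + s *\<^sub>R axis i 1)) has_real_derivative partial_deriv i f (x + t *\<^sub>R axis i 1)) (at t)"
proof -
  have "((\<lambda>s. f (x + t *\<^sub>R axis i 1 + s *\<^sub>R axis i 1)) has_real_derivative partial_deriv i f (x + t *\<^sub>R axis i 1)) (at 0)"
    using assms unfolding partial_differentiable_def partial_deriv_def
    by (simp add: DERIV_deriv_iff_real_differentiable)
  then have "((\<lambda>s. f (x + (t + s) *\<^sub>R axis i 1)) has_real_derivative partial_deriv i f (x + t *\<^sub>R axis i 1)) (at 0)"
    by (simp add: scaleR_left_distrib add.assoc)
  then show ?thesis
    using DERIV_shift[of "\<lambda>s. f (x + s *\<^sub>R axis i 1)" _ 0 t] by (simp add: add.commute)
qed

text \<open>The increment is split into steps along the coordinate axes. \<open>p S h\<close> keeps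
  the coordinates of \<open>h\<close> in \<open>S\<close>; the induction over \<open>S\<close>
  spends half of the admissible error on the coordinates already treated and half on the new
  one.\<close>

lemma has_derivative_if_continuous_partials:
  fixes f :: "real^'n::finite \<Rightarrow> real"
  assumes diff: "\<And>i x. partial_differentiable i f x"
    and cont: "\<And>i. continuous_on UNIV (partial_deriv i f)"
  shows "(f has_derivative (\<lambda>h. grad f x \<bullet> h)) (at x)"
proof -
  define p where "p S h = (\<chi> i. if i \<in> S then h $ i else 0)" for S :: "'n set" and h :: "real^'n"
  have *: "\<exists>d>0. \<forall>h. norm h < d \<longrightarrow> \<bar>f (x + p S h) - f x - (\<Sum>i\<in>S. h $ i * partial_deriv i f x)\<bar> \<le> e * norm h"
    if "0 < e" for e S
    using finite[of S] that
  proof (induction S arbitrary: e rule: finite_induct)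
    case empty
    have "p {} h = 0" for h by (simp add: p_def vec_eq_iff)
    then show ?case using empty by (auto intro!: exI[of _ 1])
  next
    case (insert j S)
    from insert.IH[of "e / 2"] insert.prems obtain d1 where d1: "0 < d1"
      "\<And>h. norm h < d1 \<Longrightarrow> \<bar>f (x + p S h) - f x - (\<Sum>i\<in>S. h $ i * partial_deriv i f x)\<bar> \<le> e / 2 * norm h"
      by auto
    have "isCont (partial_deriv j f) x"
      using cont[of j] by (simp add: continuous_on_eq_continuous_at)
    then obtain d2 where d2: "0 < d2" "\<And>v. norm v < d2 \<Longrightarrow> \<bar>partial_deriv j f (x + v) - partial_deriv j f x\<bar> < e / 2"
      using insert.prems unfolding continuous_at_eps_delta
      by (metis add_diff_cancel_left' dist_norm half_gt_zero real_norm_def)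
    show ?case
    proof (intro exI[of _ "min d1 d2"] conjI allI impI)
      fix h :: "real^'n" assume h: "norm h < min d1 d2"
      let ?y = "x + p S h"
      \<comment> \<open>With the linear part subtracted, the derivative is the deviation of the
        partial derivative from its value at \<open>x\<close>, so the mean value bound holds with
        the small constant \<open>e / 2\<close>.\<close>
      define \<psi> where "\<psi> t = f (?y + t *\<^sub>R axis j 1) - t * partial_deriv j f x" for t
      have "norm (\<psi> (h $ j) - \<psi> 0) \<le> e / 2 * norm (h $ j - 0)"
      proof (rule field_differentiable_bound)
        show "convex (cball (0::real) \<bar>h $ j\<bar>)" by (rule convex_cball)
        fix t :: real assume t: "t \<in> cball (0::real) \<bar>h $ j\<bar>"
        have "(\<psi> has_real_derivative (partial_deriv j f (?y + t *\<^sub>R axis j 1) - 1 * partial_deriv j f x)) (at t)"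
          unfolding \<psi>_def
          by (intro DERIV_diff has_real_derivative_partial_deriv diff DERIV_cmult_right DERIV_ident)
        then show "(\<psi> has_field_derivative (partial_deriv j f (?y + t *\<^sub>R axis j 1) - partial_deriv j f x))
            (at t within cball (0::real) \<bar>h $ j\<bar>)"
          by (simp add: has_field_derivative_at_within)
        \<comment> \<open>\<open>p S h\<close> has no \<open>j\<close>-th coordinate and
          \<open>t\<close> is at most that of \<open>h\<close> in modulus, so intermediate points
          stay within distance \<open>norm h\<close> of \<open>x\<close>.\<close>
        have "norm (p S h + t *\<^sub>R axis j 1) \<le> norm h"
          using insert.hyps t by (intro norm_le_componentwise_cart) (auto simp: p_def axis_def)
        then show "norm (partial_deriv j f (?y + t *\<^sub>R axis j 1) - partial_deriv j f x) \<le> e / 2"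
          using d2(2)[of "p S h + t *\<^sub>R axis j 1"] h by (simp add: add.assoc)
      qed auto
      moreover have "?y + (h $ j) *\<^sub>R axis j 1 = x + p (insert j S) h"
        using insert.hyps by (auto simp: p_def axis_def vec_eq_iff)
      ultimately have 1: "\<bar>f (x + p (insert j S) h) - f ?y - h $ j * partial_deriv j f x\<bar> \<le> e / 2 * \<bar>h $ j\<bar>"
        by (simp add: \<psi>_def algebra_simps)
      have "e / 2 * \<bar>h $ j\<bar> \<le> e / 2 * norm h"
        using insert.prems component_le_norm_cart[of h j] by (intro mult_left_mono) auto
      moreover have "\<bar>f ?y - f x - (\<Sum>i\<in>S. h $ i * partial_deriv i f x)\<bar> \<le> e / 2 * norm h"
        using d1(2) h by simp
      moreover have "(\<Sum>i\<in>insert j S. h $ i * partial_deriv i f x) =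
          h $ j * partial_deriv j f x + (\<Sum>i\<in>S. h $ i * partial_deriv i f x)"
        using insert.hyps by simp
      ultimately show "\<bar>f (x + p (insert j S) h) - f x - (\<Sum>i\<in>insert j S. h $ i * partial_deriv i f x)\<bar> \<le> e * norm h"
        using 1 by linarith
    qed (use d1 d2 in auto)
  qed
  show ?thesis
    unfolding has_derivative_at_alt
  proof (intro conjI allI impI)
    show "bounded_linear (\<lambda>h. grad f x \<bullet> h)" by (rule bounded_linear_inner_right)
    fix e :: real assume "0 < e"
    from *[OF this, of UNIV] obtain d where d: "0 < d"
      "\<And>h. norm h < d \<Longrightarrow> \<bar>f (x + h) - f x - (\<Sum>i\<in>UNIV. h $ i * partial_deriv i f x)\<bar> \<le> e * norm h"
      by (auto simp: p_def)
    show "\<exists>d>0. \<forall>y. norm (y - x) < d \<longrightarrow> norm (f y - f x - grad f x \<bullet> (y - x)) \<le> e * norm (y - x)"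
    proof (intro exI[of _ d] conjI allI impI)
      fix y assume "norm (y - x) < d"
      from d(2)[OF this] show "norm (f y - f x - grad f x \<bullet> (y - x)) \<le> e * norm (y - x)"
        by (simp add: inner_vec_def grad_def mult.commute)
    qed fact
  qed
qed

lemma iter_partial_Nil[simp]: "iter_partial [] f = f"
  by (simp add: iter_partial_def)

text \<open>\<open>foldr\<close> applies the last index first, so iterated partials of a derivative
  arise by appending an index, not by prepending one.\<close>

lemma iter_partial_snoc: "iter_partial (is @ [i]) f = iter_partial is (partial_deriv i f)"
  by (simp add: iter_partial_def)

lemma C_c_infty_continuous: "f \<in> C_c_infty \<Longrightarrow> continuous_on UNIV f"
  unfolding C_c_infty_def C_k_def by (auto dest!: spec[of _ 0] spec[of _ "[]"])

lemma C_c_infty_partial_differentiable: "f \<in> C_c_infty \<Longrightarrow> partial_differentiable i f x"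
  unfolding C_c_infty_def C_k_def by (auto dest!: spec[of _ 1] spec[of _ "[]"])

text \<open>Off the closed support \<open>f\<close> vanishes on a whole neighbourhood, hence along a
  short piece of each coordinate line.\<close>

lemma supp_partial_deriv_subset: "supp (partial_deriv i f) \<subseteq> supp f"
  unfolding supp_def
proof (rule closure_minimal)
  show "{x. partial_deriv i f x \<noteq> 0} \<subseteq> closure {x. f x \<noteq> 0}"
  proof (rule subsetI, rule ccontr)
    fix x assume x: "x \<in> {x. partial_deriv i f x \<noteq> 0}" "x \<notin> closure {x. f x \<noteq> 0}"
    let ?U = "- closure {x. f x \<noteq> 0}"
    have "((\<lambda>t. x + t *\<^sub>R axis i (1::real)) \<longlongrightarrow> x + 0 *\<^sub>R axis i 1) (nhds 0)"
      by (intro tendsto_intros filterlim_ident)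
    then have "\<forall>\<^sub>F t in nhds 0. x + t *\<^sub>R axis i 1 \<in> ?U"
      using x(2) by (intro topological_tendstoD) auto
    then have "\<forall>\<^sub>F t in nhds 0. f (x + t *\<^sub>R axis i 1) = 0"
      by (rule eventually_mono) (use closure_subset[of "{x. f x \<noteq> 0}"] in auto)
    then have "deriv (\<lambda>t. f (x + t *\<^sub>R axis i 1)) 0 = deriv (\<lambda>t. 0) 0"
      by (intro deriv_cong_ev) auto
    with x(1) show False by (simp add: partial_deriv_def)
  qed
qed simp

lemma partial_deriv_C_c_infty:
  assumes "f \<in> C_c_infty" shows "partial_deriv i f \<in> C_c_infty"
proof -
  have "partial_deriv i f \<in> C_k k" for k
  proof -
    have f: "f \<in> C_k (Suc k)" using assms by (auto simp: C_c_infty_def)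
    show ?thesis unfolding C_k_def
    proof (intro CollectI allI impI)
      fix "is" :: "'a list" assume "length is \<le> k"
      then show "continuous_on UNIV (iter_partial is (partial_deriv i f)) \<and>
          (length is < k \<longrightarrow> (\<forall>j x. partial_differentiable j (iter_partial is (partial_deriv i f)) x))"
        using f unfolding C_k_def by (auto simp: iter_partial_snoc[symmetric])
    qed
  qed
  moreover have "compact (supp (partial_deriv i f))"
    using assms closed_Int_compact[of "supp (partial_deriv i f)" "supp f"] supp_partial_deriv_subset[of i f]
    by (simp add: C_c_infty_def supp_def inf.absorb1)
  ultimately show ?thesis by (simp add: C_c_infty_def)
qed

lemma C_c_infty_bounds:
  assumes "f \<in> C_c_infty"
  obtains C K where "0 \<le> C" "0 \<le> K" "\<And>x. \<bar>f x\<bar> \<le> C" "\<And>x. K < norm x \<Longrightarrow> f x = 0"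
proof -
  have comp: "compact (supp f)" using assms by (simp add: C_c_infty_def)
  have out: "f x = 0" if "x \<notin> supp f" for x
    using that closure_subset[of "{x. f x \<noteq> 0}"] by (auto simp: supp_def)
  obtain K where K: "0 < K" "\<And>x. x \<in> supp f \<Longrightarrow> norm x \<le> K"
    using compact_imp_bounded[OF comp] bounded_pos by metis
  have "compact (f ` supp f)"
    using comp C_c_infty_continuous[OF assms] by (intro compact_continuous_image) (auto intro: continuous_on_subset)
  then obtain C where C: "0 < C" "\<And>y. y \<in> f ` supp f \<Longrightarrow> norm y \<le> C"
    using compact_imp_bounded bounded_pos by metis
  show ?thesis
  proof (rule that[of C K])
    show "\<bar>f x\<bar> \<le> C" for x using C out[of x] by (cases "x \<in> supp f") auto
    show "f x = 0" if "K < norm x" for x using K(2)[of x] that out by fastforce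
  qed (use C K in auto)
qed

lemma C_c_infty_subset_C_infty: "C_c_infty \<subseteq> C_infty"
proof
  fix f :: "real^'n \<Rightarrow> real" assume f: "f \<in> C_c_infty"
  obtain C K where K: "\<And>x. K < norm x \<Longrightarrow> f x = 0" using C_c_infty_bounds[OF f] by metis
  have "\<forall>\<^sub>F x in at_infinity. f x = 0"
    unfolding eventually_at_infinity by (intro exI[of _ "K + 1"]) (auto intro: K)
  then have "(f \<longlongrightarrow> 0) at_infinity" by (rule tendsto_eventually)
  then show "f \<in> C_infty" using C_c_infty_continuous[OF f] by (simp add: C_infty_def)
qed

lemma C_c_infty_has_derivative:
  assumes "f \<in> C_c_infty" shows "(f has_derivative (\<lambda>h. grad f x \<bullet> h)) (at x)"
  using C_c_infty_partial_differentiable[OF assms] C_c_infty_continuous[OF partial_deriv_C_c_infty[OF assms]]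
  by (rule has_derivative_if_continuous_partials)

text \<open>The chain rule with the inner product written out: for \<open>u = sgn y\<close> each
  summand is a \<open>V_integrand\<close> on the ray.\<close>

lemma C_c_infty_ray_derivative:
  assumes "f \<in> C_c_infty"
  shows "((\<lambda>z. f (x + z *\<^sub>R u)) has_real_derivative (\<Sum>i\<in>UNIV. partial_deriv i f (x + z *\<^sub>R u) * u $ i)) (at z)"
proof -
  have "((\<lambda>z. x + z *\<^sub>R u) has_derivative (\<lambda>h. h *\<^sub>R u)) (at z)"
    by (auto intro!: derivative_eq_intros)
  from has_derivative_compose[OF this C_c_infty_has_derivative[OF assms]]
  show ?thesis
    unfolding has_field_derivative_def
    by (rule has_derivative_eq_rhs) (auto simp: fun_eq_iff inner_vec_def grad_def sum_distrib_left algebra_simps)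
qed

text \<open>If \<open>g\<close> is bounded with bounded support, only a bounded part of each segment
  counts, and the inner integral is at most a constant times
  \<open>\<kappa> (norm y) * min 1 (norm y)\<close>. For \<open>\<kappa> r = 1\<close> and
  \<open>\<kappa> r = r\<close> this is the integrability that a convenient decomposition grants to
  \<open>\<mu>\<close> and to \<open>\<rho>\<close>.\<close>

lemma integral_ray_tail_bounded_support:
  fixes Q :: "(real^'n::finite) measure" and g :: "real^'n \<Rightarrow> real"
  assumes sets_Q[measurable_cong]: "sets Q = sets borel" and Q0: "emeasure Q {0} = 0"
    and k: "case_prod k \<in> borel_measurable borel"
    and k_bounds: "\<And>r z. 0 < z \<Longrightarrow> z < r \<Longrightarrow> 0 \<le> k r z \<and> k r z \<le> \<kappa> r"
    and \<kappa>[measurable]: "\<kappa> \<in> borel_measurable borel" and \<kappa>_pos: "\<And>r. 0 < r \<Longrightarrow> 0 < \<kappa> r"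
    and fin: "(\<integral>\<^sup>+y. ennreal (\<kappa> (norm y) * min 1 (norm y)) \<partial>Q) < \<infinity>"
    and g[measurable]: "g \<in> borel_measurable borel"
    and C: "\<And>v. \<bar>g v\<bar> \<le> C" and K: "\<And>v. K < norm v \<Longrightarrow> g v = 0"
  shows "integrable (ray_tail k Q) g" (is ?int)
    and "(\<integral>x. g x \<partial>ray_tail k Q) =
      (\<integral>y. (\<integral>z. ray_weight k (norm y) z * g (z *\<^sub>R sgn y) \<partial>lborel) \<partial>Q)" (is ?eq)
    and "integrable Q (\<lambda>y. \<integral>z. ray_weight k (norm y) z * g (z *\<^sub>R sgn y) \<partial>lborel)" (is ?int2)
    and "integrable lborel (\<lambda>z. ray_weight k (norm y) z * g (z *\<^sub>R sgn y))" (is ?int3)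
proof -
  note [measurable] = borel_measurable_ray_weight[OF k]
  \<comment> \<open>At least \<open>1\<close>, so that
    \<open>min (norm y) L \<le> L * min 1 (norm y)\<close>.\<close>
  define L where "L = max 1 K"
  have C0: "0 \<le> C" using C[of 0] by simp
  have w0: "0 \<le> ray_weight k r z" for r z using k_bounds by (auto simp: ray_weight_def)
  have bound: "(\<integral>\<^sup>+z. ennreal (ray_weight k (norm y) z * \<bar>g (z *\<^sub>R sgn y)\<bar>) \<partial>lborel)
      \<le> ennreal (C * L) * ennreal (\<kappa> (norm y) * min 1 (norm y))" for y
  proof (cases "y = 0")
    case True
    have "ray_weight k 0 z = 0" for z by (auto simp: ray_weight_def)
    with True show ?thesis by simp
  next
    case False
    then have \<kappa>0: "0 < \<kappa> (norm y)" by (simp add: \<kappa>_pos)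
    have "(\<integral>\<^sup>+z. ennreal (ray_weight k (norm y) z * \<bar>g (z *\<^sub>R sgn y)\<bar>) \<partial>lborel)
        \<le> (\<integral>\<^sup>+z. ennreal (\<kappa> (norm y) * C) * indicator {0..min (norm y) L} z \<partial>lborel)"
    proof (rule nn_integral_mono)
      fix z
      show "ennreal (ray_weight k (norm y) z * \<bar>g (z *\<^sub>R sgn y)\<bar>) \<le> ennreal (\<kappa> (norm y) * C) * indicator {0..min (norm y) L} z"
      proof (cases "0 < z \<and> z < norm y \<and> z \<le> L")
        case True
        have "ray_weight k (norm y) z * \<bar>g (z *\<^sub>R sgn y)\<bar> \<le> \<kappa> (norm y) * C"
          using C k_bounds[of z "norm y"] True by (intro mult_mono) (auto simp: ray_weight_def)
        then show ?thesis using True by (simp add: ennreal_leI)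
      next
        case z: False
        \<comment> \<open>Off the segment the weight vanishes; beyond \<open>L\<close> the point on
          the ray has norm \<open>z > K\<close>, and \<open>g\<close> vanishes.\<close>
        have "ray_weight k (norm y) z = 0 \<or> g (z *\<^sub>R sgn y) = 0"
          using z K[of "z *\<^sub>R sgn y"] False by (auto simp: ray_weight_def norm_sgn L_def not_le)
        then show ?thesis by auto
      qed
    qed
    also have "\<dots> = ennreal (\<kappa> (norm y) * C * min (norm y) L)"
      using C0 \<kappa>0 by (simp add: nn_integral_cmult L_def flip: ennreal_mult)
    also have "\<dots> \<le> ennreal ((C * L) * (\<kappa> (norm y) * min 1 (norm y)))"
    proof (rule ennreal_leI)
      have "min (norm y) L \<le> L * min 1 (norm y)"
      proof (cases "norm y \<le> 1")
        case True
        then have "1 * norm y \<le> L * norm y" by (intro mult_right_mono) (auto simp: L_def)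
        with True show ?thesis by simp
      qed simp
      then have "\<kappa> (norm y) * C * min (norm y) L \<le> \<kappa> (norm y) * C * (L * min 1 (norm y))"
        using C0 \<kappa>0 by (intro mult_left_mono) auto
      then show "\<kappa> (norm y) * C * min (norm y) L \<le> (C * L) * (\<kappa> (norm y) * min 1 (norm y))"
        by (simp add: mult_ac)
    qed
    finally show ?thesis using C0 \<kappa>0 by (simp add: ennreal_mult L_def)
  qed
  have sf: "sigma_finite_measure Q"
  proof (rule sigma_finite_measure_if_nn_integral_finite)
    \<comment> \<open>The weight vanishes at the origin only; \<open>indicator {0}\<close> makes it
      positive there at no cost, as the origin is a null set.\<close>
    show "(\<lambda>y. ennreal (\<kappa> (norm y) * min 1 (norm y)) + indicator {0} y) \<in> borel_measurable Q" by measurable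
    show "0 < ennreal (\<kappa> (norm y) * min 1 (norm y)) + indicator {0} y" for y :: "real^'n"
      using \<kappa>_pos[of "norm y"] by (cases "y = 0") auto
    show "(\<integral>\<^sup>+y. ennreal (\<kappa> (norm y) * min 1 (norm y)) + indicator {0} y \<partial>Q) < \<infinity>"
      using fin Q0 by (subst nn_integral_add) (auto simp: sets_Q)
  qed
  have k0: "\<And>r z. 0 < z \<Longrightarrow> z < r \<Longrightarrow> 0 \<le> k r z" using k_bounds by blast
  have "(\<integral>\<^sup>+y. (\<integral>\<^sup>+z. ennreal (ray_weight k (norm y) z * \<bar>g (z *\<^sub>R sgn y)\<bar>) \<partial>lborel) \<partial>Q)
      \<le> (\<integral>\<^sup>+y. ennreal (C * L) * ennreal (\<kappa> (norm y) * min 1 (norm y)) \<partial>Q)"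
    by (intro nn_integral_mono bound)
  also have "\<dots> < \<infinity>" using fin by (subst nn_integral_cmult) (auto simp: ennreal_mult_less_top)
  finally have "(\<integral>\<^sup>+y. (\<integral>\<^sup>+z. ennreal (ray_weight k (norm y) z * \<bar>g (z *\<^sub>R sgn y)\<bar>) \<partial>lborel) \<partial>Q) < \<infinity>" .
  from integral_ray_tail[OF sets_Q sf k k0 g this] show ?int ?eq ?int2 by auto
  show ?int3
  proof (rule integrableI_bounded)
    show "(\<integral>\<^sup>+z. ennreal (norm (ray_weight k (norm y) z * g (z *\<^sub>R sgn y))) \<partial>lborel) < \<infinity>"
      unfolding real_norm_def abs_mult abs_of_nonneg[OF w0]
      by (rule order.strict_trans1[OF bound]) (simp add: ennreal_mult_less_top)
  qed measurable
qed

section \<open>Taylor formulas against the radial tails\<close>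

lemma V_integrand_ray:
  assumes "y \<noteq> 0" "0 < z"
  shows "V_integrand i h x (z *\<^sub>R sgn y) = h (x + z *\<^sub>R sgn y) * sgn y $ i"
  using assms by (simp add: V_integrand_def norm_sgn)

lemma W_integrand_ray:
  assumes "y \<noteq> 0" "0 < z"
  shows "W_integrand i j h x (z *\<^sub>R sgn y) = h (x + z *\<^sub>R sgn y) * (sgn y $ i * sgn y $ j)"
  using assms by (simp add: W_integrand_def norm_sgn power2_eq_square)

text \<open>The direction factors are at most \<open>1\<close> in modulus (and \<open>0\<close> at
  the origin, by division by zero), while the shift by \<open>x\<close> enlarges the radius of the
  support by \<open>norm x\<close>.\<close>

lemma V_W_integrand_bounds:
  fixes h :: "real^'n::finite \<Rightarrow> real"
  assumes h: "h \<in> C_c_infty"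
  obtains C K where "\<And>i v. \<bar>V_integrand i h x v\<bar> \<le> C" "\<And>i v. K < norm v \<Longrightarrow> V_integrand i h x v = 0"
    "\<And>i j v. \<bar>W_integrand i j h x v\<bar> \<le> C" "\<And>i j v. K < norm v \<Longrightarrow> W_integrand i j h x v = 0"
    "\<And>i. V_integrand i h x \<in> borel_measurable borel" "\<And>i j. W_integrand i j h x \<in> borel_measurable borel"
proof -
  obtain C K where CK: "0 \<le> C" "\<And>v. \<bar>h v\<bar> \<le> C" "\<And>v. K < norm v \<Longrightarrow> h v = 0"
    using C_c_infty_bounds[OF h] by metis
  have [measurable]: "h \<in> borel_measurable borel"
    using C_c_infty_continuous[OF h] by (rule borel_measurable_continuous_onI)
  have q: "\<bar>v $ i / norm v\<bar> \<le> 1" for i and v :: "real^'n"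
    using component_le_norm_cart[of v i] by (cases "v = 0") (auto simp: divide_le_eq_1)
  have far: "h (x + v) = 0" if "K + norm x < norm v" for v
  proof (rule CK(3))
    have "norm v \<le> norm (x + v) + norm x" using norm_triangle_ineq4[of "x + v" x] by simp
    then show "K < norm (x + v)" using that by simp
  qed
  show ?thesis
  proof (rule that[of C "K + norm x"])
    show "\<bar>V_integrand i h x v\<bar> \<le> C" for i v
      unfolding V_integrand_def abs_mult using mult_mono[OF CK(2)[of "x + v"] q[of v i]] CK(1) by simp
    have W: "W_integrand i j h x v = h (x + v) * ((v $ i / norm v) * (v $ j / norm v))" for i j v
      by (simp add: W_integrand_def power2_eq_square)
    have qq: "\<bar>(v $ i / norm v) * (v $ j / norm v)\<bar> \<le> 1" for i j and v :: "real^'n"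
      unfolding abs_mult using mult_mono[OF q[of v i] q[of v j]] by simp
    show "\<bar>W_integrand i j h x v\<bar> \<le> C" for i j v
    proof -
      have "\<bar>h (x + v)\<bar> * \<bar>(v $ i / norm v) * (v $ j / norm v)\<bar> \<le> C * 1"
        by (rule mult_mono[OF CK(2) qq]) (simp_all add: CK(1))
      then show ?thesis unfolding W abs_mult[of "h (x + v)"] by simp
    qed
    show "V_integrand i h x v = 0" "W_integrand i j h x v = 0" if "K + norm x < norm v" for i j v
      using far[OF that] by (simp_all add: V_integrand_def W_integrand_def)
    show "V_integrand i h x \<in> borel_measurable borel" "W_integrand i j h x \<in> borel_measurable borel" for i j
      unfolding V_integrand_def W_integrand_def by measurable
  qed
qed

text \<open>\<open>r\<close> is fixed, so the antiderivative may depend on it, as it does in the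
  second-order formula. The end points of the segment are a null set.\<close>

lemma has_bochner_integral_ray_weight_FTC:
  assumes "0 \<le> r" and F: "\<And>z. (F has_real_derivative k r z * f z) (at z)"
    and cont: "continuous_on UNIV (\<lambda>z. k r z * f z)"
  shows "has_bochner_integral lborel (\<lambda>z. ray_weight k r z * f z) (F r - F 0)"
proof -
  have "has_bochner_integral lborel (\<lambda>z. (k r z * f z) * indicator {0..r} z) (F r - F 0)"
    using assms(1) F cont
    by (intro has_bochner_integral_FTC_Icc_real) (auto simp: continuous_on_eq_continuous_at)
  also have "?this \<longleftrightarrow> has_bochner_integral lborel (\<lambda>z. ray_weight k r z * f z) (F r - F 0)"
  proof (rule has_bochner_integral_cong_AE)
    have [measurable]: "(\<lambda>z. k r z * f z) \<in> borel_measurable borel"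
      using cont by (rule borel_measurable_continuous_onI)
    have "(\<lambda>z. if 0 < z \<and> z < r then k r z * f z else 0) \<in> borel_measurable borel" by measurable
    also have "(\<lambda>z. if 0 < z \<and> z < r then k r z * f z else 0) = (\<lambda>z. ray_weight k r z * f z)"
      by (auto simp: ray_weight_def)
    finally show "(\<lambda>z. ray_weight k r z * f z) \<in> borel_measurable lborel" by simp
    show "(\<lambda>z. k r z * f z * indicator {0..r} z) \<in> borel_measurable lborel" by simp
    show "AE z in lborel. k r z * f z * indicator {0..r} z = ray_weight k r z * f z"
      using AE_lborel_singleton[of 0] AE_lborel_singleton[of r]
      by eventually_elim (auto simp: ray_weight_def indicator_def)
  qed
  finally show ?thesis .
qed

text \<open>The sum over \<open>i\<close> has to be taken inside first: only the full sum is the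
  derivative of \<open>f\<close> along the ray, to which the fundamental theorem applies.\<close>

lemma sum_integral_V_integrand:
  fixes Q :: "(real^'n::finite) measure"
  assumes f: "f \<in> C_c_infty" and sets_Q[measurable_cong]: "sets Q = sets borel" and Q0: "emeasure Q {0} = 0"
    and fin: "(\<integral>\<^sup>+y. ennreal (min 1 (norm y)) \<partial>Q) < \<infinity>"
  shows "(\<Sum>i\<in>UNIV. \<integral>y. V_integrand i (partial_deriv i f) x y \<partial>integrated_tail Q) = (\<integral>y. f (x + y) - f x \<partial>Q)"
proof -
  let ?k = "\<lambda>r z :: real. 1 :: real"
  have "(\<integral>\<^sup>+y. ennreal (min 1 ((norm y)\<^sup>2)) \<partial>Q) \<le> (\<integral>\<^sup>+y. ennreal (min 1 (norm y)) \<partial>Q)"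
  proof (intro nn_integral_mono ennreal_leI)
    fix y :: "real^'n"
    show "min 1 ((norm y)\<^sup>2) \<le> min 1 (norm y)"
      using power_decreasing[of 1 2 "norm y"] by (cases "norm y \<le> 1") auto
  qed
  then have tail: "integrated_tail Q = ray_tail ?k Q"
    using fin by (intro integrated_tail_eq_ray_tail sets_Q Q0) (rule order.strict_trans1)
  have pd: "partial_deriv i f \<in> C_c_infty" for i by (rule partial_deriv_C_c_infty[OF f])
  have *: "(\<integral>v. V_integrand i (partial_deriv i f) x v \<partial>ray_tail ?k Q) =
        (\<integral>y. (\<integral>z. ray_weight ?k (norm y) z * V_integrand i (partial_deriv i f) x (z *\<^sub>R sgn y) \<partial>lborel) \<partial>Q)
      \<and> integrable Q (\<lambda>y. \<integral>z. ray_weight ?k (norm y) z * V_integrand i (partial_deriv i f) x (z *\<^sub>R sgn y) \<partial>lborel)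
      \<and> (\<forall>y::real^'n. integrable lborel (\<lambda>z. ray_weight ?k (norm y) z * V_integrand i (partial_deriv i f) x (z *\<^sub>R sgn y)))" for i
  proof -
    obtain C K where CK: "\<And>v. \<bar>V_integrand i (partial_deriv i f) x v\<bar> \<le> C"
      "\<And>v. K < norm v \<Longrightarrow> V_integrand i (partial_deriv i f) x v = 0"
      "V_integrand i (partial_deriv i f) x \<in> borel_measurable borel"
      by (rule V_W_integrand_bounds[OF pd[of i], of x]) (rule that)
    have fin': "(\<integral>\<^sup>+y. ennreal (1 * min 1 (norm y)) \<partial>Q) < \<infinity>" using fin by simp
    have k: "case_prod ?k \<in> borel_measurable borel" unfolding split_beta' by simp
    note bs = integral_ray_tail_bounded_support[OF sets_Q Q0 k _ _ _ fin' CK(3,1,2)]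
    show ?thesis by (intro conjI allI bs) simp_all
  qed
  have "(\<Sum>i\<in>UNIV. \<integral>y. V_integrand i (partial_deriv i f) x y \<partial>integrated_tail Q) =
      (\<integral>y. (\<integral>z. (\<Sum>i\<in>UNIV. ray_weight ?k (norm y) z * V_integrand i (partial_deriv i f) x (z *\<^sub>R sgn y)) \<partial>lborel) \<partial>Q)"
    unfolding tail * [THEN conjunct1]
    by (subst Bochner_Integration.integral_sum[symmetric], use * in blast,
        subst Bochner_Integration.integral_sum, use * in blast, rule refl)
  also have "\<dots> = (\<integral>y. f (x + y) - f x \<partial>Q)"
  proof (rule integral_cong_AE)
    have [measurable]: "f \<in> borel_measurable borel"
      using C_c_infty_continuous[OF f] by (rule borel_measurable_continuous_onI)
    show "(\<lambda>y. f (x + y) - f x) \<in> borel_measurable Q" by measurable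
    show "(\<lambda>y. \<integral>z. (\<Sum>i\<in>UNIV. ray_weight ?k (norm y) z * V_integrand i (partial_deriv i f) x (z *\<^sub>R sgn y)) \<partial>lborel) \<in> borel_measurable Q"
      using * by (simp add: borel_measurable_integrable)
    have "AE y in Q. y \<noteq> 0" using Q0 by (intro AE_I[of _ _ "{0}"]) (auto simp: sets_Q)
    then show "AE y in Q. (\<integral>z. (\<Sum>i\<in>UNIV. ray_weight ?k (norm y) z * V_integrand i (partial_deriv i f) x (z *\<^sub>R sgn y)) \<partial>lborel) = f (x + y) - f x"
    proof eventually_elim
      case (elim y)
      have "has_bochner_integral lborel
          (\<lambda>z. ray_weight ?k (norm y) z * (\<Sum>i\<in>UNIV. partial_deriv i f (x + z *\<^sub>R sgn y) * sgn y $ i))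
          (f (x + norm y *\<^sub>R sgn y) - f (x + 0 *\<^sub>R sgn y))"
        by (rule has_bochner_integral_ray_weight_FTC[where F="\<lambda>z. f (x + z *\<^sub>R sgn y)"])
          (auto intro!: continuous_intros continuous_on_compose2[OF C_c_infty_continuous[OF pd]]
            simp: C_c_infty_ray_derivative[OF f])
      also have "(\<lambda>z. ray_weight ?k (norm y) z * (\<Sum>i\<in>UNIV. partial_deriv i f (x + z *\<^sub>R sgn y) * sgn y $ i)) =
          (\<lambda>z. \<Sum>i\<in>UNIV. ray_weight ?k (norm y) z * V_integrand i (partial_deriv i f) x (z *\<^sub>R sgn y))"
        using elim by (auto simp: fun_eq_iff ray_weight_def V_integrand_ray)
      also have "norm y *\<^sub>R sgn y = y" using elim by (simp add: sgn_div_norm)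
      finally show ?case by (simp add: has_bochner_integral_integral_eq)
    qed
  qed
  finally show ?thesis .
qed

lemma sum_integral_W_integrand:
  fixes Q :: "(real^'n::finite) measure"
  assumes f: "f \<in> C_c_infty" and sets_Q[measurable_cong]: "sets Q = sets borel" and Q0: "emeasure Q {0} = 0"
    and fin: "(\<integral>\<^sup>+y. ennreal (min (norm y) ((norm y)\<^sup>2)) \<partial>Q) < \<infinity>"
  shows "(\<Sum>i\<in>UNIV. \<Sum>j\<in>UNIV. \<integral>y. W_integrand i j (partial_deriv i (partial_deriv j f)) x y \<partial>double_integrated_tail Q) =
    (\<integral>y. f (x + y) - f x - grad f x \<bullet> y \<partial>Q)"
proof -
  let ?k = "\<lambda>r z :: real. r - z"
  note tail = double_integrated_tail_eq_ray_tail[OF sets_Q Q0 fin]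
  have pd: "partial_deriv i f \<in> C_c_infty" for i by (rule partial_deriv_C_c_infty[OF f])
  have pd2: "partial_deriv i (partial_deriv j f) \<in> C_c_infty" for i j by (rule partial_deriv_C_c_infty[OF pd])
  \<comment> \<open>Matches the bound for \<open>\<kappa> r = r\<close> with the integrability
    condition on \<open>\<rho>\<close>.\<close>
  have min_eq: "r * min 1 r = min r (r\<^sup>2)" if "0 \<le> r" for r :: real
    using that by (auto simp: min_def power2_eq_square mult_le_cancel_left1)
  let ?W = "\<lambda>i j. W_integrand i j (partial_deriv i (partial_deriv j f)) x"
  have *: "(\<integral>v. ?W i j v \<partial>ray_tail ?k Q) =
        (\<integral>y. (\<integral>z. ray_weight ?k (norm y) z * ?W i j (z *\<^sub>R sgn y) \<partial>lborel) \<partial>Q)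
      \<and> integrable Q (\<lambda>y. \<integral>z. ray_weight ?k (norm y) z * ?W i j (z *\<^sub>R sgn y) \<partial>lborel)
      \<and> (\<forall>y::real^'n. integrable lborel (\<lambda>z. ray_weight ?k (norm y) z * ?W i j (z *\<^sub>R sgn y)))" for i j
  proof -
    obtain C K where CK: "\<And>v. \<bar>?W i j v\<bar> \<le> C" "\<And>v. K < norm v \<Longrightarrow> ?W i j v = 0"
      "?W i j \<in> borel_measurable borel"
      by (rule V_W_integrand_bounds[OF pd2[of i j], of x]) (rule that)
    have k: "case_prod ?k \<in> borel_measurable borel"
      unfolding split_beta' by (intro borel_measurable_continuous_onI continuous_intros)
    have fin': "(\<integral>\<^sup>+y. ennreal (norm y * min 1 (norm y)) \<partial>Q) < \<infinity>" using fin by (simp add: min_eq)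
    note bs = integral_ray_tail_bounded_support[OF sets_Q Q0 k _ _ _ fin' CK(3,1,2)]
    show ?thesis by (intro conjI allI bs) simp_all
  qed
  have "(\<Sum>i\<in>UNIV. \<Sum>j\<in>UNIV. \<integral>y. ?W i j y \<partial>double_integrated_tail Q) =
      (\<integral>y. (\<integral>z. (\<Sum>i\<in>UNIV. \<Sum>j\<in>UNIV. ray_weight ?k (norm y) z * ?W i j (z *\<^sub>R sgn y)) \<partial>lborel) \<partial>Q)"
  proof -
    define J where "J i j y z = ray_weight ?k (norm y) z * ?W i j (z *\<^sub>R sgn y)" for i j and y :: "real^'n" and z
    have J: "integrable Q (\<lambda>y. \<integral>z. J i j y z \<partial>lborel)" "integrable lborel (J i j y)" for i j y
      using * unfolding J_def by blast+
    have "(\<Sum>i\<in>UNIV. \<Sum>j\<in>UNIV. \<integral>y. (\<integral>z. J i j y z \<partial>lborel) \<partial>Q) =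
        (\<integral>y. (\<integral>z. (\<Sum>i\<in>UNIV. \<Sum>j\<in>UNIV. J i j y z) \<partial>lborel) \<partial>Q)"
      using J by simp
    then show ?thesis unfolding tail *[THEN conjunct1] J_def .
  qed
  also have "\<dots> = (\<integral>y. f (x + y) - f x - grad f x \<bullet> y \<partial>Q)"
  proof (rule integral_cong_AE)
    have [measurable]: "f \<in> borel_measurable borel"
      using C_c_infty_continuous[OF f] by (rule borel_measurable_continuous_onI)
    show "(\<lambda>y. f (x + y) - f x - grad f x \<bullet> y) \<in> borel_measurable Q" by measurable
    show "(\<lambda>y. \<integral>z. (\<Sum>i\<in>UNIV. \<Sum>j\<in>UNIV. ray_weight ?k (norm y) z * ?W i j (z *\<^sub>R sgn y)) \<partial>lborel) \<in> borel_measurable Q"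
      using * by (simp add: borel_measurable_integrable)
    have "AE y in Q. y \<noteq> 0" using Q0 by (intro AE_I[of _ _ "{0}"]) (auto simp: sets_Q)
    then show "AE y in Q. (\<integral>z. (\<Sum>i\<in>UNIV. \<Sum>j\<in>UNIV. ray_weight ?k (norm y) z * ?W i j (z *\<^sub>R sgn y)) \<partial>lborel) =
        f (x + y) - f x - grad f x \<bullet> y"
    proof eventually_elim
      case (elim y)
      let ?u = "sgn y"
      define \<phi>1 where "\<phi>1 z = (\<Sum>j\<in>UNIV. partial_deriv j f (x + z *\<^sub>R ?u) * ?u $ j)" for z
      define \<phi>2 where "\<phi>2 z = (\<Sum>j\<in>UNIV. (\<Sum>i\<in>UNIV. partial_deriv i (partial_deriv j f) (x + z *\<^sub>R ?u) * ?u $ i) * ?u $ j)" for z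
      \<comment> \<open>Integration by parts in advance: the derivative of \<open>F\<close> is
        \<open>(norm y - z) * \<phi>2 z\<close>, and the boundary term
        \<open>norm y * \<phi>1 0\<close> in \<open>F 0\<close> is the gradient term.\<close>
      define F where "F z = (norm y - z) * \<phi>1 z + f (x + z *\<^sub>R ?u)" for z
      have d1: "(\<phi>1 has_real_derivative \<phi>2 z) (at z)" for z
        unfolding \<phi>1_def \<phi>2_def by (intro DERIV_sum DERIV_cmult_right C_c_infty_ray_derivative pd)
      have dn: "((\<lambda>z. norm y - z) has_real_derivative 0 - 1) (at z)" for z
        by (intro DERIV_diff DERIV_const DERIV_ident)
      have "(F has_real_derivative (0 - 1) * \<phi>1 z + \<phi>2 z * (norm y - z) + \<phi>1 z) (at z)" for z
        unfolding F_def using C_c_infty_ray_derivative[OF f, of x ?u z, folded \<phi>1_def]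
        by (intro DERIV_add DERIV_mult dn d1)
      then have "has_bochner_integral lborel (\<lambda>z. ray_weight ?k (norm y) z * \<phi>2 z) (F (norm y) - F 0)"
        by (intro has_bochner_integral_ray_weight_FTC)
          (auto intro!: continuous_intros continuous_on_compose2[OF C_c_infty_continuous[OF pd2]]
            simp: \<phi>2_def mult.commute)
      also have "(\<lambda>z. ray_weight ?k (norm y) z * \<phi>2 z) =
          (\<lambda>z. \<Sum>i\<in>UNIV. \<Sum>j\<in>UNIV. ray_weight ?k (norm y) z * ?W i j (z *\<^sub>R ?u))"
      proof
        fix z
        show "ray_weight ?k (norm y) z * \<phi>2 z = (\<Sum>i\<in>UNIV. \<Sum>j\<in>UNIV. ray_weight ?k (norm y) z * ?W i j (z *\<^sub>R ?u))"
        proof (cases "0 < z")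
          case True
          then show ?thesis using elim unfolding \<phi>2_def
            by (subst sum.swap) (simp add: W_integrand_ray sum_distrib_left sum_distrib_right mult.assoc)
        qed (simp add: ray_weight_def)
      qed
      also have "F (norm y) - F 0 = f (x + y) - f x - grad f x \<bullet> y"
        using elim by (simp add: F_def \<phi>1_def inner_vec_def grad_def sgn_div_norm sum_distrib_left field_simps)
      finally show ?case by (simp add: has_bochner_integral_integral_eq)
    qed
  qed
  finally show ?thesis .
qed

section \<open>The generator in terms of a convenient decomposition\<close>

lemma integral_convenient_decomposition:
  fixes J :: "real^'n::finite \<Rightarrow> real"
  assumes dec: "convenient_decomposition Q \<nu> \<mu> \<rho>" and sets_Q: "sets (Q x) = sets borel"
    and J: "integrable (Q x) J"
  shows "integrable (\<nu> x) J" "integrable (\<mu> x) J" "integrable (\<rho> x) J"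
    and "(\<integral>y. J y \<partial>Q x) = (\<integral>y. J y \<partial>\<nu> x) + (\<integral>y. J y \<partial>\<mu> x) + (\<integral>y. J y \<partial>\<rho> x)"
proof -
  obtain h1 h2 h3 :: "real^'n \<Rightarrow> real"
    where cont: "continuous_on UNIV h1" "continuous_on UNIV h2" "continuous_on UNIV h3"
      and pos: "\<And>y. 0 \<le> h1 y" "\<And>y. 0 \<le> h2 y" "\<And>y. 0 \<le> h3 y"
      and dens: "\<nu> x = density (Q x) (\<lambda>y. ennreal (h1 y))" "\<mu> x = density (Q x) (\<lambda>y. ennreal (h2 y))"
        "\<rho> x = density (Q x) (\<lambda>y. ennreal (h3 y))"
    using dec unfolding convenient_decomposition_def by auto
  have sum: "emeasure (Q x) B = emeasure (\<nu> x) B + emeasure (\<mu> x) B + emeasure (\<rho> x) B" if "B \<in> sets borel" for B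
    using dec that unfolding convenient_decomposition_def by blast
  note [measurable_cong] = sets_Q
  have h[measurable]: "h1 \<in> borel_measurable borel" "h2 \<in> borel_measurable borel" "h3 \<in> borel_measurable borel"
    using cont by (auto intro: borel_measurable_continuous_onI)
  have hQ[measurable]: "h1 \<in> borel_measurable (Q x)" "h2 \<in> borel_measurable (Q x)" "h3 \<in> borel_measurable (Q x)"
    using h by (simp_all add: measurable_cong_sets[OF sets_Q refl])
  have [measurable]: "J \<in> borel_measurable (Q x)" using J by simp
  \<comment> \<open>The three densities sum to \<open>1\<close> only up to null sets. Instead of
    arguing pointwise, \<open>Q x\<close> is rewritten as its own density with the sum
    \<open>?h\<close>, which also dominates each summand.\<close>
  let ?h = "\<lambda>y. h1 y + h2 y + h3 y"
  have pos_h: "0 \<le> ?h y" for y using pos[of y] by simp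
  have Q_eq: "density (Q x) (\<lambda>y. ennreal (?h y)) = Q x"
  proof (rule measure_eqI)
    fix B assume "B \<in> sets (density (Q x) (\<lambda>y. ennreal (?h y)))"
    then have B[measurable]: "B \<in> sets (Q x)" by simp
    have "emeasure (density (Q x) (\<lambda>y. ennreal (?h y))) B = (\<integral>\<^sup>+y\<in>B. ennreal (?h y) \<partial>Q x)"
      by (subst emeasure_density) auto
    also have "\<dots> = (\<integral>\<^sup>+y. ennreal (h1 y) * indicator B y + ennreal (h2 y) * indicator B y + ennreal (h3 y) * indicator B y \<partial>Q x)"
      using pos by (intro nn_integral_cong) (simp add: ennreal_plus distrib_right)
    also have "\<dots> = emeasure (\<nu> x) B + emeasure (\<mu> x) B + emeasure (\<rho> x) B"
      unfolding dens by (simp add: nn_integral_add emeasure_density)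
    also have "\<dots> = emeasure (Q x) B" using B sets_Q by (intro sum[symmetric]) simp
    finally show "emeasure (density (Q x) (\<lambda>y. ennreal (?h y))) B = emeasure (Q x) B" .
  qed simp
  have int_h: "integrable (Q x) (\<lambda>y. ?h y * J y)"
    using J pos_h by (subst (asm) Q_eq[symmetric], subst (asm) integrable_density) auto
  have int1: "integrable (Q x) (\<lambda>y. h1 y * J y)" "integrable (Q x) (\<lambda>y. h2 y * J y)" "integrable (Q x) (\<lambda>y. h3 y * J y)"
    using pos by (auto intro!: Bochner_Integration.integrable_bound[OF int_h] AE_I2 simp: abs_mult mult_right_mono)
  show "integrable (\<nu> x) J" "integrable (\<mu> x) J" "integrable (\<rho> x) J"
    unfolding dens using int1 pos by (simp_all add: integrable_density)
  have "(\<integral>y. J y \<partial>Q x) = (\<integral>y. ?h y * J y \<partial>Q x)"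
    using pos_h by (subst Q_eq[symmetric], subst integral_density) auto
  also have "\<dots> = (\<integral>y. h1 y * J y \<partial>Q x) + (\<integral>y. h2 y * J y \<partial>Q x) + (\<integral>y. h3 y * J y \<partial>Q x)"
    using int1 by (simp add: distrib_right)
  also have "\<dots> = (\<integral>y. J y \<partial>\<nu> x) + (\<integral>y. J y \<partial>\<mu> x) + (\<integral>y. J y \<partial>\<rho> x)"
    unfolding dens using pos by (simp add: integral_density)
  finally show "(\<integral>y. J y \<partial>Q x) = (\<integral>y. J y \<partial>\<nu> x) + (\<integral>y. J y \<partial>\<mu> x) + (\<integral>y. J y \<partial>\<rho> x)" .
qed

text \<open>\<open>a_pi\<close> collects the mismatch of compensators. The operator compensates
  jumps with \<open>norm y < 1\<close>, whereas \<open>\<nu>\<close> and \<open>\<mu>\<close> are to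
  be uncompensated and \<open>\<rho>\<close> fully compensated: small jumps are taken out for the
  first two, large ones added for the third.\<close>

lemma levy_expr_eq_convenient:
  assumes f: "f \<in> C_c_infty" and dec: "convenient_decomposition Q \<nu> \<mu> \<rho>"
    and sets_Q: "sets (Q x) = sets borel" and Q0: "emeasure (Q x) {0} = 0"
    and int: "integrable (Q x) (jump_integrand f x)"
  shows "levy_expr a b Q f x = (a x + a_pi \<nu> \<mu> \<rho> x) \<bullet> grad f x + 1/2 * div_grad b f x + U_inner \<nu> f x
      + (\<Sum>i\<in>UNIV. V_inner \<mu> i (partial_deriv i f) x)
      + (\<Sum>i\<in>UNIV. \<Sum>j\<in>UNIV. W_inner \<rho> i j (partial_deriv i (partial_deriv j f)) x)"
proof -
  have sets[measurable_cong]: "sets (\<nu> x) = sets borel" "sets (\<mu> x) = sets borel" "sets (\<rho> x) = sets borel"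
    and zero: "emeasure (\<mu> x) {0} = 0" "emeasure (\<rho> x) {0} = 0"
  proof -
    obtain h1 h2 h3 :: "real^'a \<Rightarrow> real" where
      "\<nu> x = density (Q x) (\<lambda>y. ennreal (h1 y))" "\<mu> x = density (Q x) (\<lambda>y. ennreal (h2 y))"
      "\<rho> x = density (Q x) (\<lambda>y. ennreal (h3 y))"
      using dec unfolding convenient_decomposition_def by blast
    then show "sets (\<nu> x) = sets borel" "sets (\<mu> x) = sets borel" "sets (\<rho> x) = sets borel"
      using sets_Q by auto
    have "emeasure (Q x) {0} = emeasure (\<nu> x) {0} + emeasure (\<mu> x) {0} + emeasure (\<rho> x) {0}"
      using dec unfolding convenient_decomposition_def by simp
    with Q0 show "emeasure (\<mu> x) {0} = 0" "emeasure (\<rho> x) {0} = 0" by auto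
  qed
  have fin: "emeasure (\<nu> x) UNIV < \<infinity>" "(\<integral>\<^sup>+y. ennreal (min 1 (norm y)) \<partial>\<mu> x) < \<infinity>"
    "(\<integral>\<^sup>+y. ennreal (min (norm y) ((norm y)\<^sup>2)) \<partial>\<rho> x) < \<infinity>"
    using dec unfolding convenient_decomposition_def by blast+
  note J = integral_convenient_decomposition[OF dec sets_Q int]
  let ?g = "grad f x"
  let ?s = "\<lambda>y::real^'a. indicator {y. norm y < 1} y *\<^sub>R y" and ?l = "\<lambda>y::real^'a. indicator {y. 1 \<le> norm y} y *\<^sub>R y"
  have [measurable]: "f \<in> borel_measurable borel"
    using C_c_infty_continuous[OF f] by (rule borel_measurable_continuous_onI)
  obtain C where C: "\<And>y. \<bar>f y\<bar> \<le> C" using C_c_infty_bounds[OF f] by metis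
  interpret \<nu>: finite_measure "\<nu> x"
    using fin(1) sets_eq_imp_space_eq[OF sets(1)] by (intro finite_measureI) auto
  have \<nu>_f: "integrable (\<nu> x) (\<lambda>y. f (x + y))"
    by (rule \<nu>.integrable_const_bound[where B=C]) (auto simp: C)
  have \<nu>_s: "integrable (\<nu> x) ?s"
    by (rule \<nu>.integrable_const_bound[where B=1]) (auto simp: indicator_def)
  have \<mu>_s: "integrable (\<mu> x) ?s"
  proof (rule integrableI_bounded)
    have "(\<integral>\<^sup>+y. ennreal (norm (?s y)) \<partial>\<mu> x) \<le> (\<integral>\<^sup>+y. ennreal (min 1 (norm y)) \<partial>\<mu> x)"
      by (intro nn_integral_mono ennreal_leI) (auto simp: indicator_def)
    then show "(\<integral>\<^sup>+y. ennreal (norm (?s y)) \<partial>\<mu> x) < \<infinity>" using fin(2) by (rule order.strict_trans1)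
  qed measurable
  have \<rho>_l: "integrable (\<rho> x) ?l"
  proof (rule integrableI_bounded)
    have "(\<integral>\<^sup>+y. ennreal (norm (?l y)) \<partial>\<rho> x) \<le> (\<integral>\<^sup>+y. ennreal (min (norm y) ((norm y)\<^sup>2)) \<partial>\<rho> x)"
      by (intro nn_integral_mono ennreal_leI) (auto simp: indicator_def self_le_power)
    then show "(\<integral>\<^sup>+y. ennreal (norm (?l y)) \<partial>\<rho> x) < \<infinity>" using fin(3) by (rule order.strict_trans1)
  qed measurable
  have j1: "jump_integrand f x y = f (x + y) - f x - ?g \<bullet> ?s y" for y
    by (simp add: jump_integrand_def indicator_def)
  have j2: "jump_integrand f x y = f (x + y) - f x - ?g \<bullet> y + ?g \<bullet> ?l y" for y
    by (simp add: jump_integrand_def indicator_def)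
  have 1: "(\<integral>y. jump_integrand f x y \<partial>\<nu> x) = U_inner \<nu> f x - ?g \<bullet> (\<integral>y. ?s y \<partial>\<nu> x)"
    unfolding j1 U_inner_def using \<nu>_f \<nu>_s sets_eq_imp_space_eq[OF sets(1)]
    by (simp add: mult.commute del: inner_scaleR_right)
  have 2: "(\<integral>y. jump_integrand f x y \<partial>\<mu> x) = (\<integral>y. f (x + y) - f x \<partial>\<mu> x) - ?g \<bullet> (\<integral>y. ?s y \<partial>\<mu> x)"
  proof -
    \<comment> \<open>Integrability is known for the jump integrand and for the compensator; the
      bare increment is integrated as their sum.\<close>
    have "(\<integral>y. f (x + y) - f x \<partial>\<mu> x) = (\<integral>y. jump_integrand f x y + ?g \<bullet> ?s y \<partial>\<mu> x)"
      unfolding j1 by simp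
    also have "\<dots> = (\<integral>y. jump_integrand f x y \<partial>\<mu> x) + ?g \<bullet> (\<integral>y. ?s y \<partial>\<mu> x)"
      using J(2) \<mu>_s by (subst Bochner_Integration.integral_add) (auto simp del: inner_scaleR_right)
    finally show ?thesis by simp
  qed
  have 3: "(\<integral>y. jump_integrand f x y \<partial>\<rho> x) = (\<integral>y. f (x + y) - f x - ?g \<bullet> y \<partial>\<rho> x) + ?g \<bullet> (\<integral>y. ?l y \<partial>\<rho> x)"
  proof -
    have "(\<integral>y. f (x + y) - f x - ?g \<bullet> y \<partial>\<rho> x) = (\<integral>y. jump_integrand f x y - ?g \<bullet> ?l y \<partial>\<rho> x)"
      unfolding j2 by simp
    also have "\<dots> = (\<integral>y. jump_integrand f x y \<partial>\<rho> x) - ?g \<bullet> (\<integral>y. ?l y \<partial>\<rho> x)"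
      using J(3) \<rho>_l by (subst Bochner_Integration.integral_diff) (auto simp del: inner_scaleR_right)
    finally show ?thesis by simp
  qed
  have V: "(\<Sum>i\<in>UNIV. V_inner \<mu> i (partial_deriv i f) x) = (\<integral>y. f (x + y) - f x \<partial>\<mu> x)"
    unfolding V_inner_def by (rule sum_integral_V_integrand[OF f sets(2) zero(1) fin(2)])
  have W: "(\<Sum>i\<in>UNIV. \<Sum>j\<in>UNIV. W_inner \<rho> i j (partial_deriv i (partial_deriv j f)) x) =
      (\<integral>y. f (x + y) - f x - ?g \<bullet> y \<partial>\<rho> x)"
    unfolding W_inner_def by (rule sum_integral_W_integrand[OF f sets(3) zero(2) fin(3)])
  show ?thesis
    unfolding levy_expr_def J(4) 1 2 3 V W a_pi_def set_lebesgue_integral_def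
    by (simp add: inner_add_left inner_diff_left inner_add_right inner_diff_right inner_commute[of _ "grad f x"])
qed

text \<open>Membership in \<open>M_space\<close> supplies integrability in \<open>x\<close>,
  measurability included, of each term, so the pointwise identity may be integrated term by
  term.\<close>

lemma integral_levy_expr:
  assumes M: "\<eta> \<in> M_space a b \<nu> \<mu> \<rho>" and f: "f \<in> C_c_infty"
    and dec: "convenient_decomposition Q \<nu> \<mu> \<rho>" and Q: "levy_kernel Q"
    and int: "\<And>x. integrable (Q x) (jump_integrand f x)"
  shows "(\<integral>x. levy_expr a b Q f x \<partial>\<eta>) =
     - drift_functional (\<lambda>x. a x + a_pi \<nu> \<mu> \<rho> x) \<eta> f + diffusion_functional b \<eta> f
     + U_functional \<nu> \<eta> f - div_V_functional \<mu> \<eta> f + H_W_functional \<rho> \<eta> f"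
proof -
  let ?c = "\<lambda>x. a x + a_pi \<nu> \<mu> \<rho> x"
  have ints: "integrable \<eta> (\<lambda>x. ?c x \<bullet> grad f x)" "integrable \<eta> (\<lambda>x. 1/2 * div_grad b f x)" "integrable \<eta> (U_inner \<nu> f)"
    "integrable \<eta> (V_inner \<mu> i (partial_deriv i f))" "integrable \<eta> (W_inner \<rho> i j (partial_deriv i (partial_deriv j f)))" for i j
    using M f unfolding M_space_def Let_def drift_defined_def diffusion_defined_def U_defined_def div_V_defined_def H_W_defined_def
    by blast+
  have "(\<integral>x. levy_expr a b Q f x \<partial>\<eta>) = (\<integral>x. ?c x \<bullet> grad f x + 1/2 * div_grad b f x + U_inner \<nu> f x
      + (\<Sum>i\<in>UNIV. V_inner \<mu> i (partial_deriv i f) x)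
      + (\<Sum>i\<in>UNIV. \<Sum>j\<in>UNIV. W_inner \<rho> i j (partial_deriv i (partial_deriv j f)) x) \<partial>\<eta>)"
    using Q unfolding levy_kernel_def
    by (intro Bochner_Integration.integral_cong refl levy_expr_eq_convenient[OF f dec _ _ int]) auto
  also have "\<dots> = (\<integral>x. ?c x \<bullet> grad f x \<partial>\<eta>) + (\<integral>x. 1/2 * div_grad b f x \<partial>\<eta>) + (\<integral>x. U_inner \<nu> f x \<partial>\<eta>)
      + (\<Sum>i\<in>UNIV. \<integral>x. V_inner \<mu> i (partial_deriv i f) x \<partial>\<eta>)
      + (\<Sum>i\<in>UNIV. \<Sum>j\<in>UNIV. \<integral>x. W_inner \<rho> i j (partial_deriv i (partial_deriv j f)) x \<partial>\<eta>)"
    using ints by (simp only: Bochner_Integration.integral_add Bochner_Integration.integrable_add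
        Bochner_Integration.integral_sum Bochner_Integration.integrable_sum)
  finally show ?thesis
    by (simp add: drift_functional_def diffusion_functional_def U_functional_def div_V_functional_def H_W_functional_def)
qed

section \<open>Feller semigroups and invariant measures\<close>

lemma C_infty_bounded:
  assumes "f \<in> C_infty"
  obtains C where "\<And>x. \<bar>f x\<bar> \<le> C"
proof -
  have "\<forall>\<^sub>F x in at_infinity. \<bar>f x\<bar> < 1"
    using assms tendstoD[of f 0 at_infinity 1] by (simp add: C_infty_def)
  then obtain K where K: "\<And>x. K \<le> norm x \<Longrightarrow> \<bar>f x\<bar> < 1"
    unfolding eventually_at_infinity by blast
  have "compact (f ` cball 0 K)"
    using assms by (intro compact_continuous_image) (auto simp: C_infty_def intro: continuous_on_subset)
  then obtain C where C: "\<And>y. y \<in> f ` cball 0 K \<Longrightarrow> norm y \<le> C"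
    using compact_imp_bounded bounded_iff by metis
  show ?thesis
  proof (rule that[of "max 1 C"])
    fix x show "\<bar>f x\<bar> \<le> max 1 C"
      using K[of x] C[of "f x"] by (cases "K \<le> norm x") (auto simp: le_max_iff_disj)
  qed
qed

lemma C_infty_borel_measurable: "f \<in> C_infty \<Longrightarrow> f \<in> borel_measurable borel"
  by (auto simp: C_infty_def intro: borel_measurable_continuous_onI)

lemma C_infty_integrable:
  assumes "f \<in> C_infty" "finite_measure M" "sets M = sets borel"
  shows "integrable M f"
proof -
  interpret finite_measure M by fact
  obtain C where C: "\<And>x. \<bar>f x\<bar> \<le> C" using C_infty_bounded[OF assms(1)] by metis
  show ?thesis
    using C_infty_borel_measurable[OF assms(1)] C
    by (intro integrable_const_bound[where B=C]) (auto simp: measurable_cong_sets[OF assms(3) refl])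
qed

text \<open>The indicator of an open box is the limit of
  \<open>min 1 (real n * infdist x (- box a b))\<close>. These functions are continuous and vanish
  off a bounded set, and boxes form a generator stable under intersection.\<close>

lemma measure_eqI_C_infty:
  fixes M N :: "(real^'n::finite) measure"
  assumes sets_M: "sets M = sets borel" and sets_N: "sets N = sets borel"
    and "finite_measure M" "finite_measure N"
    and eq: "\<And>f. f \<in> C_infty \<Longrightarrow> (\<integral>x. f x \<partial>M) = (\<integral>x. f x \<partial>N)"
  shows "M = N"
proof -
  interpret M: finite_measure M by fact
  interpret N: finite_measure N by fact
  have box: "measure M (box a b) = measure N (box a b)" for a b :: "real^'n"
  proof -
    define g where "g n x = min 1 (real n * infdist x (- box a b))" for n and x :: "real^'n"
    \<comment> \<open>\<open>infdist\<close> to the empty set is \<open>0\<close> by convention,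
      hence the check.\<close>
    have ne: "- box a b \<noteq> {}" using bounded_box[of a b] not_bounded_UNIV by (metis Compl_empty_eq double_complement)
    have in_box: "0 < infdist x (- box a b) \<longleftrightarrow> x \<in> box a b" for x :: "real^'n"
      using in_closed_iff_infdist_zero[of "- box a b" x] ne infdist_nonneg[of x "- box a b"]
      by (auto simp: closed_Compl open_box less_le)
    have out: "infdist x (- box a b) = 0" if "x \<notin> box a b" for x :: "real^'n"
      using in_box[of x] that infdist_nonneg[of x "- box a b"] by simp
    have g: "g n \<in> C_infty" for n
    proof -
      obtain B where B: "\<And>x. x \<in> box a b \<Longrightarrow> norm x \<le> B"
        using bounded_box[of a b] bounded_iff by metis
      have "\<forall>\<^sub>F x in at_infinity. g n x = 0"
        unfolding eventually_at_infinity
      proof (intro exI allI impI)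
        fix x :: "real^'n" assume "B + 1 \<le> norm x"
        then have "x \<notin> box a b" using B[of x] by auto
        then show "g n x = 0" by (simp add: g_def out)
      qed
      then have "(g n \<longlongrightarrow> 0) at_infinity" by (rule tendsto_eventually)
      moreover have "continuous_on UNIV (g n)"
        unfolding g_def by (intro continuous_intros)
      ultimately show ?thesis by (simp add: C_infty_def)
    qed
    have lim: "(\<lambda>n. g n x) \<longlonglongrightarrow> indicator (box a b) x" for x
    proof (cases "x \<in> box a b")
      case True
      obtain n where n: "1 / infdist x (- box a b) < real n" using reals_Archimedean2 by blast
      have pos: "0 < infdist x (- box a b)" using True in_box by simp
      have "g m x = 1" if "n \<le> m" for m
      proof -
        have "1 / infdist x (- box a b) < real m" using n that by simp
        then have "1 < real m * infdist x (- box a b)" using pos by (simp add: field_simps)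
        then show ?thesis by (simp add: g_def)
      qed
      then have "\<forall>\<^sub>F m in sequentially. g m x = 1" unfolding eventually_sequentially by blast
      then show ?thesis using True by (simp add: tendsto_eventually)
    qed (simp add: g_def out)
    have conv: "(\<lambda>n. \<integral>x. g n x \<partial>K) \<longlonglongrightarrow> measure K (box a b)"
      if K: "finite_measure K" "sets K = sets borel" for K :: "(real^'n) measure"
    proof -
      interpret K: finite_measure K by fact
      have "(\<lambda>n. \<integral>x. g n x \<partial>K) \<longlonglongrightarrow> (\<integral>x. indicator (box a b) x \<partial>K)"
      proof (rule integral_dominated_convergence[where w="\<lambda>_. 1"])
        show "g n \<in> borel_measurable K" for n
          using C_infty_borel_measurable[OF g] by (simp add: measurable_cong_sets[OF K(2) refl])
        show "AE x in K. norm (g n x) \<le> 1" for n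
          by (auto simp: g_def infdist_nonneg)
      qed (use lim K(2) in \<open>auto simp: measurable_cong_sets[OF K(2) refl]\<close>)
      then show ?thesis using K(2) sets_eq_imp_space_eq[OF K(2)] by simp
    qed
    show ?thesis
      using conv[OF M.finite_measure_axioms sets_M] conv[OF N.finite_measure_axioms sets_N]
      by (simp add: eq[OF g] LIMSEQ_unique)
  qed
  show ?thesis
  proof (rule measure_eqI_generator_eq[where A="\<lambda>n::nat. box (- (real n *\<^sub>R One)) (real n *\<^sub>R One)"])
    let ?E = "range (\<lambda>(a, b). box a b :: (real^'n) set)"
    show "Int_stable ?E" by (auto simp: Int_stable_def box_Int_box)
    show "sets M = sigma_sets UNIV ?E" "sets N = sigma_sets UNIV ?E"
      using sets_M sets_N by (simp_all add: borel_eq_box)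
    show "emeasure M X = emeasure N X" if "X \<in> ?E" for X
      using that box by (auto simp: M.emeasure_eq_measure N.emeasure_eq_measure)
    show "(\<Union>n::nat. box (- (real n *\<^sub>R One)) (real n *\<^sub>R One)) = (UNIV :: (real^'n) set)"
      by (rule UN_box_eq_UNIV)
  qed auto
qed

lemma tendsto_integral_uniform_limit:
  fixes F :: "'b \<Rightarrow> 'a \<Rightarrow> real"
  assumes lim: "uniform_limit UNIV F g \<F>" and "finite_measure M"
    and int: "\<forall>\<^sub>F n in \<F>. integrable M (F n)" "integrable M g"
  shows "((\<lambda>n. \<integral>x. F n x \<partial>M) \<longlongrightarrow> (\<integral>x. g x \<partial>M)) \<F>"
proof (rule tendstoI)
  interpret finite_measure M by fact
  fix e :: real assume e: "0 < e"
  let ?m = "measure M (space M)"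
  \<comment> \<open>The added \<open>1\<close> guards against a null measure.\<close>
  define d where "d = e / (?m + 1)"
  have m: "0 < ?m + 1" using measure_nonneg[of M "space M"] by linarith
  have d: "0 < d" "d * ?m < e"
    using e m by (simp_all add: d_def field_simps)
  from uniform_limitD[OF lim d(1)] int(1)
  show "\<forall>\<^sub>F n in \<F>. dist (\<integral>x. F n x \<partial>M) (\<integral>x. g x \<partial>M) < e"
  proof eventually_elim
    case (elim n)
    have "dist (\<integral>x. F n x \<partial>M) (\<integral>x. g x \<partial>M) = \<bar>\<integral>x. F n x - g x \<partial>M\<bar>"
      using elim int(2) by (simp add: dist_real_def)
    also have "\<dots> \<le> (\<integral>x. d \<partial>M)"
      using elim int(2)
      by (intro order_trans[OF integral_norm_bound[where 'a=real, unfolded real_norm_def]] integral_mono integrable_abs) (auto simp: dist_real_def less_imp_le)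
    also have "\<dots> < e" using d by (simp add: mult.commute)
    finally show ?case .
  qed
qed

section \<open>Transition kernels and the Chapman-Kolmogorov equation\<close>

definition transition :: "('a \<Rightarrow> 'w measure) \<Rightarrow> (real \<Rightarrow> 'w \<Rightarrow> real^'n::finite) \<Rightarrow> real \<Rightarrow> 'a \<Rightarrow> (real^'n) measure"
  where "transition P X t x = distr (P x) borel (X t)"

context markov_process
begin

lemma space_P: "space (P x) = space M"
  using sets_P by (rule sets_eq_imp_space_eq)

lemma X_measurable_P: "0 \<le> t \<Longrightarrow> X t \<in> borel_measurable (P x)"
  using X_measurable by (simp add: measurable_cong_sets[OF sets_P refl])

lemma prob_space_transition: "0 \<le> t \<Longrightarrow> prob_space (transition P X t x)"
  unfolding transition_def by (rule prob_space.prob_space_distr[OF prob X_measurable_P])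

lemma sets_transition: "sets (transition P X t x) = sets borel"
  by (simp add: transition_def)

lemma space_transition: "space (transition P X t x) = UNIV"
  by (simp add: transition_def)

lemma emeasure_transition:
  "0 \<le> t \<Longrightarrow> B \<in> sets borel \<Longrightarrow> emeasure (transition P X t x) B = emeasure (P x) (X t -` B \<inter> space M)"
  unfolding transition_def using X_measurable_P by (simp add: emeasure_distr space_P)

lemma measure_transition:
  "0 \<le> t \<Longrightarrow> B \<in> sets borel \<Longrightarrow> measure (transition P X t x) B = measure (P x) (X t -` B \<inter> space M)"
  by (simp add: measure_def emeasure_transition)

lemma measurable_transition:
  assumes t: "0 \<le> t"
  shows "transition P X t \<in> measurable borel (subprob_algebra borel)"
proof (rule measurable_subprob_algebra)
  fix B :: "(real^'n) set" assume B: "B \<in> sets borel"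
  have "emeasure (transition P X t x) B = ennreal (measure (P x) (X t -` B \<inter> space M))" for x
    using prob_space_transition[OF t] B
    by (simp add: finite_measure.emeasure_eq_measure prob_space.finite_measure measure_transition t)
  then show "(\<lambda>x. emeasure (transition P X t x) B) \<in> borel_measurable borel"
    using kernel[OF t B] by simp
qed (auto simp: sets_transition intro: prob_space_imp_subprob_space prob_space_transition t)

lemma semigroup_op_eq:
  assumes "0 \<le> t" "f \<in> borel_measurable borel"
  shows "semigroup_op P X t f x = (\<integral>y. f y \<partial>transition P X t x)"
  unfolding semigroup_op_def transition_def using assms X_measurable_P by (simp add: integral_distr)

lemma integrable_transition:
  fixes f :: "real^'n \<Rightarrow> real"
  assumes "0 \<le> t" "f \<in> borel_measurable borel" "\<And>x. \<bar>f x\<bar> \<le> C"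
  shows "integrable (transition P X t x) f"
proof -
  interpret T: prob_space "transition P X t x" using assms(1) by (rule prob_space_transition)
  show ?thesis
    using assms by (intro T.integrable_const_bound[where B=C]) (auto simp: measurable_cong_sets[OF sets_transition refl])
qed

lemma semigroup_op_0:
  assumes "f \<in> borel_measurable borel" shows "semigroup_op P X 0 f x = f x"
proof -
  interpret prob_space "P x" by (rule prob)
  have "semigroup_op P X 0 f x = (\<integral>w. f x \<partial>P x)"
    unfolding semigroup_op_def using start[of x] X_measurable_P[of 0 x] assms
    by (intro integral_cong_AE) auto
  then show ?thesis by (simp add: prob_space)
qed

lemma abs_integral_transition_le:
  fixes f :: "real^'n \<Rightarrow> real"
  assumes "0 \<le> t" "f \<in> borel_measurable borel" "\<And>x. \<bar>f x\<bar> \<le> C"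
  shows "\<bar>\<integral>y. f y \<partial>transition P X t x\<bar> \<le> C"
proof -
  interpret T: prob_space "transition P X t x" using assms(1) by (rule prob_space_transition)
  have "\<bar>\<integral>y. f y \<partial>transition P X t x\<bar> \<le> (\<integral>y. \<bar>f y\<bar> \<partial>transition P X t x)"
    using integral_norm_bound[of "transition P X t x" f] by simp
  also have "\<dots> \<le> (\<integral>y. C \<partial>transition P X t x)"
    using assms by (intro integral_mono integrable_abs integrable_transition) auto
  finally show ?thesis by (simp add: T.prob_space)
qed

text \<open>Expectations are taken in the Markov property: the conditional expectation of the
  indicator has the same mean as the indicator, and its version depends on \<open>w\<close> through
  \<open>X s w\<close> only, so it integrates against the law of \<open>X s\<close>.\<close>

lemma chapman_kolmogorov:
  assumes s: "0 \<le> s" and t: "0 \<le> t"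
  shows "transition P X (s + t) x = transition P X s x \<bind> transition P X t"
proof (rule measure_eqI)
  note [measurable] = measurable_transition[OF t]
  have m: "transition P X t \<in> measurable (transition P X s x) (subprob_algebra borel)"
    using measurable_transition[OF t] by (simp add: measurable_cong_sets[OF sets_transition refl])
  show "sets (transition P X (s + t) x) = sets (transition P X s x \<bind> transition P X t)"
    using sets_bind[of "transition P X s x" "transition P X t" borel] by (simp add: space_transition sets_transition)
  fix B assume "B \<in> sets (transition P X (s + t) x)"
  then have B: "B \<in> sets borel" by (simp add: sets_transition)
  interpret Px: prob_space "P x" by (rule prob)
  interpret T: prob_space "transition P X s x" using s by (rule prob_space_transition)
  let ?F = "natural_filtration M X s"
  have gen: "{X u -` B \<inter> space M | u B. 0 \<le> u \<and> u \<le> s \<and> B \<in> sets borel} \<subseteq> sets M"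
    using X_measurable by (auto intro: measurable_sets)
  have "subalgebra (P x) ?F"
    unfolding subalgebra_def natural_filtration_def
    using sets.sigma_sets_subset[OF gen] sets.sets_into_space
    by (subst space_measure_of, blast, subst sets_measure_of, blast) (simp add: space_P sets_P)
  then interpret finite_measure_subalgebra "P x" ?F
    by unfold_locales
  let ?A = "X (s + t) -` B \<inter> space M"
  have A: "?A \<in> sets (P x)"
    using X_measurable[of "s + t"] s t B by (auto simp: sets_P intro: measurable_sets)
  have int: "integrable (P x) (indicator ?A :: _ \<Rightarrow> real)"
    using A by (simp add: Px.emeasure_eq_measure)
  have k: "(\<lambda>y. measure (P y) (X t -` B \<inter> space M)) \<in> borel_measurable borel" by (rule kernel[OF t B])
  have "measure (transition P X (s + t) x) B = (\<integral>w. indicator ?A w \<partial>P x)"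
    using A s t B sets.sets_into_space[OF A] by (simp add: measure_transition space_P Int_absorb1)
  also have "\<dots> = (\<integral>w. real_cond_exp (P x) ?F (indicator ?A) w \<partial>P x)"
    using real_cond_exp_int(2)[OF int] by simp
  also have "\<dots> = (\<integral>w. measure (P (X s w)) (X t -` B \<inter> space M) \<partial>P x)"
    using markov[OF s t B, of x] measurable_compose[OF X_measurable_P[OF s] k]
    by (intro integral_cong_AE) (auto intro: borel_measurable_cond_exp2)
  also have "\<dots> = (\<integral>y. measure (P y) (X t -` B \<inter> space M) \<partial>transition P X s x)"
    unfolding transition_def using X_measurable_P[OF s] k by (subst integral_distr) auto
  finally have eq: "measure (transition P X (s + t) x) B = (\<integral>y. measure (transition P X t y) B \<partial>transition P X s x)"
    using t B by (simp add: measure_transition)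
  have mt: "(\<lambda>y. measure (transition P X t y) B) \<in> borel_measurable borel"
    using k t B by (simp add: measure_transition)
  have "emeasure (transition P X s x \<bind> transition P X t) B = (\<integral>\<^sup>+y. emeasure (transition P X t y) B \<partial>transition P X s x)"
    using m B by (intro emeasure_bind) (auto simp: space_transition)
  also have "\<dots> = (\<integral>\<^sup>+y. ennreal (measure (transition P X t y) B) \<partial>transition P X s x)"
    using prob_space_transition[OF t]
    by (intro nn_integral_cong) (simp add: finite_measure.emeasure_eq_measure prob_space.finite_measure)
  also have "\<dots> = ennreal (\<integral>y. measure (transition P X t y) B \<partial>transition P X s x)"
    using mt prob_space.prob_le_1[OF prob_space_transition[OF t]]
    by (intro nn_integral_eq_integral T.integrable_const_bound[where B=1])
      (auto simp: measurable_cong_sets[OF sets_transition refl])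
  also have "\<dots> = emeasure (transition P X (s + t) x) B"
    using prob_space_transition[of "s + t"] s t eq
    by (simp add: finite_measure.emeasure_eq_measure prob_space.finite_measure)
  finally show "emeasure (transition P X (s + t) x) B = emeasure (transition P X s x \<bind> transition P X t) B" ..
qed

lemma integral_bind_transition:
  fixes f :: "real^'n \<Rightarrow> real"
  assumes t: "0 \<le> t" and N: "finite_measure N" "sets N = sets borel"
    and f: "f \<in> borel_measurable borel" "\<And>x. \<bar>f x\<bar> \<le> C"
  shows "(\<integral>y. f y \<partial>(N \<bind> transition P X t)) = (\<integral>x. semigroup_op P X t f x \<partial>N)"
proof -
  have "(\<integral>y. f y \<partial>(N \<bind> transition P X t)) = (\<integral>x. (\<integral>y. f y \<partial>transition P X t x) \<partial>N)"
  proof (rule integral_bind[where K=borel and B=C and B'=1])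
    show "transition P X t \<in> measurable N (subprob_algebra borel)"
      using measurable_transition[OF t] by (simp add: measurable_cong_sets[OF N(2) refl])
    show "AE x in N. emeasure (transition P X t x) (space (transition P X t x)) \<le> ennreal 1"
      using prob_space.emeasure_space_1[OF prob_space_transition[OF t]] by simp
  qed (use f N in auto)
  then show ?thesis using semigroup_op_eq[OF t f(1)] by simp
qed

lemma semigroup_op_add:
  assumes s: "0 \<le> s" and t: "0 \<le> t" and f: "f \<in> borel_measurable borel" "\<And>x. \<bar>f x\<bar> \<le> C"
  shows "semigroup_op P X (s + t) f x = (\<integral>y. semigroup_op P X t f y \<partial>transition P X s x)"
  using semigroup_op_eq[of "s + t" f x] s t f
    integral_bind_transition[OF t prob_space.finite_measure[OF prob_space_transition[OF s]] sets_transition f]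
  by (simp add: chapman_kolmogorov)

text \<open>Both sides say that \<open>\<eta> \<bind> transition P X t\<close> is
  \<open>\<eta>\<close>, once evaluated on Borel sets and once tested with \<open>C_infty\<close>,
  which determines a finite measure.\<close>

lemma invariant_measure_iff:
  assumes \<eta>: "finite_measure \<eta>" "sets \<eta> = sets borel"
  shows "invariant_measure M P X \<eta> \<longleftrightarrow> (\<forall>t\<ge>0. \<forall>f\<in>C_infty. (\<integral>x. semigroup_op P X t f x \<partial>\<eta>) = (\<integral>x. f x \<partial>\<eta>))"
proof -
  interpret \<eta>: finite_measure \<eta> by fact
  have "(\<forall>B\<in>sets borel. (\<integral>\<^sup>+x. emeasure (P x) (X t -` B \<inter> space M) \<partial>\<eta>) = emeasure \<eta> B) \<longleftrightarrow>
      (\<forall>f\<in>C_infty. (\<integral>x. semigroup_op P X t f x \<partial>\<eta>) = (\<integral>x. f x \<partial>\<eta>))" (is "?L \<longleftrightarrow> ?R") if t: "0 \<le> t" for t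
  proof -
    have m: "transition P X t \<in> measurable \<eta> (subprob_algebra borel)"
      using measurable_transition[OF t] by (simp add: measurable_cong_sets[OF \<eta>(2) refl])
    have sp: "space \<eta> = UNIV" using sets_eq_imp_space_eq[OF \<eta>(2)] by simp
    have sets: "sets (\<eta> \<bind> transition P X t) = sets borel"
      by (rule sets_bind) (simp_all add: sets_transition sp)
    have em: "emeasure (\<eta> \<bind> transition P X t) B = (\<integral>\<^sup>+x. emeasure (P x) (X t -` B \<inter> space M) \<partial>\<eta>)"
      if B: "B \<in> sets borel" for B
      using m B t by (subst emeasure_bind) (auto simp: sp emeasure_transition)
    have "finite_measure (\<eta> \<bind> transition P X t)"
    proof (rule finite_measureI)
      have "emeasure (\<eta> \<bind> transition P X t) UNIV = (\<integral>\<^sup>+x. emeasure (transition P X t x) UNIV \<partial>\<eta>)"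
        using m by (subst emeasure_bind) (auto simp: sp)
      also have "\<dots> = (\<integral>\<^sup>+x. 1 \<partial>\<eta>)"
        using prob_space.emeasure_space_1[OF prob_space_transition[OF t]] by (simp add: space_transition)
      finally show "emeasure (\<eta> \<bind> transition P X t) (space (\<eta> \<bind> transition P X t)) \<noteq> \<infinity>"
        using sets_eq_imp_space_eq[OF sets] by simp
    qed
    then have "?R \<longleftrightarrow> \<eta> \<bind> transition P X t = \<eta>"
    proof (intro iffI ballI)
      assume R: ?R and fm: "finite_measure (\<eta> \<bind> transition P X t)"
      show "\<eta> \<bind> transition P X t = \<eta>"
      proof (rule measure_eqI_C_infty[OF sets \<eta>(2) fm \<eta>(1)])
        fix f :: "real^'n \<Rightarrow> real" assume f: "f \<in> C_infty"
        obtain C where C: "\<And>x. \<bar>f x\<bar> \<le> C" using C_infty_bounded[OF f] by metis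
        show "(\<integral>x. f x \<partial>(\<eta> \<bind> transition P X t)) = (\<integral>x. f x \<partial>\<eta>)"
          using integral_bind_transition[OF t \<eta> C_infty_borel_measurable[OF f] C] R f by simp
      qed
    next
      fix f :: "real^'n \<Rightarrow> real" assume E: "\<eta> \<bind> transition P X t = \<eta>" and f: "f \<in> C_infty"
      obtain C where C: "\<And>x. \<bar>f x\<bar> \<le> C" using C_infty_bounded[OF f] by metis
      show "(\<integral>x. semigroup_op P X t f x \<partial>\<eta>) = (\<integral>x. f x \<partial>\<eta>)"
        using integral_bind_transition[OF t \<eta> C_infty_borel_measurable[OF f] C] E by simp
    qed
    also have "\<dots> \<longleftrightarrow> ?L"
      using em sets \<eta>(2) by (auto intro!: measure_eqI)
    finally show ?thesis by blast
  qed
  then show ?thesis using \<eta>(2) unfolding invariant_measure_def by blast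
qed

end

section \<open>The generator and time averages of the semigroup\<close>

lemma is_generator_value_unique:
  assumes "is_generator_value P X f g" "is_generator_value P X f g'"
  shows "g = g'"
proof
  fix x
  show "g x = g' x"
    using tendsto_uniform_limitI[OF assms(1)[unfolded is_generator_value_def] UNIV_I]
      tendsto_uniform_limitI[OF assms(2)[unfolded is_generator_value_def] UNIV_I]
    by (rule tendsto_unique[OF trivial_limit_at_right_real])
qed

lemma generator_eqI: "is_generator_value P X f g \<Longrightarrow> generator P X f = g"
  unfolding generator_def by (rule the_equality) (auto intro: is_generator_value_unique)

lemma is_generator_value_generator:
  "f \<in> generator_dom P X \<Longrightarrow> is_generator_value P X f (generator P X f)"
  using generator_eqI unfolding generator_dom_def by blast

text \<open>One approximant per \<open>e\<close> instead of a sequence, to fit the Riemann sums used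
  below.\<close>

lemma uniform_limit_C_infty:
  assumes g: "continuous_on UNIV g" and approx: "\<And>e. 0 < e \<Longrightarrow> \<exists>f\<in>C_infty. \<forall>x. \<bar>f x - g x\<bar> < e"
  shows "g \<in> C_infty"
proof -
  have "(g \<longlongrightarrow> 0) at_infinity"
  proof (rule tendstoI)
    fix e :: real assume "0 < e"
    with approx[of "e / 2"] obtain f where f: "f \<in> C_infty" "\<And>x. \<bar>f x - g x\<bar> < e / 2" by auto
    have "\<forall>\<^sub>F x in at_infinity. dist (f x) 0 < e / 2"
      using f(1) \<open>0 < e\<close> by (intro tendstoD) (auto simp: C_infty_def)
    then show "\<forall>\<^sub>F x in at_infinity. dist (g x) 0 < e"
    proof eventually_elim
      case (elim x)
      then show ?case using f(2)[of x] unfolding dist_real_def by linarith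
    qed
  qed
  with g show ?thesis by (simp add: C_infty_def)
qed

instance bcontfun :: (metric_space, banach) banach ..

text \<open>Vanishing at infinity is not part of the type of bounded continuous functions. It
  survives integration because the integral is a norm limit of tagged Riemann sums, finite
  combinations of values of \<open>F\<close>.\<close>

lemma C_infty_integral:
  fixes F :: "real \<Rightarrow> (real^'n::finite) \<Rightarrow>\<^sub>C real"
  assumes F: "\<And>s. s \<in> {a..b} \<Longrightarrow> apply_bcontfun (F s) \<in> C_infty" and int: "F integrable_on {a..b}"
  shows "apply_bcontfun (integral {a..b} F) \<in> C_infty"
proof (rule uniform_limit_C_infty)
  fix e :: real assume "0 < e"
  from integrable_integral[OF int, unfolded has_integral_real, rule_format, OF this]
  obtain \<gamma> where \<gamma>': "gauge \<gamma> \<and> (\<forall>\<D>. \<D> tagged_division_of {a..b} \<and> \<gamma> fine \<D> \<longrightarrow>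
    norm ((\<Sum>(x, k)\<in>\<D>. measure lborel k *\<^sub>R F x) - integral {a..b} F) < e)" by (rule exE)
  then have \<gamma>: "gauge \<gamma>" by (rule conjunct1)
  note close = mp[OF spec[OF conjunct2[OF \<gamma>']], OF conjI]
  obtain \<D> where \<D>: "\<D> tagged_division_of {a..b}" "\<gamma> fine \<D>" by (rule fine_division_exists_real[OF \<gamma>])
  let ?R = "\<Sum>(x, k)\<in>\<D>. measure lborel k *\<^sub>R F x"
  have ev: "apply_bcontfun (\<Sum>i\<in>I. G i) x = (\<Sum>i\<in>I. apply_bcontfun (G i) x)"
    for I x and G :: "real \<times> real set \<Rightarrow> (real^'n) \<Rightarrow>\<^sub>C real"
    by (induction I rule: infinite_finite_induct) auto
  have "((\<lambda>y. \<Sum>(x, k)\<in>\<D>. measure lborel k * F x y) \<longlongrightarrow> (\<Sum>(x, k)\<in>\<D>. 0)) at_infinity"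
  proof (rule tendsto_sum, clarify)
    fix x k assume "(x, k) \<in> \<D>"
    then have "x \<in> {a..b}" using tagged_division_ofD(2,3)[OF \<D>(1)] by blast
    from F[OF this] have "(F x \<longlongrightarrow> 0) at_infinity" by (simp add: C_infty_def)
    from tendsto_mult_right_zero[OF this] show "((\<lambda>y. measure lborel k * F x y) \<longlongrightarrow> 0) at_infinity" .
  qed
  also have "(\<lambda>y. \<Sum>(x, k)\<in>\<D>. measure lborel k * F x y) = apply_bcontfun ?R"
    by (simp add: fun_eq_iff ev split_beta')
  finally have "apply_bcontfun ?R \<in> C_infty"
    by (simp only: C_infty_def mem_Collect_eq continuous_on_apply_bcontfun split_beta' sum.neutral_const simp_thms)
  moreover have "\<bar>apply_bcontfun ?R x - apply_bcontfun (integral {a..b} F) x\<bar> < e" for x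
    using norm_bounded[of "?R - integral {a..b} F" x] close[OF \<D>] by simp
  ultimately show "\<exists>f\<in>C_infty. \<forall>x. \<bar>f x - apply_bcontfun (integral {a..b} F) x\<bar> < e" by blast
qed simp

lemma integral_apply_bounded_linear:
  fixes F :: "real \<Rightarrow> 'a::banach" and L :: "'a \<Rightarrow> real"
  assumes "bounded_linear L" "continuous_on {a..b} F"
  shows "L (integral {a..b} F) = integral {a..b} (\<lambda>s. L (F s))"
  using integral_linear[OF integrable_continuous_real[OF assms(2)] assms(1)] by (simp add: o_def)

lemma bounded_linear_apply_bcontfun:
  "bounded_linear (\<lambda>f. apply_bcontfun (f :: 'a::topological_space \<Rightarrow>\<^sub>C real) x)"
  by (rule bounded_linear_intro[where K=1]) (use norm_bounded[where 'b=real] in \<open>auto simp flip: real_norm_def\<close>)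

text \<open>Contractivity in the supremum norm; boundedness lets the semigroup be pulled inside a
  Banach-space-valued integral.\<close>

lemma (in markov_process) bounded_linear_transition:
  assumes "0 \<le> t"
  shows "bounded_linear (\<lambda>f :: (real^'n) \<Rightarrow>\<^sub>C real. \<integral>y. apply_bcontfun f y \<partial>transition P X t x)"
proof (rule bounded_linear_intro[where K=1])
  have m: "apply_bcontfun f \<in> borel_measurable borel" for f :: "(real^'n) \<Rightarrow>\<^sub>C real"
    by (rule borel_measurable_continuous_onI) simp
  have b: "\<bar>apply_bcontfun f y\<bar> \<le> norm f" for f :: "(real^'n) \<Rightarrow>\<^sub>C real" and y
    using norm_bounded[of f y] by simp
  note i = integrable_transition[OF assms m b]
  show "(\<integral>y. apply_bcontfun (f + g) y \<partial>transition P X t x) =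
    (\<integral>y. apply_bcontfun f y \<partial>transition P X t x) + (\<integral>y. apply_bcontfun g y \<partial>transition P X t x)" for f g :: "(real^'n) \<Rightarrow>\<^sub>C real"
    using i by simp
  show "norm (\<integral>y. apply_bcontfun f y \<partial>transition P X t x) \<le> norm f * 1" for f :: "(real^'n) \<Rightarrow>\<^sub>C real"
    using abs_integral_transition_le[OF assms m b] by simp
qed simp

text \<open>The witness is \<open>g = \<integral>\<^sub>0\<^sup>t P\<^sub>s f ds\<close>, an integral in the Banach space of bounded continuous functions.\<close>

lemma generator_time_average:
  fixes P :: "real^'n::finite \<Rightarrow> 'w measure"
  assumes feller: "feller_process M P X" and f: "f \<in> C_infty" and t: "0 \<le> t"
  obtains g where "g \<in> generator_dom P X" "generator P X g = (\<lambda>x. semigroup_op P X t f x - f x)"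
proof -
  interpret markov_process M P X using feller by (simp add: feller_process_def)
  have PC: "semigroup_op P X s f \<in> C_infty" if "0 \<le> s" for s
    using feller f that by (simp add: feller_process_def)
  have lim0: "uniform_limit UNIV (\<lambda>s. semigroup_op P X s f) f (at_right 0)"
    using feller f by (simp add: feller_process_def)
  obtain C where C: "\<And>x. \<bar>f x\<bar> \<le> C" using C_infty_bounded[OF f] by metis
  note fm = C_infty_borel_measurable[OF f]
  define F where "F s = Bcontfun (semigroup_op P X s f)" for s
  have F: "apply_bcontfun (F s) = semigroup_op P X s f" if s: "0 \<le> s" for s
  proof -
    obtain C' where "\<And>x. \<bar>semigroup_op P X s f x\<bar> \<le> C'" using C_infty_bounded[OF PC[OF s]] by metis
    then have "semigroup_op P X s f \<in> bcontfun"
      using PC[OF s] by (intro bcontfun_normI) (auto simp: C_infty_def)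
    then show ?thesis unfolding F_def by (rule Bcontfun_inverse)
  qed
  have F_shift: "(\<integral>y. apply_bcontfun (F s) y \<partial>transition P X h x) = apply_bcontfun (F (s + h)) x"
    if "0 \<le> s" "0 \<le> h" for s h x
    using semigroup_op_add[OF that(2,1) fm C, of x] that by (simp add: F add.commute)
  \<comment> \<open>P_(s+h) f - P_s f = P_s (P_h f - f) and P_s is a contraction, so the modulus of
    continuity at \<open>0\<close> serves at every time.\<close>
  have F_step: "norm (F (s + h) - F s) \<le> e"
    if s: "0 \<le> s" and h: "0 \<le> h" and e: "\<And>x. \<bar>semigroup_op P X h f x - f x\<bar> \<le> e" for s h e :: real
  proof (rule norm_bound)
    fix x
    have "apply_bcontfun (F (s + h) - F s) x =
        (\<integral>y. apply_bcontfun (F h) y \<partial>transition P X s x) - (\<integral>y. f y \<partial>transition P X s x)"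
      using F_shift[OF h s, of x] F[OF s] semigroup_op_eq[OF s fm] by (simp add: add.commute)
    also have "\<dots> = (\<integral>y. semigroup_op P X h f y - f y \<partial>transition P X s x)"
      using integrable_transition[OF s fm C] integrable_transition[OF s C_infty_borel_measurable[OF PC[OF h]], of _ x]
        C_infty_bounded[OF PC[OF h]] F[OF h]
      by (subst Bochner_Integration.integral_diff) (auto simp: prob_space.finite_measure prob_space_transition s sets_transition
          intro!: C_infty_integrable PC h)
    finally show "norm (apply_bcontfun (F (s + h) - F s) x) \<le> e"
      using abs_integral_transition_le[OF s _ e] fm C_infty_borel_measurable[OF PC[OF h]] by simp
  qed
  \<comment> \<open>Continuity is given only from the right at \<open>0\<close>. As
    \<open>F_step\<close> is uniform in the base point, differences to the left are handled by
    taking the smaller time as base.\<close>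
  have cont: "continuous_on {0..} F"
    unfolding continuous_on_iff
  proof (intro ballI allI impI)
    fix s e :: real assume s: "s \<in> {0..}" and e: "0 < e"
    have "0 < e / 2" using e by simp
    from uniform_limitD[OF lim0 this] obtain d where d: "0 < d"
      "\<And>h x. 0 < h \<Longrightarrow> h < d \<Longrightarrow> \<bar>semigroup_op P X h f x - f x\<bar> < e / 2"
      unfolding eventually_at_right_field by (auto simp: dist_real_def)
    have step: "norm (F (s + h) - F s) \<le> e / 2" if "0 \<le> s" "0 \<le> h" "h < d" for s h :: real
    proof (cases "h = 0")
      case False
      then show ?thesis using d(2)[of h] that by (intro F_step) (auto intro: less_imp_le)
    qed (use e in simp)
    have "dist (F s') (F s) < e" if s': "s' \<in> {0..}" "dist s' s < d" for s' :: real
    proof (cases "s \<le> s'")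
      case True
      then show ?thesis using step[of s "s' - s"] s s' e by (simp add: dist_norm)
    next
      case False
      then show ?thesis using step[of s' "s - s'"] s s' e by (simp add: dist_norm norm_minus_commute)
    qed
    then show "\<exists>d>0. \<forall>s'\<in>{0..}. dist s' s < d \<longrightarrow> dist (F s') (F s) < e" using d(1) by blast
  qed
  have contI: "continuous_on {a..b} F" if "0 \<le> a" for a b :: real
    using cont by (rule continuous_on_subset) (use that in auto)
  define \<Phi> where "\<Phi> u = integral {0..u} F" for u
  \<comment> \<open>The derivative of the indefinite integral, one-sided and in norm; the interval
    up to \<open>u + 1\<close> leaves room to the right of \<open>u\<close>.\<close>
  have \<Phi>_deriv: "\<forall>\<^sub>F h in at_right 0. norm (\<Phi> (u + h) - \<Phi> u - h *\<^sub>R F u) \<le> e * h"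
    if u: "0 \<le> u" and e: "0 < e" for u e
  proof -
    have "(\<Phi> has_vector_derivative F u) (at u within {0..u + 1})"
      unfolding \<Phi>_def using u by (intro Henstock_Kurzweil_Integration.integral_has_vector_derivative[OF contI]) auto
    then obtain d where d: "0 < d"
      "\<And>v. v \<in> {0..u + 1} \<Longrightarrow> \<bar>v - u\<bar> < d \<Longrightarrow> norm (\<Phi> v - \<Phi> u - (v - u) *\<^sub>R F u) \<le> e * \<bar>v - u\<bar>"
      unfolding has_vector_derivative_def has_derivative_within_alt using e by (metis real_norm_def)
    show ?thesis
      unfolding eventually_at_right_field
    proof (intro exI[of _ "min d 1"] conjI allI impI)
      fix h assume "0 < h" "h < min d 1"
      then show "norm (\<Phi> (u + h) - \<Phi> u - h *\<^sub>R F u) \<le> e * h" using d(2)[of "u + h"] u by simp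
    qed (use d in auto)
  qed
  define g where "g = apply_bcontfun (\<Phi> t)"
  have g: "g \<in> C_infty"
    unfolding g_def \<Phi>_def using PC by (intro C_infty_integral integrable_continuous_real contI) (auto simp: F)
  \<comment> \<open>The semigroup shifts the domain of integration from \<open>{0..t}\<close> to
    \<open>{h..t + h}\<close>, so the difference quotient of \<open>g\<close> sees only the two end
    pieces.\<close>
  have Pg: "semigroup_op P X h g x = apply_bcontfun (\<Phi> (t + h) - \<Phi> h) x" if h: "0 \<le> h" for h x
  proof -
    have "semigroup_op P X h g x = (\<integral>y. apply_bcontfun (\<Phi> t) y \<partial>transition P X h x)"
      using semigroup_op_eq[OF h C_infty_borel_measurable[OF g]] by (simp add: g_def)
    also have "\<dots> = integral {0..t} (\<lambda>s. \<integral>y. apply_bcontfun (F s) y \<partial>transition P X h x)"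
      unfolding \<Phi>_def by (rule integral_apply_bounded_linear[OF bounded_linear_transition[OF h] contI]) simp
    also have "\<dots> = integral {0..t} (\<lambda>s. apply_bcontfun (F (s + h)) x)"
      using h by (intro integral_cong F_shift) auto
    also have "\<dots> = integral {h..t + h} (\<lambda>s. apply_bcontfun (F s) x)"
      using integral_shift_real_ivl[of h h "t + h" "\<lambda>s. apply_bcontfun (F s) x"] by simp
    also have "\<dots> = apply_bcontfun (integral {h..t + h} F) x"
      using integral_apply_bounded_linear[OF bounded_linear_apply_bcontfun contI[OF h]] by simp
    also have "integral {h..t + h} F = \<Phi> (t + h) - \<Phi> h"
      unfolding \<Phi>_def using Henstock_Kurzweil_Integration.integral_combine[of 0 h "t + h" F] h t
      by (simp add: integrable_continuous_real contI algebra_simps eq_diff_eq)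
    finally show ?thesis .
  qed
  have \<Phi>0: "\<Phi> 0 = 0" by (simp add: \<Phi>_def)
  have F0: "apply_bcontfun (F 0) = f" using semigroup_op_0[OF fm] by (simp add: F fun_eq_iff)
  have "is_generator_value P X g (\<lambda>x. semigroup_op P X t f x - f x)"
    unfolding is_generator_value_def
  proof (rule uniform_limitI)
    fix e :: real assume e: "0 < e"
    \<comment> \<open>A quarter each for the derivative of \<open>\<Phi>\<close> at \<open>t\<close>
      and at \<open>0\<close>; the sum \<open>e / 2\<close> leaves room for the strict
      inequality.\<close>
    then have e4: "0 < e / 4" by simp
    from \<Phi>_deriv[OF t e4] \<Phi>_deriv[OF order_refl e4] eventually_at_right_less[of 0]
    show "\<forall>\<^sub>F h in at_right 0. \<forall>x\<in>UNIV. dist ((semigroup_op P X h g x - g x) / h) (semigroup_op P X t f x - f x) < e"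
    proof eventually_elim
      case (elim h)
      let ?D = "(\<Phi> (t + h) - \<Phi> h - \<Phi> t) - h *\<^sub>R (F t - F 0)"
      have "norm ?D = norm ((\<Phi> (t + h) - \<Phi> t - h *\<^sub>R F t) - (\<Phi> (0 + h) - \<Phi> 0 - h *\<^sub>R F 0))"
        by (simp add: \<Phi>0 algebra_simps)
      also have "\<dots> \<le> e / 4 * h + e / 4 * h"
        by (rule order_trans[OF norm_triangle_ineq4 add_mono[OF elim(1,2)]])
      finally have D: "norm ?D \<le> e / 2 * h" by simp
      show ?case
      proof
        fix x
        have "(semigroup_op P X h g x - g x) - h * (semigroup_op P X t f x - f x) = apply_bcontfun ?D x"
          using elim F[OF t] F0 by (simp add: Pg[unfolded g_def] g_def)
        then have "\<bar>(semigroup_op P X h g x - g x) - h * (semigroup_op P X t f x - f x)\<bar> \<le> e / 2 * h"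
          using norm_bounded[of ?D x] D by simp
        moreover have "(semigroup_op P X h g x - g x) / h - (semigroup_op P X t f x - f x) =
            ((semigroup_op P X h g x - g x) - h * (semigroup_op P X t f x - f x)) / h"
          using elim by (simp add: field_simps)
        ultimately have "\<bar>(semigroup_op P X h g x - g x) / h - (semigroup_op P X t f x - f x)\<bar> \<le> e / 2"
          using elim by (simp add: pos_divide_le_eq)
        then show "dist ((semigroup_op P X h g x - g x) / h) (semigroup_op P X t f x - f x) < e"
          using e by (simp add: dist_real_def)
      qed
    qed
  qed
  then show ?thesis using that[of g] g generator_eqI unfolding generator_dom_def by blast
qed

theorem corollary5p1:
  fixes M :: "'w measure"
    and P :: "real^'n::finite \<Rightarrow> 'w measure"
    and X :: "real \<Rightarrow> 'w \<Rightarrow> real^'n"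
    and a :: "real^'n \<Rightarrow> real^'n"
    and b :: "real^'n \<Rightarrow> real^'n^'n"
    and Q \<nu> \<mu> \<rho> :: "real^'n \<Rightarrow> (real^'n) measure"
    and \<eta> :: "(real^'n) measure"
  assumes "feller_process M P X"
    and "rich P X"
    and "levy_type_operator C_infty (generator_dom P X) (generator P X) a b Q"
    and "convenient_decomposition Q \<nu> \<mu> \<rho>"
    and "\<eta> \<in> M_space a b \<nu> \<mu> \<rho>"
    and "finite_measure \<eta>"
  shows "((\<exists>D. is_core D (generator_dom P X) (generator P X) \<and> D \<subseteq> C_c_infty) \<and>
            solves_equation a b \<nu> \<mu> \<rho> \<eta> \<longrightarrow> invariant_measure M P X \<eta>) \<and>
         (invariant_measure M P X \<eta> \<longrightarrow> solves_equation a b \<nu> \<mu> \<rho> \<eta>)"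
proof -
  let ?A = "generator P X" and ?DA = "generator_dom P X"
  have sets_\<eta>: "sets \<eta> = sets borel" using assms(5) by (simp add: M_space_def)
  have dom: "f \<in> ?DA" if "f \<in> C_c_infty" for f using assms(2) that by (auto simp: rich_def)
  have A_C_infty: "?A f \<in> C_infty" if "f \<in> ?DA" for f
    using assms(3) that by (simp add: levy_type_operator_def)
  have int_A: "integrable \<eta> (?A f)" if "f \<in> ?DA" for f
    using C_infty_integrable[OF A_C_infty[OF that] assms(6) sets_\<eta>] .
  have solves_iff: "solves_equation a b \<nu> \<mu> \<rho> \<eta> \<longleftrightarrow> (\<forall>f\<in>C_c_infty. (\<integral>x. ?A f x \<partial>\<eta>) = 0)"
    unfolding solves_equation_def
  proof (intro ball_cong refl)
    fix f :: "real^'n \<Rightarrow> real" assume f: "f \<in> C_c_infty"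
    \<comment> \<open>The operator has its classical form on \<open>C_k 2\<close>, which contains
      the test functions.\<close>
    then have "f \<in> ?DA \<inter> C_k 2" using dom by (auto simp: C_c_infty_def)
    with assms(3) have *: "integrable (Q x) (jump_integrand f x)" "?A f x = levy_expr a b Q f x" for x
      by (auto simp: levy_type_operator_def)
    have Q: "levy_kernel Q"
      using assms(3) by (simp add: levy_type_operator_def characteristic_triplet_def)
    show "(- drift_functional (\<lambda>x. a x + a_pi \<nu> \<mu> \<rho> x) \<eta> f + diffusion_functional b \<eta> f
        + U_functional \<nu> \<eta> f - div_V_functional \<mu> \<eta> f + H_W_functional \<rho> \<eta> f = 0) \<longleftrightarrow> (\<integral>x. ?A f x \<partial>\<eta>) = 0"
      unfolding *(2) integral_levy_expr[OF assms(5) f assms(4) Q *(1)] ..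
  qed
  interpret markov_process M P X using assms(1) by (simp add: feller_process_def)
  note inv_iff = invariant_measure_iff[OF assms(6) sets_\<eta>]
  have PC: "semigroup_op P X t f \<in> C_infty" if "f \<in> C_infty" "0 \<le> t" for f t
    using assms(1) that by (simp add: feller_process_def)
  have int: "integrable \<eta> f" if "f \<in> C_infty" for f :: "real^'n \<Rightarrow> real"
    using that assms(6) sets_\<eta> by (rule C_infty_integrable)
  show ?thesis
  proof (intro conjI impI)
    assume "(\<exists>D. is_core D ?DA ?A \<and> D \<subseteq> C_c_infty) \<and> solves_equation a b \<nu> \<mu> \<rho> \<eta>"
    then obtain D where D: "is_core D ?DA ?A" "D \<subseteq> C_c_infty"
      and zero: "\<And>f. f \<in> C_c_infty \<Longrightarrow> (\<integral>x. ?A f x \<partial>\<eta>) = 0"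
      unfolding solves_iff by blast
    \<comment> \<open>Approximation is in the graph sense: \<open>?A g\<close> itself is a uniform
      limit of functions with vanishing integral.\<close>
    have zero_dom: "(\<integral>x. ?A g x \<partial>\<eta>) = 0" if g: "g \<in> ?DA" for g
    proof -
      have "\<exists>F :: nat \<Rightarrow> real^'n \<Rightarrow> real. (\<forall>n. F n \<in> D) \<and> uniform_limit UNIV F g sequentially \<and>
          uniform_limit UNIV (\<lambda>n. ?A (F n)) (?A g) sequentially"
        using D(1) g unfolding is_core_def by metis
      then obtain F :: "nat \<Rightarrow> real^'n \<Rightarrow> real" where F: "\<And>n. F n \<in> D"
        and lim: "uniform_limit UNIV (\<lambda>n. ?A (F n)) (?A g) sequentially" by auto
      have F': "F n \<in> C_c_infty" for n using F D(2) by auto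
      have "(\<lambda>n. \<integral>x. ?A (F n) x \<partial>\<eta>) \<longlonglongrightarrow> (\<integral>x. ?A g x \<partial>\<eta>)"
        using lim assms(6) F' dom g int_A by (intro tendsto_integral_uniform_limit) auto
      then show ?thesis using zero[OF F'] by (simp add: LIMSEQ_const_iff)
    qed
    show "invariant_measure M P X \<eta>"
      unfolding inv_iff
    proof (intro allI impI ballI)
      fix t :: real and f :: "real^'n \<Rightarrow> real" assume t: "0 \<le> t" and f: "f \<in> C_infty"
      obtain g where g: "g \<in> ?DA" "?A g = (\<lambda>x. semigroup_op P X t f x - f x)"
        using generator_time_average[OF assms(1) f t] by metis
      from zero_dom[OF g(1)] show "(\<integral>x. semigroup_op P X t f x \<partial>\<eta>) = (\<integral>x. f x \<partial>\<eta>)"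
        using int[OF PC[OF f t]] int[OF f] by (simp add: g(2))
    qed
  next
    assume inv: "invariant_measure M P X \<eta>"
    show "solves_equation a b \<nu> \<mu> \<rho> \<eta>"
      unfolding solves_iff
    proof
      fix f :: "real^'n \<Rightarrow> real" assume "f \<in> C_c_infty"
      then have f: "f \<in> ?DA" "f \<in> C_infty" using dom C_c_infty_subset_C_infty by auto
      \<comment> \<open>The quotients converge uniformly, so finiteness of \<open>\<eta>\<close>
        suffices to pass to the limit under the integral.\<close>
      have "((\<lambda>t. \<integral>x. (semigroup_op P X t f x - f x) / t \<partial>\<eta>) \<longlongrightarrow> (\<integral>x. ?A f x \<partial>\<eta>)) (at_right 0)"
      proof (rule tendsto_integral_uniform_limit[OF _ assms(6) _ int_A[OF f(1)]])
        show "uniform_limit UNIV (\<lambda>t x. (semigroup_op P X t f x - f x) / t) (?A f) (at_right 0)"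
          using is_generator_value_generator[OF f(1)] by (simp add: is_generator_value_def)
        show "\<forall>\<^sub>F t in at_right 0. integrable \<eta> (\<lambda>x. (semigroup_op P X t f x - f x) / t)"
          using eventually_at_right_less[of "0::real"]
          by eventually_elim (use int f PC in auto)
      qed
      moreover have "\<forall>\<^sub>F t in at_right 0. (\<integral>x. (semigroup_op P X t f x - f x) / t \<partial>\<eta>) = 0"
        using eventually_at_right_less[of "0::real"]
      proof eventually_elim
        case (elim t)
        then show ?case using inv f int PC unfolding inv_iff by simp
      qed
      ultimately show "(\<integral>x. ?A f x \<partial>\<eta>) = 0"
        using tendsto_unique[OF trivial_limit_at_right_real _ tendsto_eventually] by blast
    qed
  qed
qed

end
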